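(* Let $G$ be a torsion-free (discrete) group and let $H \leqslant G$ be a subgroup. Let $\mathcal{A} = \{ G/H \}$, the family whose only member is the discrete $G$-space $G/H$ of left cosets with $G$ acting by left translation. Then $$\mathrm{secat}(H \hookrightarrow G) = \mathcal{A}\text{-}\mathrm{genus}(EG).$$
   Context: All groups are discrete. The sectional category $\mathrm{secat}(f)$ of a map $f\colon X\to Y$ is the smallest integer $n\ge 0$ such that there exist an open cover $U_0,\dots,U_n$ of $Y$ and continuous maps $s_i\colon U_i\to X$ with $f\circ s_i$ homotopic to the inclusion $U_i\hookrightarrow Y$ for each $i$ (and $\infty$ if no such $n$ exists). For a subgroup inclusion $\iota\colon H\hookrightarrow G$, let $K(\iota,1)\colon K(H,1)\to K(G,1)$ be the covering map (between Eilenberg--MacLane spaces) inducing $\iota$ on fundamental groups; define $\mathrm{secat}(H\hookrightarrow G):=\mathrm{secat}(K(\iota,1))$. For a family $\mathcal{A}$ of $G$-spaces and a $G$-space $X$, $\mathcal{A}\text{-}\mathrm{genus}(X)$ is the smallest integer $k\ge 0$ such that there is an open cover $\{U_0,\dots,U_k\}$ of $X$ by $G$-invariant subsets such that for every $0\le i\le k$ there exist $A_i\in\mathcal{A}$ and a $G$-equivariant map $U_i\to A_i$ (and $\infty$ if no such $k$ exists). $EG$ denotes a contractible free $G$-CW complex (the universal cover of a $K(G,1)$ CW complex). *)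

theory Defs
  imports
    "HOL-Analysis.Analysis"
    "HOL-Algebra.Group_Action"
    "HOL-Algebra.Left_Coset"
    "HOL-Library.Extended_Nat"
begin

section \<open>Sectional category\<close>

text \<open>The infimum is taken in \<open>enat\<close>, where \<open>Inf {} = \<infinity>\<close>.\<close>

definition secat :: "'a topology \<Rightarrow> 'b topology \<Rightarrow> ('a \<Rightarrow> 'b) \<Rightarrow> enat" where
  "secat X Y f = Inf (enat ` {n. \<exists>U.
     (\<forall>i\<le>n. openin Y (U i)) \<and> (\<Union>i\<le>n. U i) = topspace Y \<and>
     (\<forall>i\<le>n. \<exists>s. continuous_map (subtopology Y (U i)) X s \<and>
                 homotopic_with (\<lambda>_. True) (subtopology Y (U i)) Y (f \<circ> s) id)})"


section \<open>The fundamental group and the higher homotopy groups\<close>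

definition loop_homotopic :: "'a topology \<Rightarrow> 'a \<Rightarrow> (real \<Rightarrow> 'a) \<Rightarrow> (real \<Rightarrow> 'a) \<Rightarrow> bool" where
  "loop_homotopic X x = homotopic_with (\<lambda>r. r 0 = x \<and> r 1 = x) (top_of_set {0..1}) X"

definition loop_class :: "'a topology \<Rightarrow> 'a \<Rightarrow> (real \<Rightarrow> 'a) \<Rightarrow> (real \<Rightarrow> 'a) set" where
  "loop_class X x p = {q. loop_homotopic X x p q}"

text \<open>This is \<^const>\<open>joinpaths\<close> without its sort constraint \<open>topological_space\<close>.\<close>

definition path_concat :: "(real \<Rightarrow> 'a) \<Rightarrow> (real \<Rightarrow> 'a) \<Rightarrow> real \<Rightarrow> 'a" where
  "path_concat p q = (\<lambda>t. if t \<le> 1/2 then p (2 * t) else q (2 * t - 1))"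

definition fundamental_group :: "'a topology \<Rightarrow> 'a \<Rightarrow> (real \<Rightarrow> 'a) set monoid" where
  "fundamental_group X x =
     \<lparr>carrier = loop_class X x ` {p. pathin X p \<and> p 0 = x \<and> p 1 = x},
      mult = (\<lambda>A B. {r. \<exists>p\<in>A. \<exists>q\<in>B. loop_homotopic X x (path_concat p q) r}),
      one = loop_class X x (\<lambda>_. x)\<rparr>"

text \<open>The map on fundamental groups induced by \<open>f\<close>, into the fundamental group of \<open>(Y, y)\<close>.\<close>

definition induced_map ::
    "'b topology \<Rightarrow> 'b \<Rightarrow> ('a \<Rightarrow> 'b) \<Rightarrow> (real \<Rightarrow> 'a) set \<Rightarrow> (real \<Rightarrow> 'b) set" where
  "induced_map Y y f A = {r. \<exists>p\<in>A. loop_homotopic Y y (f \<circ> p) r}"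

definition sphere_base :: "nat \<Rightarrow> real" where
  "sphere_base = (\<lambda>i. if i = 0 then 1 else 0)"

text \<open>Triviality of the set of pointed homotopy classes of pointed maps from the \<open>n\<close>-sphere
  to \<open>(X, x)\<close>.\<close>

definition trivial_homotopy_group :: "nat \<Rightarrow> 'a topology \<Rightarrow> 'a \<Rightarrow> bool" where
  "trivial_homotopy_group n X x \<longleftrightarrow>
     (\<forall>f. continuous_map (nsphere n) X f \<and> f sphere_base = x \<longrightarrow>
          homotopic_with (\<lambda>h. h sphere_base = x) (nsphere n) X f (\<lambda>_. x))"


section \<open>CW complexes\<close>

text \<open>Discs, open discs and their bounding spheres in \<open>\<real>\<^sup>n\<close>, modelled as in
  \<^const>\<open>Euclidean_space\<close> by sequences that vanish from index \<open>n\<close> on. For \<open>n = 0\<close> the disc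
  and the open disc are a point and the bounding sphere is empty.\<close>

definition disc :: "nat \<Rightarrow> (nat \<Rightarrow> real) topology" where
  "disc n = subtopology (Euclidean_space n) {x. (\<Sum>i<n. (x i)\<^sup>2) \<le> 1}"

definition open_disc :: "nat \<Rightarrow> (nat \<Rightarrow> real) topology" where
  "open_disc n = subtopology (Euclidean_space n) {x. (\<Sum>i<n. (x i)\<^sup>2) < 1}"

definition disc_boundary :: "nat \<Rightarrow> (nat \<Rightarrow> real) set" where
  "disc_boundary n = {x \<in> topspace (Euclidean_space n). (\<Sum>i<n. (x i)\<^sup>2) = 1}"

text \<open>Whitehead's definition. \<open>\<C>\<close> is the set of open cells (which thus serve as their own
  indices), \<open>d C\<close> is the dimension of the cell \<open>C\<close>, and \<open>\<Phi> C\<close> is its characteristic map; the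
  image of the closed disc under \<open>\<Phi> C\<close> is the closed cell. The last two clauses are closure
  finiteness and the weak topology.\<close>

definition CW_structure ::
    "'a topology \<Rightarrow> 'a set set \<Rightarrow> ('a set \<Rightarrow> nat) \<Rightarrow> ('a set \<Rightarrow> (nat \<Rightarrow> real) \<Rightarrow> 'a) \<Rightarrow> bool" where
  "CW_structure X \<C> d \<Phi> \<longleftrightarrow>
     Hausdorff_space X \<and> \<Union>\<C> = topspace X \<and> pairwise disjnt \<C> \<and>
     (\<forall>C\<in>\<C>. continuous_map (disc (d C)) X (\<Phi> C) \<and>
             homeomorphic_map (open_disc (d C)) (subtopology X C) (\<Phi> C)) \<and>
     (\<forall>C\<in>\<C>. \<exists>\<F>. finite \<F> \<and> \<F> \<subseteq> {B\<in>\<C>. d B < d C} \<and> \<Phi> C ` disc_boundary (d C) \<subseteq> \<Union>\<F>) \<and>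
     (\<forall>S. S \<subseteq> topspace X \<and> (\<forall>C\<in>\<C>. closedin X (S \<inter> \<Phi> C ` topspace (disc (d C))))
          \<longrightarrow> closedin X S)"

definition CW_complex :: "'a topology \<Rightarrow> bool" where
  "CW_complex X \<longleftrightarrow> (\<exists>\<C> d \<Phi>. CW_structure X \<C> d \<Phi>)"


section \<open>Eilenberg--MacLane spaces and the covering realising a subgroup inclusion\<close>

definition covering_map :: "'a topology \<Rightarrow> 'b topology \<Rightarrow> ('a \<Rightarrow> 'b) \<Rightarrow> bool" where
  "covering_map X Y p \<longleftrightarrow>
     continuous_map X Y p \<and> p ` topspace X = topspace Y \<and>
     (\<forall>y\<in>topspace Y. \<exists>U. openin Y U \<and> y \<in> U \<and>
        (\<exists>\<V>. \<Union>\<V> = {x \<in> topspace X. p x \<in> U} \<and> pairwise disjnt \<V> \<and>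
             (\<forall>V\<in>\<V>. openin X V \<and> homeomorphic_map (subtopology X V) (subtopology Y U) p)))"

text \<open>\<open>X\<close> is a \<open>K(G,1)\<close> CW complex, with \<open>\<phi>\<close> identifying its fundamental group at \<open>x\<close>
  with \<open>G\<close>.\<close>

definition eilenberg_maclane ::
    "('g, 'm) monoid_scheme \<Rightarrow> 'a topology \<Rightarrow> 'a \<Rightarrow> ((real \<Rightarrow> 'a) set \<Rightarrow> 'g) \<Rightarrow> bool" where
  "eilenberg_maclane G X x \<phi> \<longleftrightarrow>
     CW_complex X \<and> path_connected_space X \<and> x \<in> topspace X \<and>
     \<phi> \<in> iso (fundamental_group X x) G \<and>
     (\<forall>n\<ge>2. \<forall>z\<in>topspace X. trivial_homotopy_group n X z)"

text \<open>\<open>p\<close> is a model of \<open>K(\<iota>,1) : K(H,1) \<rightarrow> K(G,1)\<close> for the inclusion \<open>\<iota>\<close> of \<open>H\<close> into \<open>G\<close>: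
  a covering map that becomes \<open>\<iota>\<close> under the identifications of the fundamental groups with
  \<open>H\<close> and \<open>G\<close>.\<close>

definition inclusion_covering ::
    "('g, 'm) monoid_scheme \<Rightarrow> 'g set \<Rightarrow> 'a topology \<Rightarrow> 'b topology \<Rightarrow> ('a \<Rightarrow> 'b) \<Rightarrow> bool" where
  "inclusion_covering G H X Y p \<longleftrightarrow>
     covering_map X Y p \<and>
     (\<exists>x y \<phi> \<psi>. eilenberg_maclane (G\<lparr>carrier := H\<rparr>) X x \<phi> \<and> eilenberg_maclane G Y y \<psi> \<and>
        p x = y \<and>
        (\<forall>A\<in>carrier (fundamental_group X x). \<psi> (induced_map Y y p A) = \<phi> A))"


section \<open>Spaces with a group action, and the genus\<close>

text \<open>Groups are discrete, so continuity of the action means that every group element acts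
  continuously.\<close>

definition G_space ::
    "('g, 'm) monoid_scheme \<Rightarrow> 'a topology \<Rightarrow> ('g \<Rightarrow> 'a \<Rightarrow> 'a) \<Rightarrow> bool" where
  "G_space G X \<alpha> \<longleftrightarrow>
     group_action G (topspace X) \<alpha> \<and> (\<forall>g\<in>carrier G. continuous_map X X (\<alpha> g))"

definition genus ::
    "('g, 'm) monoid_scheme \<Rightarrow> ('c topology \<times> ('g \<Rightarrow> 'c \<Rightarrow> 'c)) set \<Rightarrow>
     'a topology \<Rightarrow> ('g \<Rightarrow> 'a \<Rightarrow> 'a) \<Rightarrow> enat" where
  "genus G \<A> X \<alpha> = Inf (enat ` {k. \<exists>U.
     (\<forall>i\<le>k. openin X (U i) \<and> (\<forall>g\<in>carrier G. \<alpha> g ` U i \<subseteq> U i)) \<and>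
     (\<Union>i\<le>k. U i) = topspace X \<and>
     (\<forall>i\<le>k. \<exists>(A, \<beta>)\<in>\<A>. \<exists>f. continuous_map (subtopology X (U i)) A f \<and>
                 (\<forall>g\<in>carrier G. \<forall>u\<in>U i. f (\<alpha> g u) = \<beta> g (f u)))})"

text \<open>For a discrete group, a \<open>G\<close>-CW complex is the same as a \<open>G\<close>-space with a CW structure
  whose open cells are permuted by \<open>G\<close>, such that a group element mapping a cell to itself
  fixes it pointwise; the orbit of an \<open>n\<close>-cell with stabiliser \<open>K\<close> is then an equivariant
  cell of type \<open>G/K \<times> D\<^sup>n\<close>.\<close>

definition G_CW_complex ::
    "('g, 'm) monoid_scheme \<Rightarrow> 'a topology \<Rightarrow> ('g \<Rightarrow> 'a \<Rightarrow> 'a) \<Rightarrow> bool" where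
  "G_CW_complex G X \<alpha> \<longleftrightarrow> G_space G X \<alpha> \<and>
     (\<exists>\<C> d \<Phi>. CW_structure X \<C> d \<Phi> \<and>
        (\<forall>g\<in>carrier G. \<forall>C\<in>\<C>. \<alpha> g ` C \<in> \<C> \<and> d (\<alpha> g ` C) = d C \<and>
           (\<alpha> g ` C = C \<longrightarrow> (\<forall>x\<in>C. \<alpha> g x = x))))"

text \<open>A contractible free \<open>G\<close>-CW complex. Nonemptiness is explicit because the empty space
  satisfies \<^const>\<open>contractible_space\<close>.\<close>

definition is_EG ::
    "('g, 'm) monoid_scheme \<Rightarrow> 'a topology \<Rightarrow> ('g \<Rightarrow> 'a \<Rightarrow> 'a) \<Rightarrow> bool" where
  "is_EG G E \<alpha> \<longleftrightarrow> G_CW_complex G E \<alpha> \<and> contractible_space E \<and> topspace E \<noteq> {} \<and>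
     (\<forall>g\<in>carrier G. \<forall>x\<in>topspace E. \<alpha> g x = x \<longrightarrow> g = \<one>\<^bsub>G\<^esub>)"


section \<open>Torsion-free groups and coset spaces\<close>

definition torsion_free :: "('g, 'm) monoid_scheme \<Rightarrow> bool" where
  "torsion_free G \<longleftrightarrow>
     (\<forall>g\<in>carrier G. \<forall>n::nat. n > 0 \<and> g [^]\<^bsub>G\<^esub> n = \<one>\<^bsub>G\<^esub> \<longrightarrow> g = \<one>\<^bsub>G\<^esub>)"

text \<open>Left translation on \<open>G/H\<close>; \<^const>\<open>group_action\<close> requires it to be extensional.\<close>

definition left_translation ::
    "('g, 'm) monoid_scheme \<Rightarrow> 'g set \<Rightarrow> 'g \<Rightarrow> 'g set \<Rightarrow> 'g set" where
  "left_translation G H g = (\<lambda>C\<in>lcosets\<^bsub>G\<^esub> H. g <#\<^bsub>G\<^esub> C)"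

lemma G_space_coset_space:
  assumes "group G" and "subgroup H G"
  shows "G_space G (discrete_topology (lcosets\<^bsub>G\<^esub> H)) (left_translation G H)"
proof -
  interpret G: group G by fact
  have HG: "H \<subseteq> carrier G"
    using assms(2) by (rule subgroup.subset)
  have coset: "\<exists>a\<in>carrier G. C = a <#\<^bsub>G\<^esub> H" if "C \<in> lcosets\<^bsub>G\<^esub> H" for C
    using that by (auto simp: LCOSETS_def)
  have closed: "g <#\<^bsub>G\<^esub> C \<in> lcosets\<^bsub>G\<^esub> H" if "g \<in> carrier G" "C \<in> lcosets\<^bsub>G\<^esub> H" for g C
    using coset[OF that(2)] that(1) HG by (auto simp: LCOSETS_def G.lcos_m_assoc)
  have sub: "C \<subseteq> carrier G" if "C \<in> lcosets\<^bsub>G\<^esub> H" for C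
    using coset[OF that] HG G.l_coset_subset_G by auto
  have mult: "g <#\<^bsub>G\<^esub> (h <#\<^bsub>G\<^esub> C) = (g \<otimes>\<^bsub>G\<^esub> h) <#\<^bsub>G\<^esub> C"
    if "g \<in> carrier G" "h \<in> carrier G" "C \<in> lcosets\<^bsub>G\<^esub> H" for g h C
    using that sub by (simp add: G.lcos_m_assoc)
  have one: "\<one>\<^bsub>G\<^esub> <#\<^bsub>G\<^esub> C = C" if "C \<in> lcosets\<^bsub>G\<^esub> H" for C
    using sub[OF that] by (simp add: G.lcos_mult_one)
  have Bij: "left_translation G H g \<in> Bij (lcosets\<^bsub>G\<^esub> H)" if g: "g \<in> carrier G" for g
  proof -
    have "bij_betw (left_translation G H g) (lcosets\<^bsub>G\<^esub> H) (lcosets\<^bsub>G\<^esub> H)"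
      by (rule bij_betw_byWitness[where f' = "\<lambda>C. inv\<^bsub>G\<^esub> g <#\<^bsub>G\<^esub> C"])
        (use g in \<open>auto simp: left_translation_def closed mult one\<close>)
    then show ?thesis
      by (auto simp: Bij_def left_translation_def)
  qed
  have "left_translation G H \<in> hom G (BijGroup (lcosets\<^bsub>G\<^esub> H))"
  proof (rule homI)
    fix g h assume gh: "g \<in> carrier G" "h \<in> carrier G"
    have "left_translation G H (g \<otimes>\<^bsub>G\<^esub> h)
        = compose (lcosets\<^bsub>G\<^esub> H) (left_translation G H g) (left_translation G H h)"
      using gh by (auto simp: left_translation_def compose_def fun_eq_iff restrict_def closed mult)
    then show "left_translation G H (g \<otimes>\<^bsub>G\<^esub> h) = left_translation G H g
        \<otimes>\<^bsub>BijGroup (lcosets\<^bsub>G\<^esub> H)\<^esub> left_translation G H h"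
      using gh Bij by (simp add: BijGroup_def)
  qed (simp add: BijGroup_def Bij)
  then have "group_action G (lcosets\<^bsub>G\<^esub> H) (left_translation G H)"
    by (simp add: group_action_def group_hom_def group_hom_axioms_def group_BijGroup assms(1))
  moreover have "continuous_map (discrete_topology (lcosets\<^bsub>G\<^esub> H))
      (discrete_topology (lcosets\<^bsub>G\<^esub> H)) (left_translation G H g)" if "g \<in> carrier G" for g
    using that closed by (auto simp: left_translation_def)
  ultimately show ?thesis
    by (simp add: G_space_def)
qed

end

theory Submission
  imports Defs
begin

text \<open>Write \<open>Y\<close> for \<open>K(G,1)\<close> and \<open>p : X \<rightarrow> Y\<close> for the covering with fundamental group \<open>H\<close>.

  Homotopies lift through a covering, so a local section of \<open>p\<close> up to homotopy can be deformed into a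
  strict one: \<open>secat\<close> counts open sets over which \<open>p\<close> has sections (\<open>covering_strict_section_iff\<close>).

  Let \<open>P\<close> be the universal cover of \<open>Y\<close>, on which \<open>G\<close> acts by deck transformations. Then \<open>X\<close> is the orbit
  space \<open>P/H\<close>, so that a section of \<open>p\<close> over \<open>U\<close> is the same as an equivariant map to \<open>G/H\<close> from the
  preimage of \<open>U\<close> in \<open>P\<close>, and the invariant subsets of \<open>P\<close> are exactly such preimages. Hence \<open>secat(p)\<close> is
  the genus of \<open>P\<close> (\<open>sections_le_iff_genus_le\<close>).

  The genus does not increase when it is pulled back along an equivariant map. Between \<open>P\<close> and any
  \<open>EG\<close> there are equivariant maps in both directions: each is built from free cells, and in each every
  map from a sphere extends over the disc, so that a map can be constructed cell by cell, choosing it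
  on one cell of each orbit (\<open>equivariant_map_exists\<close>). Hence the two genera agree.

  What remains is that \<open>P\<close> exists and has these properties. Its points are the homotopy classes of
  paths in \<open>Y\<close> from the base point. That the endpoint map is a covering needs \<open>Y\<close> to be locally path
  connected, which passes from discs to quotients of sums of discs, and semilocally simply connected:
  an open cell, thickened radially through the cells of higher dimension, is an open set whose loops
  contract in \<open>Y\<close> (\<open>thick\<close>). The cells of \<open>Y\<close> lift to free cells of \<open>P\<close>. Spheres in \<open>P\<close> can be filled because \<open>P\<close> is
  simply connected and the higher homotopy groups of \<open>Y\<close> vanish.\<close>


section \<open>Lifting through covering maps\<close>

lemma continuous_map_in_topspace: "continuous_map X Y f \<Longrightarrow> x \<in> topspace X \<Longrightarrow> f x \<in> topspace Y"
  by (auto simp: continuous_map_def)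

lemma covering_map_imp_continuous: "covering_map X Y p \<Longrightarrow> continuous_map X Y p"
  by (simp add: covering_map_def)

lemma covering_map_in_topspace: "covering_map X Y p \<Longrightarrow> x \<in> topspace X \<Longrightarrow> p x \<in> topspace Y"
  by (auto simp: covering_map_def)

text \<open>Working with the inverse of \<open>p\<close> on a sheet, instead of with the sheets themselves, turns
  local lifting into composition.\<close>

lemma covering_map_evenly_covered:
  assumes p: "covering_map X Y p" and y: "y \<in> topspace Y"
  obtains U where "openin Y U" "y \<in> U"
    "\<And>x. x \<in> topspace X \<Longrightarrow> p x \<in> U \<Longrightarrow>
      \<exists>V \<sigma>. openin X V \<and> x \<in> V \<and> continuous_map (subtopology Y U) X \<sigma> \<and>
        (\<forall>v\<in>V. p v \<in> U \<and> \<sigma> (p v) = v) \<and> (\<forall>u\<in>U. \<sigma> u \<in> V \<and> p (\<sigma> u) = u)"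
proof -
  obtain U \<V> where U: "openin Y U" "y \<in> U"
    and \<V>: "\<Union>\<V> = {x \<in> topspace X. p x \<in> U}" "\<And>V. V \<in> \<V> \<Longrightarrow> openin X V"
      "\<And>V. V \<in> \<V> \<Longrightarrow> homeomorphic_map (subtopology X V) (subtopology Y U) p"
    using p y unfolding covering_map_def by meson
  have "\<exists>V \<sigma>. openin X V \<and> x \<in> V \<and> continuous_map (subtopology Y U) X \<sigma> \<and>
        (\<forall>v\<in>V. p v \<in> U \<and> \<sigma> (p v) = v) \<and> (\<forall>u\<in>U. \<sigma> u \<in> V \<and> p (\<sigma> u) = u)"
    if x: "x \<in> topspace X" "p x \<in> U" for x
  proof -
    obtain V where V: "V \<in> \<V>" "x \<in> V" using \<V>(1) x by blast
    obtain \<sigma> where \<sigma>: "homeomorphic_maps (subtopology X V) (subtopology Y U) p \<sigma>"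
      using \<V>(3)[OF V(1)] by (auto simp: homeomorphic_map_maps)
    have sub: "V \<subseteq> topspace X" "U \<subseteq> topspace Y"
      using \<V>(2)[OF V(1)] U(1) openin_subset by auto
    have \<sigma>im: "\<sigma> u \<in> V" if "u \<in> U" for u
      using \<sigma> that sub unfolding homeomorphic_maps_def continuous_map_def by fastforce
    have pim: "p v \<in> U" if "v \<in> V" for v
      using \<V>(1) V(1) that by blast
    have "continuous_map (subtopology Y U) X \<sigma>"
      using \<sigma> continuous_map_in_subtopology unfolding homeomorphic_maps_def by blast
    moreover have "\<forall>v\<in>V. p v \<in> U \<and> \<sigma> (p v) = v" "\<forall>u\<in>U. \<sigma> u \<in> V \<and> p (\<sigma> u) = u"
      using \<sigma> sub \<sigma>im pim unfolding homeomorphic_maps_def by auto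
    ultimately show ?thesis using V \<V>(2) by blast
  qed
  then show thesis using that U by blast
qed

lemma covering_map_separates_fibre:
  assumes p: "covering_map X Y p" and x: "x \<in> topspace X" "x' \<in> topspace X" "p x = p x'" "x \<noteq> x'"
  obtains V V' where "openin X V" "openin X V'" "x \<in> V" "x' \<in> V'" "disjnt V V'"
proof -
  have "p x \<in> topspace Y" using covering_map_in_topspace[OF p] x by blast
  then obtain U \<V> where U: "openin Y U" "p x \<in> U"
    and \<V>: "\<Union>\<V> = {x \<in> topspace X. p x \<in> U}" "\<And>V. V \<in> \<V> \<Longrightarrow> openin X V" "pairwise disjnt \<V>"
      "\<And>V. V \<in> \<V> \<Longrightarrow> homeomorphic_map (subtopology X V) (subtopology Y U) p"
    using p unfolding covering_map_def by meson
  obtain V V' where V: "V \<in> \<V>" "x \<in> V" "V' \<in> \<V>" "x' \<in> V'"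
    using \<V>(1) x U(2) by (smt (verit, best) UnionE mem_Collect_eq)
  have "V \<noteq> V'"
    using homeomorphic_imp_injective_map[OF \<V>(4)[OF V(1)]] x V by (auto simp: inj_on_def)
  then show thesis using that V \<V>(2,3) by (metis pairwiseD)
qed

lemma openin_lifts_agree:
  assumes p: "covering_map X Y p" and f: "continuous_map Z X f" and g: "continuous_map Z X g"
    and fg: "\<And>z. z \<in> topspace Z \<Longrightarrow> p (f z) = p (g z)"
  shows "openin Z {z \<in> topspace Z. f z = g z}"
proof (subst openin_subopen, intro ballI)
  fix z assume "z \<in> {z \<in> topspace Z. f z = g z}"
  then have z: "z \<in> topspace Z" "f z = g z" by auto
  have fz: "f z \<in> topspace X" using continuous_map_in_topspace[OF f z(1)] .
  obtain U where U: "openin Y U" "p (f z) \<in> U"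
     "\<And>x. x \<in> topspace X \<Longrightarrow> p x \<in> U \<Longrightarrow>
      \<exists>V \<sigma>. openin X V \<and> x \<in> V \<and> continuous_map (subtopology Y U) X \<sigma> \<and>
        (\<forall>v\<in>V. p v \<in> U \<and> \<sigma> (p v) = v) \<and> (\<forall>u\<in>U. \<sigma> u \<in> V \<and> p (\<sigma> u) = u)"
    using covering_map_evenly_covered[OF p covering_map_in_topspace[OF p fz]] by blast
  then obtain V \<sigma> where V: "openin X V" "f z \<in> V" "\<And>v. v \<in> V \<Longrightarrow> \<sigma> (p v) = v"
    using fz by meson
  let ?T = "{z \<in> topspace Z. f z \<in> V} \<inter> {z \<in> topspace Z. g z \<in> V}"
  have "openin Z ?T"
    using f g V(1) by (intro openin_Int openin_continuous_map_preimage)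
  moreover have "?T \<subseteq> {z \<in> topspace Z. f z = g z}"
    using V(3) fg by (auto, metis)
  ultimately show "\<exists>T. openin Z T \<and> z \<in> T \<and> T \<subseteq> {z \<in> topspace Z. f z = g z}"
    using z V(2) by (intro exI[of _ ?T]) auto
qed

lemma openin_lifts_disagree:
  assumes p: "covering_map X Y p" and f: "continuous_map Z X f" and g: "continuous_map Z X g"
    and fg: "\<And>z. z \<in> topspace Z \<Longrightarrow> p (f z) = p (g z)"
  shows "openin Z {z \<in> topspace Z. f z \<noteq> g z}"
proof (subst openin_subopen, intro ballI)
  fix z assume "z \<in> {z \<in> topspace Z. f z \<noteq> g z}"
  then have z: "z \<in> topspace Z" "f z \<noteq> g z" by auto
  have "f z \<in> topspace X" "g z \<in> topspace X" using f g z continuous_map_in_topspace by metis+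
  then obtain V V' where V: "openin X V" "openin X V'" "f z \<in> V" "g z \<in> V'" "disjnt V V'"
    using covering_map_separates_fibre[OF p] z fg by metis
  let ?T = "{z \<in> topspace Z. f z \<in> V} \<inter> {z \<in> topspace Z. g z \<in> V'}"
  have "openin Z ?T"
    using f g V(1,2) by (intro openin_Int openin_continuous_map_preimage)
  moreover have "?T \<subseteq> {z \<in> topspace Z. f z \<noteq> g z}"
    using V(5) by (auto simp: disjnt_iff)
  ultimately show "\<exists>T. openin Z T \<and> z \<in> T \<and> T \<subseteq> {z \<in> topspace Z. f z \<noteq> g z}"
    using z V(3,4) by (intro exI[of _ ?T]) auto
qed

lemma lifts_equal:
  assumes p: "covering_map X Y p" and f: "continuous_map Z X f" and g: "continuous_map Z X g"
    and fg: "\<And>z. z \<in> topspace Z \<Longrightarrow> p (f z) = p (g z)"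
    and Z: "connected_space Z" and z0: "z0 \<in> topspace Z" "f z0 = g z0" and z: "z \<in> topspace Z"
  shows "f z = g z"
proof (rule ccontr)
  assume ne: "f z \<noteq> g z"
  let ?A = "{z \<in> topspace Z. f z = g z}" and ?B = "{z \<in> topspace Z. f z \<noteq> g z}"
  have "openin Z ?A" "openin Z ?B" "topspace Z \<subseteq> ?A \<union> ?B" "?A \<inter> ?B = {}"
    using openin_lifts_agree[OF p f g fg] openin_lifts_disagree[OF p f g fg] by auto
  then have "?A = {} \<or> ?B = {}"
    using Z unfolding connected_space_def by meson
  then show False using z0 z ne by blast
qed

text \<open>The interval is subdivided, by compactness, into pieces that \<open>h\<close> sends into one evenly covered set
  near \<open>z0\<close>; on such a piece the lift is \<open>h\<close> followed by the inverse of the covering on the right sheet.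
  The neighbourhood of \<open>z0\<close> shrinks finitely often.\<close>

lemma lift_homotopy_locally:
  assumes p: "covering_map X Y p"
    and h: "continuous_map (prod_topology (top_of_set {0..1}) Z) Y h"
    and s: "continuous_map Z X s" "\<And>z. z \<in> topspace Z \<Longrightarrow> p (s z) = h (0, z)"
    and z0: "z0 \<in> topspace Z"
  obtains M H where "openin Z M" "z0 \<in> M"
    "continuous_map (subtopology (prod_topology (top_of_set {0..1::real}) Z) ({0..1} \<times> M)) X H"
    "\<And>t z. t \<in> {0..1} \<Longrightarrow> z \<in> M \<Longrightarrow> p (H (t, z)) = h (t, z)"
    "\<And>z. z \<in> M \<Longrightarrow> H (0, z) = s z"
proof -
  define W where "W = prod_topology (top_of_set {0..1::real}) Z"
  have topW: "topspace W = {0..1} \<times> topspace Z" by (simp add: W_def)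
  have fstW: "continuous_map W euclideanreal fst"
    unfolding W_def using continuous_map_fst continuous_map_in_subtopology by blast
  define P where "P = (\<lambda>a b::real. 0 \<le> a \<and> b \<le> 1 \<longrightarrow> (\<forall>N s. openin Z N \<and> z0 \<in> N \<and>
      continuous_map (subtopology Z N) X s \<and> (\<forall>z\<in>N. p (s z) = h (a, z)) \<longrightarrow>
      (\<exists>M H. openin Z M \<and> z0 \<in> M \<and> M \<subseteq> N \<and>
         continuous_map (subtopology W ({a..b} \<times> M)) X H \<and>
         (\<forall>t\<in>{a..b}. \<forall>z\<in>M. p (H (t, z)) = h (t, z)) \<and> (\<forall>z\<in>M. H (a, z) = s z))))"
  \<comment> \<open>A property of intervals that is inherited by unions of adjacent intervals and holds for all
    short ones around each point holds for the whole interval.\<close>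
  have "P 0 1"
  proof (rule Bolzano)
    show "(0::real) \<le> 1" by simp
  next
    fix a b c :: real
    assume ab: "P a b" and bc: "P b c" and le: "a \<le> b" "b \<le> c"
    show "P a c"
      unfolding P_def
    proof (intro impI allI)
      fix N s
      assume ac: "0 \<le> a \<and> c \<le> 1"
        and N: "openin Z N \<and> z0 \<in> N \<and> continuous_map (subtopology Z N) X s \<and>
          (\<forall>z\<in>N. p (s z) = h (a, z))"
      have "0 \<le> a \<and> b \<le> 1" "0 \<le> b \<and> c \<le> 1" using ac le by auto
      then obtain M H where M: "openin Z M" "z0 \<in> M" "M \<subseteq> N"
         and H: "continuous_map (subtopology W ({a..b} \<times> M)) X H"
           "\<forall>t\<in>{a..b}. \<forall>z\<in>M. p (H (t, z)) = h (t, z)" "\<forall>z\<in>M. H (a, z) = s z"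
        using spec[OF spec[OF mp[OF ab[unfolded P_def]], of N], of s] N by auto
      have MZ: "M \<subseteq> topspace Z" using M(1) openin_subset by blast
      have 1: "continuous_map (subtopology Z M) (subtopology W ({a..b} \<times> M)) (\<lambda>z. (b, z))"
        unfolding W_def continuous_map_in_subtopology continuous_map_pairwise o_def
        using ac le MZ by (auto intro!: continuous_map_from_subtopology)
      have "continuous_map (subtopology Z M) X (\<lambda>z. H (b, z))"
        using continuous_map_compose[OF 1 H(1)] by (simp add: o_def)
      moreover have "\<forall>z\<in>M. p (H (b, z)) = h (b, z)" using H(2) le by auto
      ultimately obtain M' H' where M': "openin Z M'" "z0 \<in> M'" "M' \<subseteq> M"
         and H': "continuous_map (subtopology W ({b..c} \<times> M')) X H'"
           "\<forall>t\<in>{b..c}. \<forall>z\<in>M'. p (H' (t, z)) = h (t, z)" "\<forall>z\<in>M'. H' (b, z) = H (b, z)"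
        using spec[OF spec[OF mp[OF bc[unfolded P_def] \<open>0 \<le> b \<and> c \<le> 1\<close>], of M], of "\<lambda>z. H (b, z)"] M
        by auto
      have M'Z: "M' \<subseteq> topspace Z" using M'(1) openin_subset by blast
      let ?K = "\<lambda>w. if fst w \<le> b then H w else H' w"
      have "continuous_map (subtopology W ({a..c} \<times> M')) X ?K"
      proof (rule continuous_map_cases_le)
        show "continuous_map (subtopology W ({a..c} \<times> M')) euclideanreal fst"
          using fstW continuous_map_from_subtopology by blast
        show "continuous_map (subtopology (subtopology W ({a..c} \<times> M'))
            {w \<in> topspace (subtopology W ({a..c} \<times> M')). fst w \<le> b}) X H"
          unfolding subtopology_subtopology
          by (rule continuous_map_from_subtopology_mono[OF H(1)]) (use M' in auto)
        show "continuous_map (subtopology (subtopology W ({a..c} \<times> M'))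
            {w \<in> topspace (subtopology W ({a..c} \<times> M')). b \<le> fst w}) X H'"
          unfolding subtopology_subtopology
          by (rule continuous_map_from_subtopology_mono[OF H'(1)]) auto
      qed (use H'(3) in auto)
      moreover have "\<forall>t\<in>{a..c}. \<forall>z\<in>M'. p (?K (t, z)) = h (t, z)"
        using H(2) H'(2) M'(3) by auto
      moreover have "\<forall>z\<in>M'. ?K (a, z) = s z"
        using H(3) M'(3) le by auto
      ultimately show "\<exists>M H. openin Z M \<and> z0 \<in> M \<and> M \<subseteq> N \<and>
         continuous_map (subtopology W ({a..c} \<times> M)) X H \<and>
         (\<forall>t\<in>{a..c}. \<forall>z\<in>M. p (H (t, z)) = h (t, z)) \<and> (\<forall>z\<in>M. H (a, z) = s z)"
        using M' M by (intro exI[of _ M'] exI[of _ ?K]) auto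
    qed
  next
    fix x :: real assume x: "0 \<le> x" "x \<le> 1"
    then have xz: "(x, z0) \<in> topspace W" using z0 by (simp add: topW)
    then have "h (x, z0) \<in> topspace Y" using h unfolding W_def continuous_map_def by blast
    then obtain U where U: "openin Y U" "h (x, z0) \<in> U"
       "\<And>x. x \<in> topspace X \<Longrightarrow> p x \<in> U \<Longrightarrow>
        \<exists>V \<sigma>. openin X V \<and> x \<in> V \<and> continuous_map (subtopology Y U) X \<sigma> \<and>
          (\<forall>v\<in>V. p v \<in> U \<and> \<sigma> (p v) = v) \<and> (\<forall>u\<in>U. \<sigma> u \<in> V \<and> p (\<sigma> u) = u)"
      using covering_map_evenly_covered[OF p] by blast
    have opW: "openin W {w \<in> topspace W. h w \<in> U}"
      using h U(1) unfolding W_def by (rule openin_continuous_map_preimage)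
    then obtain T N0 where T: "openin (top_of_set {0..1}) T" "x \<in> T" and N0: "openin Z N0" "z0 \<in> N0"
      and TN: "T \<times> N0 \<subseteq> {w \<in> topspace W. h w \<in> U}"
      using xz U(2) unfolding W_def openin_prod_topology_alt by (smt (verit) mem_Collect_eq)
    obtain e where e: "e > 0" "\<And>t. t \<in> {0..1} \<Longrightarrow> dist t x < e \<Longrightarrow> t \<in> T"
      using T unfolding openin_euclidean_subtopology_iff by (metis dist_commute)
    have "P a b" if ab: "a \<le> x \<and> x \<le> b \<and> b - a < e" for a b
      unfolding P_def
    proof (intro impI allI)
      fix N s
      assume ac: "0 \<le> a \<and> b \<le> 1"
        and N: "openin Z N \<and> z0 \<in> N \<and> continuous_map (subtopology Z N) X s \<and>
          (\<forall>z\<in>N. p (s z) = h (a, z))"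
      have abT: "{a..b} \<subseteq> T" using e(2) ab ac by (auto simp: dist_real_def)
      have NZ: "N \<subseteq> topspace Z" using N openin_subset by blast
      have sz0: "s z0 \<in> topspace X" using N NZ by (auto simp: continuous_map_def)
      have "(a, z0) \<in> T \<times> N0" using abT ab N0(2) by auto
      then have "p (s z0) \<in> U" using N TN by auto
      then obtain V \<sigma> where V: "openin X V" "s z0 \<in> V" "continuous_map (subtopology Y U) X \<sigma>"
          "\<forall>v\<in>V. p v \<in> U \<and> \<sigma> (p v) = v" "\<forall>u\<in>U. \<sigma> u \<in> V \<and> p (\<sigma> u) = u"
        using U(3)[OF sz0] by meson
      define M where "M = N0 \<inter> {z \<in> topspace (subtopology Z N). s z \<in> V}"
      have "openin (subtopology Z N) {z \<in> topspace (subtopology Z N). s z \<in> V}"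
        using N V(1) openin_continuous_map_preimage by blast
      then have M: "openin Z M" unfolding M_def
        using N N0 openin_open_subtopology by blast
      have "continuous_map (subtopology W ({a..b} \<times> M)) (subtopology Y U) h"
        unfolding continuous_map_in_subtopology
        using continuous_map_from_subtopology[OF h[folded W_def]] TN abT
        by (auto simp: M_def)
      then have "continuous_map (subtopology W ({a..b} \<times> M)) X (\<sigma> \<circ> h)"
        using V(3) continuous_map_compose by blast
      moreover have "\<forall>t\<in>{a..b}. \<forall>z\<in>M. p ((\<sigma> \<circ> h) (t, z)) = h (t, z)"
        using V(5) TN abT by (auto simp: M_def)
      moreover have "\<forall>z\<in>M. (\<sigma> \<circ> h) (a, z) = s z"
        using N V(4) unfolding M_def by (metis (no_types, lifting) IntD2 comp_apply mem_Collect_eq Int_iff topspace_subtopology)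
      ultimately show "\<exists>M H. openin Z M \<and> z0 \<in> M \<and> M \<subseteq> N \<and>
         continuous_map (subtopology W ({a..b} \<times> M)) X H \<and>
         (\<forall>t\<in>{a..b}. \<forall>z\<in>M. p (H (t, z)) = h (t, z)) \<and> (\<forall>z\<in>M. H (a, z) = s z)"
        using M N V(2) N0(2) NZ by (intro exI[of _ M] exI[of _ "\<sigma> \<circ> h"]) (auto simp: M_def)
    qed
    then show "\<exists>d>0. \<forall>a b. a \<le> x \<and> x \<le> b \<and> b - a < d \<longrightarrow> P a b"
      using e(1) by blast
  qed
  then obtain M H where M: "openin Z M" "z0 \<in> M" "continuous_map (subtopology W ({0..1} \<times> M)) X H"
         "\<forall>t\<in>{0..1}. \<forall>z\<in>M. p (H (t, z)) = h (t, z)" "\<forall>z\<in>M. H (0, z) = s z"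
    using s z0 spec[OF spec[OF mp[OF \<open>P 0 1\<close>[unfolded P_def]], of "topspace Z"], of s] by auto
  show thesis
    by (rule that[of M H]) (use M in \<open>simp_all add: W_def\<close>)
qed

text \<open>The local lifts agree where they overlap, because along each path \<open>t \<mapsto> (t, w)\<close> they are lifts with
  the same start.\<close>

theorem covering_map_lift_homotopy:
  assumes p: "covering_map X Y p"
    and h: "continuous_map (prod_topology (top_of_set {0..1}) Z) Y h"
    and s: "continuous_map Z X s" "\<And>z. z \<in> topspace Z \<Longrightarrow> p (s z) = h (0, z)"
  obtains H where "continuous_map (prod_topology (top_of_set {0..1::real}) Z) X H"
    "\<And>t z. t \<in> {0..1} \<Longrightarrow> z \<in> topspace Z \<Longrightarrow> p (H (t, z)) = h (t, z)"
    "\<And>z. z \<in> topspace Z \<Longrightarrow> H (0, z) = s z"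
proof -
  let ?W = "prod_topology (top_of_set {0..1::real}) Z"
  have "\<exists>M H. openin Z M \<and> z \<in> M \<and> continuous_map (subtopology ?W ({0..1} \<times> M)) X H \<and>
      (\<forall>t\<in>{0..1}. \<forall>z\<in>M. p (H (t, z)) = h (t, z)) \<and> (\<forall>z\<in>M. H (0, z) = s z)"
    (is "\<exists>M H. ?Q z M H") if "z \<in> topspace Z" for z
    by (rule lift_homotopy_locally[OF p h s that]) blast+
  then have "\<exists>MH. ?Q z (fst MH) (snd MH)" if "z \<in> topspace Z" for z
    using that by (metis fst_conv snd_conv)
  from bchoice[OF this[THEN ballI]]
  obtain MH where MH: "\<forall>z\<in>topspace Z. ?Q z (fst (MH z)) (snd (MH z))" ..
  define M where "M z = fst (MH z)" for z
  define H where "H z = snd (MH z)" for z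
  have M: "openin Z (M z)" "z \<in> M z" if "z \<in> topspace Z" for z
    using MH that by (auto simp: M_def)
  have H: "continuous_map (subtopology ?W ({0..1} \<times> M z)) X (H z)"
      "\<And>t w. t \<in> {0..1} \<Longrightarrow> w \<in> M z \<Longrightarrow> p (H z (t, w)) = h (t, w)"
      "\<And>w. w \<in> M z \<Longrightarrow> H z (0, w) = s w" if "z \<in> topspace Z" for z
    using bspec[OF MH that] by (simp_all add: M_def H_def)
  have path: "continuous_map (top_of_set {0..1}) X (\<lambda>t. H z (t, w))"
    if "z \<in> topspace Z" "w \<in> M z" for z w
  proof -
    have "w \<in> topspace Z" using M(1)[OF that(1)] that(2) openin_subset by blast
    then have "continuous_map (top_of_set {0..1}) (subtopology ?W ({0..1} \<times> M z)) (\<lambda>t. (t, w))"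
      unfolding continuous_map_in_subtopology continuous_map_pairwise o_def
      using that by auto
    from continuous_map_compose[OF this H(1)[OF that(1)]] show ?thesis by (simp add: o_def)
  qed
  have agree: "H z (t, w) = H z' (t, w)"
    if "z \<in> topspace Z" "z' \<in> topspace Z" "t \<in> {0..1}" "w \<in> M z" "w \<in> M z'" for z z' t w
  proof (rule lifts_equal[OF p path[OF that(1,4)] path[OF that(2,5)]])
    show "connected_space (top_of_set {0..1::real})" by (simp add: connected_space_subtopology)
    show "p (H z (t, w)) = p (H z' (t, w))" if "t \<in> topspace (top_of_set {0..1})" for t
      using that by (simp add: H(2) \<open>z \<in> topspace Z\<close> \<open>z' \<in> topspace Z\<close> \<open>w \<in> M z\<close> \<open>w \<in> M z'\<close>)
    show "(0::real) \<in> topspace (top_of_set {0..1})" "t \<in> topspace (top_of_set {0..1})"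
      using \<open>t \<in> {0..1}\<close> by auto
    show "H z (0, w) = H z' (0, w)"
      by (simp add: H(3) \<open>z \<in> topspace Z\<close> \<open>z' \<in> topspace Z\<close> \<open>w \<in> M z\<close> \<open>w \<in> M z'\<close>)
  qed
  have cover: "topspace ?W \<subseteq> (\<Union>z\<in>topspace Z. {0..1} \<times> M z)" using M(2) by auto
  have ope: "openin ?W ({0..1} \<times> M z)" if "z \<in> topspace Z" for z
    using M(1)[OF that] by (simp add: openin_prod_Times_iff)
  have eq: "H z x = H z' x" if zx: "z \<in> topspace Z" "z' \<in> topspace Z"
      "x \<in> topspace ?W \<inter> ({0..1} \<times> M z) \<inter> ({0..1} \<times> M z')" for z z' x
  proof -
    obtain t w where "x = (t, w)" "t \<in> {0..1}" "w \<in> M z" "w \<in> M z'" using zx(3) by blast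
    then show ?thesis using agree[OF zx(1,2)] by simp
  qed
  show thesis
  proof (rule pasting_lemma_exists[where X = ?W and Y = X and I = "topspace Z"
          and T = "\<lambda>z. {0..1} \<times> M z" and f = H])
    fix K
    assume K: "continuous_map ?W X K"
      "\<And>x z. \<lbrakk>z \<in> topspace Z; x \<in> topspace ?W \<inter> ({0..1} \<times> M z)\<rbrakk> \<Longrightarrow> K x = H z x"
    have KH: "K (t, z) = H z (t, z)" if "t \<in> {0..1}" "z \<in> topspace Z" for t z
      using K(2)[OF that(2), of "(t, z)"] that M(2) by simp
    show thesis
      by (rule that[OF K(1)]) (simp_all add: KH H M(2))
  qed (fact cover ope H(1) eq)+
qed


section \<open>Homotopy of paths in an abstract topological space\<close>

definition path_homotopic :: "'a topology \<Rightarrow> (real \<Rightarrow> 'a) \<Rightarrow> (real \<Rightarrow> 'a) \<Rightarrow> bool" where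
  "path_homotopic X p q = homotopic_with (\<lambda>r. r 0 = p 0 \<and> r 1 = p 1) (top_of_set {0..1}) X p q"

lemma prod_topology_top_of_set:
  "prod_topology (top_of_set S) (top_of_set T) = top_of_set (S \<times> T)"
  by (metis prod_topology_euclidean prod_topology_subtopology(1) prod_topology_subtopology(2)
      subtopology_Times)

lemma path_homotopic_iff:
  fixes X :: "'a topology"
  shows
  "path_homotopic X p q \<longleftrightarrow> (\<exists>h :: real \<times> real \<Rightarrow> 'a. continuous_map (top_of_set ({0..1} \<times> {0..1})) X h \<and>
     (\<forall>s\<in>{0..1}. h (0, s) = p s) \<and> (\<forall>s\<in>{0..1}. h (1, s) = q s) \<and>
     (\<forall>t\<in>{0..1}. h (t, 0) = p 0 \<and> h (t, 1) = p 1))"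
  unfolding path_homotopic_def
  apply (subst homotopic_with)
   apply simp
  apply (simp only: prod_topology_top_of_set topspace_euclidean_subtopology)
  done

lemma path_homotopic_ends: "path_homotopic X p q \<Longrightarrow> q 0 = p 0 \<and> q 1 = p 1"
  unfolding path_homotopic_def by (drule homotopic_with_imp_property) simp

lemma path_homotopic_imp_pathin: "path_homotopic X p q \<Longrightarrow> pathin X p \<and> pathin X q"
  unfolding path_homotopic_def pathin_def by (rule homotopic_with_imp_continuous_maps)

lemma path_homotopic_refl: "pathin X p \<Longrightarrow> path_homotopic X p p"
  by (simp add: path_homotopic_def pathin_def)

lemma path_homotopic_sym: "path_homotopic X p q \<Longrightarrow> path_homotopic X q p"
  using path_homotopic_ends[of X p q] by (simp add: path_homotopic_def homotopic_with_sym)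

lemma path_homotopic_trans [trans]:
  "path_homotopic X p q \<Longrightarrow> path_homotopic X q r \<Longrightarrow> path_homotopic X p r"
proof -
  assume pq: "path_homotopic X p q" and qr: "path_homotopic X q r"
  have "homotopic_with (\<lambda>s. s 0 = p 0 \<and> s 1 = p 1) (top_of_set {0..1}) X q r"
    using qr path_homotopic_ends[OF pq] by (simp add: path_homotopic_def)
  then show "path_homotopic X p r"
    using pq unfolding path_homotopic_def by (rule homotopic_with_trans[rotated])
qed

lemma path_homotopic_eq:
  "pathin X p \<Longrightarrow> (\<And>t. 0 \<le> t \<Longrightarrow> t \<le> 1 \<Longrightarrow> p t = q t) \<Longrightarrow> path_homotopic X p q"
  unfolding path_homotopic_def pathin_def by (rule homotopic_with_equal) auto

lemma loop_homotopic_iff: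
  "loop_homotopic X x p q \<longleftrightarrow> path_homotopic X p q \<and> p 0 = x \<and> p 1 = x"
proof
  assume l: "loop_homotopic X x p q"
  then have "p 0 = x \<and> p 1 = x"
    unfolding loop_homotopic_def by (drule_tac homotopic_with_imp_property) simp
  with l show "path_homotopic X p q \<and> p 0 = x \<and> p 1 = x"
    by (simp add: path_homotopic_def loop_homotopic_def)
next
  assume "path_homotopic X p q \<and> p 0 = x \<and> p 1 = x"
  then show "loop_homotopic X x p q" by (auto simp: path_homotopic_def loop_homotopic_def)
qed

lemma path_homotopic_compose:
  assumes "continuous_map X Y f" "path_homotopic X p q"
  shows "path_homotopic Y (f \<circ> p) (f \<circ> q)"
  using homotopic_with_compose_continuous_map_left[OF assms(2)[unfolded path_homotopic_def] assms(1)]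
  by (simp add: path_homotopic_def)

text \<open>All groupoid laws for paths come from this lemma: both sides of a law are images of two
  paths with the same ends in an interval of the real line, under a map built from the paths.\<close>

lemma path_homotopic_image_convex:
  fixes S :: "'c::real_normed_vector set"
  assumes f: "continuous_map (top_of_set S) X f" and "convex S"
    and a: "pathin (top_of_set S) a" and b: "pathin (top_of_set S) b"
    and ends: "a 0 = b 0" "a 1 = b 1"
  shows "path_homotopic X (f \<circ> a) (f \<circ> b)"
proof -
  let ?k = "\<lambda>(t, s). (1 - t) *\<^sub>R a s + t *\<^sub>R b s"
  have ca: "continuous_on {0..1} a" "continuous_on {0..1} b" "a ` {0..1} \<subseteq> S" "b ` {0..1} \<subseteq> S"
    using a b by (auto simp: pathin_def)
  have "continuous_on ({0..1} \<times> {0..1}) ?k"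
    unfolding split_def
    by (intro continuous_intros continuous_on_compose2[OF ca(1)] continuous_on_compose2[OF ca(2)]) auto
  moreover have "?k ` ({0..1} \<times> {0..1}) \<subseteq> S"
    using ca(3,4) \<open>convex S\<close> by (auto simp: image_subset_iff intro!: convexD)
  ultimately have "continuous_map (top_of_set ({0..1} \<times> {0..1})) (top_of_set S) ?k" by auto
  from continuous_map_compose[OF this f] show ?thesis
    unfolding path_homotopic_iff using ends
    by (intro exI[of _ "f \<circ> ?k"]) (auto simp flip: scaleR_left_distrib)
qed

lemma path_concat_ends [simp]: "path_concat p q 0 = p 0" "path_concat p q 1 = q 1"
  by (auto simp: path_concat_def)

lemma continuous_map_cases_interval:
  fixes S :: "'c::topological_space set" and m :: "'c \<Rightarrow> real"
  assumes "continuous_on S m" "continuous_map (top_of_set {x\<in>S. m x \<le> c}) Y f"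
    "continuous_map (top_of_set {x\<in>S. c \<le> m x}) Y g" "\<And>x. x \<in> S \<Longrightarrow> m x = c \<Longrightarrow> f x = g x"
  shows "continuous_map (top_of_set S) Y (\<lambda>x. if m x \<le> c then f x else g x)"
proof (rule continuous_map_cases_le)
  have "S \<inter> {x \<in> S. m x \<le> c} = {x\<in>S. m x \<le> c}" "S \<inter> {x \<in> S. c \<le> m x} = {x\<in>S. c \<le> m x}" by auto
  then show "continuous_map (subtopology (top_of_set S) {x \<in> topspace (top_of_set S). m x \<le> c}) Y f"
    "continuous_map (subtopology (top_of_set S) {x \<in> topspace (top_of_set S). c \<le> m x}) Y g"
    using assms by (simp_all add: subtopology_subtopology)
qed (use assms in auto)

lemma continuous_map_top_of_set_compose:
  assumes "continuous_map (top_of_set T) Y f" "continuous_on S g" "g ` S \<subseteq> T"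
  shows "continuous_map (top_of_set S) Y (\<lambda>x. f (g x))"
  using continuous_map_compose[of "top_of_set S" "top_of_set T" g Y f] assms by (auto simp: o_def)

lemma pathin_concat:
  assumes "pathin X p" "pathin X q" "p 1 = q 0"
  shows "pathin X (path_concat p q)"
  unfolding pathin_def path_concat_def
  by (rule continuous_map_cases_interval;
      (intro continuous_map_top_of_set_compose[OF assms(1)[unfolded pathin_def]]
         continuous_map_top_of_set_compose[OF assms(2)[unfolded pathin_def]])?)
    (use assms in \<open>auto intro!: continuous_intros simp: field_simps\<close>)

lemma path_homotopic_concat:
  fixes X :: "'a topology"
  assumes pp: "path_homotopic X p p'" and qq: "path_homotopic X q q'" and pq: "p 1 = q 0"
  shows "path_homotopic X (path_concat p q) (path_concat p' q')"
proof -
  obtain h :: "real \<times> real \<Rightarrow> 'a" where h: "continuous_map (top_of_set ({0..1} \<times> {0..1})) X h"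
    "\<forall>s\<in>{0..1}. h (0, s) = p s" "\<forall>s\<in>{0..1}. h (1, s) = p' s"
    "\<forall>t\<in>{0..1}. h (t, 0) = p 0 \<and> h (t, 1) = p 1"
    using pp unfolding path_homotopic_iff by blast
  obtain k :: "real \<times> real \<Rightarrow> 'a" where k: "continuous_map (top_of_set ({0..1} \<times> {0..1})) X k"
    "\<forall>s\<in>{0..1}. k (0, s) = q s" "\<forall>s\<in>{0..1}. k (1, s) = q' s"
    "\<forall>t\<in>{0..1}. k (t, 0) = q 0 \<and> k (t, 1) = q 1"
    using qq unfolding path_homotopic_iff by blast
  let ?H = "\<lambda>x. if snd x \<le> 1/2 then h (fst x, 2 * snd x) else k (fst x, 2 * snd x - 1)"
  have "continuous_map (top_of_set ({0..1} \<times> {0..1})) X ?H"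
    by (rule continuous_map_cases_interval;
      (intro continuous_map_top_of_set_compose[OF h(1)] continuous_map_top_of_set_compose[OF k(1)])?)
      (use h(4) k(4) pq in \<open>auto intro!: continuous_intros simp: eq_divide_eq mult.commute\<close>)
  then show ?thesis
    unfolding path_homotopic_iff
    by (intro exI[of _ ?H]) (use h k in \<open>auto simp: path_concat_def\<close>)
qed

lemma pathin_linear: "m ` {0..1} \<subseteq> {0..c::real} \<Longrightarrow> continuous_on {0..1} m \<Longrightarrow> pathin (top_of_set {0..c}) m"
  by (auto simp: pathin_def)

lemma continuous_on_piecewise:
  fixes f g :: "real \<Rightarrow> real"
  assumes "continuous_on UNIV f" "continuous_on UNIV g" "f c = g c"
  shows "continuous_on A (\<lambda>t. if t \<le> c then f t else g t)"
proof -
  have "continuous_on UNIV (\<lambda>t. if t \<le> c then f t else g t)"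
    by (rule continuous_on_cases_le) (use assms in \<open>auto intro: continuous_on_subset continuous_intros\<close>)
  then show ?thesis using continuous_on_subset by blast
qed

lemma path_concat_assoc:
  assumes p: "pathin X p" and q: "pathin X q" and r: "pathin X r" and "p 1 = q 0" "q 1 = r 0"
  shows "path_homotopic X (path_concat (path_concat p q) r) (path_concat p (path_concat q r))"
proof -
  define f where "f = (\<lambda>t::real. if t \<le> 1 then p t else (if t \<le> 2 then q (t - 1) else r (t - 2)))"
  have "continuous_map (top_of_set {0..3}) X f"
    unfolding f_def
  proof (rule continuous_map_cases_interval)
    have "{x \<in> {0..3}. 1 \<le> x} = {1..3::real}" by auto
    moreover have "continuous_map (top_of_set {1..3::real}) X (\<lambda>t. if t \<le> 2 then q (t - 1) else r (t - 2))"
      by (rule continuous_map_cases_interval;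
        (intro continuous_map_top_of_set_compose[OF q[unfolded pathin_def]]
          continuous_map_top_of_set_compose[OF r[unfolded pathin_def]])?)
       (use assms in \<open>auto intro!: continuous_intros\<close>)
    ultimately show "continuous_map (top_of_set {x \<in> {0..3}. 1 \<le> x}) X
        (\<lambda>t. if t \<le> 2 then q (t - 1) else r (t - 2))" by simp
    show "continuous_map (top_of_set {x \<in> {0..3}. x \<le> 1}) X p"
      using p unfolding pathin_def by (rule continuous_map_from_subtopology_mono) auto
  qed (use assms in auto)
  moreover define a where "a = (\<lambda>t::real. if t \<le> 1/2 then 4 * t else 2 * t + 1)"
  moreover define b where "b = (\<lambda>t::real. if t \<le> 1/2 then 2 * t else 4 * t - 1)"
  moreover have "pathin (top_of_set {0..3}) a" "pathin (top_of_set {0..3}) b"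
    unfolding a_def b_def
    by (intro pathin_linear continuous_on_piecewise continuous_intros; auto)+
  ultimately have *: "path_homotopic X (f \<circ> a) (f \<circ> b)"
    by (intro path_homotopic_image_convex) auto
  have "path_homotopic X (f \<circ> a) (path_concat (path_concat p q) r)"
    using path_homotopic_imp_pathin[OF *] assms(5)
    by (intro path_homotopic_eq) (auto simp: f_def a_def path_concat_def algebra_simps)
  then have "path_homotopic X (path_concat (path_concat p q) r) (f \<circ> a)"
    by (rule path_homotopic_sym)
  also note *
  also have "path_homotopic X (f \<circ> b) (path_concat p (path_concat q r))"
    using path_homotopic_imp_pathin[OF *] assms(4)
    by (intro path_homotopic_eq) (auto simp: f_def b_def path_concat_def algebra_simps)
  finally show ?thesis .
qed

lemma path_concat_subpaths:
  assumes p: "pathin X p" and ab: "0 \<le> a" "a \<le> 1" "0 \<le> b" "b \<le> 1" "0 \<le> c" "c \<le> 1"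
  shows "path_homotopic X
    (path_concat (\<lambda>s. p (a + s * (b - a))) (\<lambda>s. p (b + s * (c - b)))) (\<lambda>s. p (a + s * (c - a)))"
proof -
  have seg: "x + s * (y - x) \<in> {0..1}" if "0 \<le> s" "s \<le> 1" "0 \<le> x" "x \<le> 1" "0 \<le> y" "y \<le> 1" for s x y :: real
    using convexD[of "{0..1::real}" x y "1 - s" s] that by (simp add: algebra_simps)
  let ?m = "\<lambda>s. if s \<le> 1/2 then a + (2 * s) * (b - a) else b + (2 * s - 1) * (c - b)"
  have "path_homotopic X (p \<circ> ?m) (p \<circ> (\<lambda>s. a + s * (c - a)))"
  proof (rule path_homotopic_image_convex[of "{0..1}"])
    show "continuous_map (top_of_set {0..1}) X p" using p by (simp add: pathin_def)
    show "pathin (top_of_set {0..1}) ?m"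
      by (intro pathin_linear continuous_on_piecewise continuous_intros)
        (use ab seg[of "2 * s" a b for s] seg[of "2 * s - 1" b c for s] in \<open>auto simp: image_subset_iff\<close>)
    show "pathin (top_of_set {0..1}) (\<lambda>s. a + s * (c - a))"
      by (intro pathin_linear continuous_intros)
        (use ab seg[of s a c for s] in \<open>auto simp: image_subset_iff\<close>)
  qed auto
  moreover have "p \<circ> ?m = path_concat (\<lambda>s. p (a + s * (b - a))) (\<lambda>s. p (b + s * (c - b)))"
    by (auto simp: path_concat_def)
  ultimately show ?thesis by (simp add: o_def)
qed

lemma path_concat_const_right:
  "pathin X p \<Longrightarrow> x = p 1 \<Longrightarrow> path_homotopic X (path_concat p (\<lambda>_. x)) p"
  using path_concat_subpaths[of X p 0 1 1] by simp

lemma path_concat_const_left: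
  "pathin X p \<Longrightarrow> x = p 0 \<Longrightarrow> path_homotopic X (path_concat (\<lambda>_. x) p) p"
  using path_concat_subpaths[of X p 0 0 1] by simp

lemma pathin_reverse: "pathin X p \<Longrightarrow> pathin X (\<lambda>t. p (1 - t))"
  unfolding pathin_def
  by (rule continuous_map_top_of_set_compose) (auto intro!: continuous_intros)

lemma path_concat_reverse_right:
  "pathin X p \<Longrightarrow> path_homotopic X (path_concat p (\<lambda>t. p (1 - t))) (\<lambda>_. p 0)"
  using path_concat_subpaths[of X p 0 1 0] by simp

lemma path_concat_reverse_left:
  "pathin X p \<Longrightarrow> path_homotopic X (path_concat (\<lambda>t. p (1 - t)) p) (\<lambda>_. p 1)"
  using path_concat_subpaths[of X p 1 0 1] by simp

lemma path_concat_reverse_cancel: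
  assumes "pathin X p" "pathin X q" "p 1 = q 1"
  shows "path_homotopic X (path_concat (path_concat p (\<lambda>t. q (1 - t))) q) p"
proof -
  note rq = pathin_reverse[OF assms(2)]
  have "path_homotopic X (path_concat (path_concat p (\<lambda>t. q (1 - t))) q)
      (path_concat p (path_concat (\<lambda>t. q (1 - t)) q))"
    using assms rq by (intro path_concat_assoc) auto
  also have "path_homotopic X \<dots> (path_concat p (\<lambda>_. q 1))"
    using assms by (intro path_homotopic_concat path_homotopic_refl path_concat_reverse_left) auto
  also have "path_homotopic X \<dots> p"
    using assms by (intro path_concat_const_right) auto
  finally show ?thesis .
qed

text \<open>A free null-homotopy of a loop, seen as a map on a square, exhibits the loop as homotopic to
  the track of its base point followed by the reverse of that track.\<close>

lemma loop_null_homotopic: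
  fixes X :: "'a topology"
  assumes c: "homotopic_with (\<lambda>r. r 0 = r 1) (top_of_set {0..1}) X c (\<lambda>_. a)"
  shows "path_homotopic X c (\<lambda>_. c 0)"
proof -
  obtain h :: "real \<times> real \<Rightarrow> 'a" where h: "continuous_map (top_of_set ({0..1} \<times> {0..1})) X h" "\<And>s. h (0, s) = c s"
    "\<And>s. h (1, s) = a" "\<And>t. t \<in> {0..1} \<Longrightarrow> h (t, 0) = h (t, 1)"
    using c unfolding homotopic_with_def prod_topology_top_of_set by auto
  let ?S = "{0..1::real} \<times> {0..1::real}"
  let ?e0 = "\<lambda>t::real. (t, 0::real)" and ?e1 = "\<lambda>t::real. (1 - t, 1::real)"
    and ?m = "\<lambda>t::real. (1::real, t)"
  have conv: "convex ?S" by (intro convex_Times) auto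
  have paths: "pathin (top_of_set ?S) (\<lambda>s. (0, s))" "pathin (top_of_set ?S) ?e0"
     "pathin (top_of_set ?S) ?e1" "pathin (top_of_set ?S) ?m"
    by (auto simp: pathin_def intro!: continuous_intros)
  have track: "pathin X (\<lambda>t. h (t, 0))"
    using pathin_compose[OF paths(2) h(1)] by (simp add: o_def)
  have "path_homotopic X (h \<circ> (\<lambda>s. (0, s))) (h \<circ> path_concat (path_concat ?e0 ?m) ?e1)"
    using paths by (intro path_homotopic_image_convex[OF h(1) conv] pathin_concat) auto
  moreover have "h \<circ> (\<lambda>s. (0, s)) = c" using h(2) by auto
  ultimately have "path_homotopic X c (h \<circ> path_concat (path_concat ?e0 ?m) ?e1)" by simp
  also have "path_homotopic X (h \<circ> path_concat (path_concat ?e0 ?m) ?e1)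
      (path_concat (path_concat (\<lambda>t. h (t, 0)) (\<lambda>_. a)) (\<lambda>t. h (1 - t, 0)))"
    using h(3,4) pathin_compose[OF _ h(1)] paths
    by (intro path_homotopic_eq pathin_compose[OF _ h(1)] pathin_concat)
      (auto simp: path_concat_def)
  also have "path_homotopic X
     (path_concat (path_concat (\<lambda>t. h (t, 0)) (\<lambda>_. a)) (\<lambda>t. h (1 - t, 0)))
     (path_concat (\<lambda>t. h (t, 0)) (\<lambda>t. h (1 - t, 0)))"
    using track h(3) pathin_reverse[OF track]
    by (intro path_homotopic_concat path_concat_const_right path_homotopic_refl) auto
  also have "path_homotopic X (path_concat (\<lambda>t. h (t, 0)) (\<lambda>t. h (1 - t, 0))) (\<lambda>_. c 0)"
    using path_concat_reverse_right[OF track] h(2) by simp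
  finally show ?thesis .
qed


section \<open>Lifting paths\<close>

lemma covering_map_lift_path:
  assumes p: "covering_map X Y p" and \<gamma>: "pathin Y \<gamma>" and x: "x \<in> topspace X" "p x = \<gamma> 0"
  obtains \<beta> where "pathin X \<beta>" "\<beta> 0 = x" "\<And>t. 0 \<le> t \<Longrightarrow> t \<le> 1 \<Longrightarrow> p (\<beta> t) = \<gamma> t"
proof -
  let ?Z = "discrete_topology {()}"
  have "continuous_map (prod_topology (top_of_set {0..1}) ?Z) Y (\<gamma> \<circ> fst)"
    using \<gamma> unfolding pathin_def by (rule continuous_map_compose[OF continuous_map_fst])
  moreover have "continuous_map ?Z X (\<lambda>_. x)" using x by simp
  moreover have "p x = (\<gamma> \<circ> fst) (0, z)" for z :: unit using x by simp
  ultimately obtain H where H: "continuous_map (prod_topology (top_of_set {0..1::real}) ?Z) X H"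
     "\<And>t z. t \<in> {0..1} \<Longrightarrow> z \<in> topspace ?Z \<Longrightarrow> p (H (t, z)) = (\<gamma> \<circ> fst) (t, z)"
     "\<And>z. z \<in> topspace ?Z \<Longrightarrow> H (0, z) = x"
    using covering_map_lift_homotopy[OF p, of ?Z "\<gamma> \<circ> fst" "\<lambda>_. x"] by blast
  have "continuous_map (top_of_set {0..1}) (prod_topology (top_of_set {0..1::real}) ?Z) (\<lambda>t. (t, ()))"
    by (simp add: continuous_map_pairwise o_def)
  from continuous_map_compose[OF this H(1)] have "pathin X (\<lambda>t. H (t, ()))"
    by (simp add: pathin_def o_def)
  then show thesis
    by (rule that) (use H(2,3) in auto)
qed

lemma path_lifts_equal:
  assumes p: "covering_map X Y p" and "pathin X \<beta>" "pathin X \<beta>'" "\<beta> 0 = \<beta>' 0"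
    and "\<And>t. 0 \<le> t \<Longrightarrow> t \<le> 1 \<Longrightarrow> p (\<beta> t) = p (\<beta>' t)" and "0 \<le> t" "t \<le> 1"
  shows "\<beta> t = \<beta>' t"
proof -
  have "continuous_map (top_of_set {0..1}) X \<beta>" "continuous_map (top_of_set {0..1}) X \<beta>'"
    using assms by (simp_all add: pathin_def)
  from lifts_equal[OF p this, of 0 t] show ?thesis
    using assms(4-7) by (simp add: connected_space_subtopology)
qed

text \<open>The tracks of the two ends under the lifted homotopy lie over constant paths.\<close>

lemma homotopic_path_lifts_end:
  assumes p: "covering_map X Y p" and \<beta>: "pathin X \<beta>" "pathin X \<beta>'" "\<beta> 0 = \<beta>' 0"
    and hom: "path_homotopic Y (p \<circ> \<beta>) (p \<circ> \<beta>')"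
  shows "\<beta> 1 = \<beta>' 1"
proof -
  obtain h :: "real \<times> real \<Rightarrow> 'b" where h: "continuous_map (top_of_set ({0..1} \<times> {0..1})) Y h"
    "\<forall>s\<in>{0..1}. h (0, s) = p (\<beta> s)" "\<forall>s\<in>{0..1}. h (1, s) = p (\<beta>' s)"
    "\<forall>t\<in>{0..1}. h (t, 0) = p (\<beta> 0) \<and> h (t, 1) = p (\<beta> 1)"
    using hom unfolding path_homotopic_iff by auto
  have "continuous_map (prod_topology (top_of_set {0..1}) (top_of_set {0..1})) Y h"
    using h(1) by (simp add: prod_topology_top_of_set)
  moreover have "continuous_map (top_of_set {0..1}) X \<beta>" using \<beta>(1) by (simp add: pathin_def)
  moreover have "p (\<beta> s) = h (0, s)" if "s \<in> topspace (top_of_set {0..1})" for s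
    using h(2) that by auto
  ultimately obtain H where H: "continuous_map (prod_topology (top_of_set {0..1}) (top_of_set {0..1})) X H"
    "\<And>t s. t \<in> {0..1} \<Longrightarrow> s \<in> topspace (top_of_set {0..1}) \<Longrightarrow> p (H (t, s)) = h (t, s)"
    "\<And>s. s \<in> topspace (top_of_set {0..1}) \<Longrightarrow> H (0, s) = \<beta> s"
    using covering_map_lift_homotopy[OF p, of "top_of_set {0..1}" h \<beta>] by blast
  have Hc: "continuous_map (top_of_set ({0..1} \<times> {0..1})) X H"
    using H(1) by (simp add: prod_topology_top_of_set)
  have side: "pathin X (\<lambda>t. H (t, s))" if "s \<in> {0..1}" for s
    unfolding pathin_def
    by (rule continuous_map_top_of_set_compose[OF Hc]) (use that in \<open>auto intro!: continuous_intros\<close>)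
  have top: "pathin X (\<lambda>s. H (1, s))"
    unfolding pathin_def
    by (rule continuous_map_top_of_set_compose[OF Hc]) (auto intro!: continuous_intros)
  have \<beta>X: "\<beta> 0 \<in> topspace X" "\<beta> 1 \<in> topspace X"
    using \<beta>(1) path_start_in_topspace path_finish_in_topspace by auto
  have "H (1, 0) = (\<lambda>_. \<beta> 0) (1::real)"
    by (rule path_lifts_equal[OF p side, of 0]) (use \<beta>X H h(4) in auto)
  moreover have "H (1, 1) = (\<lambda>_. \<beta> 1) (1::real)"
    by (rule path_lifts_equal[OF p side, of 1]) (use \<beta>X H h(4) in auto)
  moreover have "H (1, 1) = \<beta>' 1"
    by (rule path_lifts_equal[OF p top \<beta>(2)]) (use \<beta>(3) H(2) h(3) \<open>H (1, 0) = _\<close> in auto)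
  ultimately show ?thesis by simp
qed

section \<open>The universal cover\<close>

definition path_class :: "'a topology \<Rightarrow> (real \<Rightarrow> 'a) \<Rightarrow> (real \<Rightarrow> 'a) set" where
  "path_class Y \<gamma> = {q. path_homotopic Y \<gamma> q}"

definition paths_from :: "'a topology \<Rightarrow> 'a \<Rightarrow> (real \<Rightarrow> 'a) set" where
  "paths_from Y y = {\<gamma>. pathin Y \<gamma> \<and> \<gamma> 0 = y}"

definition endpoint :: "(real \<Rightarrow> 'a) set \<Rightarrow> 'a" where
  "endpoint z = (SOME \<gamma>. \<gamma> \<in> z) 1"

definition whisker :: "'a topology \<Rightarrow> 'a set \<Rightarrow> (real \<Rightarrow> 'a) \<Rightarrow> (real \<Rightarrow> 'a) set set" where
  "whisker Y U \<gamma> = {path_class Y (path_concat \<gamma> \<delta>) |\<delta>. pathin (subtopology Y U) \<delta> \<and> \<delta> 0 = \<gamma> 1}"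

text \<open>The sets \<^term>\<open>whisker Y U \<gamma>\<close>, with \<open>U\<close> an open neighbourhood of the end of \<open>\<gamma>\<close>, are a basis of
  this topology. Points are sets of paths, since homotopic paths have to be identified.\<close>

definition universal_cover :: "'a topology \<Rightarrow> 'a \<Rightarrow> (real \<Rightarrow> 'a) set topology" where
  "universal_cover Y y = topology (\<lambda>S. S \<subseteq> path_class Y ` paths_from Y y \<and>
     (\<forall>\<gamma>\<in>paths_from Y y. path_class Y \<gamma> \<in> S \<longrightarrow>
        (\<exists>U. openin Y U \<and> \<gamma> 1 \<in> U \<and> whisker Y U \<gamma> \<subseteq> S)))"

text \<open>Loops in \<open>U\<close> contract in \<open>Y\<close>; the form with two paths is the one that identifies the sheets of the
  universal cover.\<close>

definition semilocally_simply_connected :: "'a topology \<Rightarrow> bool" where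
  "semilocally_simply_connected Y \<longleftrightarrow> (\<forall>a\<in>topspace Y. \<exists>U. openin Y U \<and> a \<in> U \<and>
     (\<forall>\<delta> \<delta>'. pathin (subtopology Y U) \<delta> \<and> pathin (subtopology Y U) \<delta>' \<and>
        \<delta> 0 = \<delta>' 0 \<and> \<delta> 1 = \<delta>' 1 \<longrightarrow> path_homotopic Y \<delta> \<delta>'))"

lemma path_class_eq: "path_homotopic Y \<gamma> \<delta> \<Longrightarrow> path_class Y \<gamma> = path_class Y \<delta>"
  unfolding path_class_def
  using path_homotopic_sym[of Y \<gamma> \<delta>] path_homotopic_trans[of Y \<gamma> \<delta>] path_homotopic_trans[of Y \<delta> \<gamma>]
  by auto

lemma path_class_eqD: "pathin Y \<delta> \<Longrightarrow> path_class Y \<gamma> = path_class Y \<delta> \<Longrightarrow> path_homotopic Y \<gamma> \<delta>"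
  unfolding path_class_def using path_homotopic_refl by blast

lemma endpoint_path_class: "pathin Y \<gamma> \<Longrightarrow> endpoint (path_class Y \<gamma>) = \<gamma> 1"
  unfolding endpoint_def path_class_def
  using someI[of "\<lambda>q. q \<in> {q. path_homotopic Y \<gamma> q}" \<gamma>] path_homotopic_refl[of Y \<gamma>]
    path_homotopic_ends[of Y \<gamma>] by auto

lemma whisker_mono: "U \<subseteq> V \<Longrightarrow> whisker Y U \<gamma> \<subseteq> whisker Y V \<gamma>"
  unfolding whisker_def by (auto simp: pathin_subtopology subset_iff)

lemma istopology_universal_cover:
  "istopology (\<lambda>S. S \<subseteq> path_class Y ` paths_from Y y \<and>
     (\<forall>\<gamma>\<in>paths_from Y y. path_class Y \<gamma> \<in> S \<longrightarrow>
        (\<exists>U. openin Y U \<and> \<gamma> 1 \<in> U \<and> whisker Y U \<gamma> \<subseteq> S)))" (is "istopology ?op")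
  unfolding istopology_def
proof (rule conjI; intro allI impI)
  fix S T assume S: "?op S" and T: "?op T"
  have "\<exists>U. openin Y U \<and> \<gamma> 1 \<in> U \<and> whisker Y U \<gamma> \<subseteq> S \<inter> T"
    if g: "\<gamma> \<in> paths_from Y y" "path_class Y \<gamma> \<in> S \<inter> T" for \<gamma>
  proof -
    obtain U where U: "openin Y U" "\<gamma> 1 \<in> U" "whisker Y U \<gamma> \<subseteq> S" using S g by blast
    obtain V where V: "openin Y V" "\<gamma> 1 \<in> V" "whisker Y V \<gamma> \<subseteq> T" using T g by blast
    have "whisker Y (U \<inter> V) \<gamma> \<subseteq> S \<inter> T"
      using U(3) V(3) whisker_mono[of "U \<inter> V" U] whisker_mono[of "U \<inter> V" V] by blast
    then show ?thesis using U V by blast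
  qed
  then show "?op (S \<inter> T)" using S by blast
next
  fix \<K> assume K: "\<forall>S\<in>\<K>. ?op S"
  then show "?op (\<Union>\<K>)" by (meson UnionE Union_upper Union_least order_trans)
qed

lemma openin_universal_cover:
  "openin (universal_cover Y y) S \<longleftrightarrow> S \<subseteq> path_class Y ` paths_from Y y \<and>
     (\<forall>\<gamma>\<in>paths_from Y y. path_class Y \<gamma> \<in> S \<longrightarrow>
        (\<exists>U. openin Y U \<and> \<gamma> 1 \<in> U \<and> whisker Y U \<gamma> \<subseteq> S))"
  unfolding universal_cover_def by (simp add: istopology_universal_cover)

lemma pathin_concat_sub:
  "pathin Y \<gamma> \<Longrightarrow> pathin (subtopology Y U) \<delta> \<Longrightarrow> \<delta> 0 = \<gamma> 1 \<Longrightarrow> pathin Y (path_concat \<gamma> \<delta>)"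
  by (auto simp: pathin_subtopology intro: pathin_concat)

lemma whisker_subset:
  "\<gamma> \<in> paths_from Y y \<Longrightarrow> whisker Y U \<gamma> \<subseteq> path_class Y ` paths_from Y y"
  unfolding whisker_def paths_from_def by (auto intro!: pathin_concat_sub)

lemma paths_from_end: "\<gamma> \<in> paths_from Y y \<Longrightarrow> \<gamma> 1 \<in> topspace Y"
  using path_finish_in_topspace by (auto simp: paths_from_def)

lemma topspace_universal_cover: "topspace (universal_cover Y y) = path_class Y ` paths_from Y y"
proof
  show "topspace (universal_cover Y y) \<subseteq> path_class Y ` paths_from Y y"
    using openin_topspace[of "universal_cover Y y"] unfolding openin_universal_cover by blast
  have "openin (universal_cover Y y) (path_class Y ` paths_from Y y)"
    unfolding openin_universal_cover
    using whisker_subset paths_from_end by (metis openin_topspace subset_refl)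
  then show "path_class Y ` paths_from Y y \<subseteq> topspace (universal_cover Y y)"
    by (rule openin_subset)
qed

lemma in_universal_coverE:
  assumes "z \<in> topspace (universal_cover Y y)"
  obtains \<gamma> where "pathin Y \<gamma>" "\<gamma> 0 = y" "z = path_class Y \<gamma>"
  using assms unfolding topspace_universal_cover paths_from_def by auto

lemma path_class_in_universal_cover:
  "pathin Y \<gamma> \<Longrightarrow> \<gamma> 0 = y \<Longrightarrow> path_class Y \<gamma> \<in> topspace (universal_cover Y y)"
  unfolding topspace_universal_cover paths_from_def by auto

lemma path_class_in_whisker:
  assumes "pathin Y \<gamma>" "\<gamma> 1 \<in> U" shows "path_class Y \<gamma> \<in> whisker Y U \<gamma>"
proof -
  have "pathin (subtopology Y U) (\<lambda>_. \<gamma> 1)"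
    using assms path_finish_in_topspace by auto
  moreover have "path_class Y \<gamma> = path_class Y (path_concat \<gamma> (\<lambda>_. \<gamma> 1))"
    using path_concat_const_right[OF assms(1) refl] path_class_eq by metis
  ultimately show ?thesis unfolding whisker_def by blast
qed

lemma whisker_cong:
  assumes "path_homotopic Y \<gamma> \<gamma>'" shows "whisker Y U \<gamma> = whisker Y U \<gamma>'"
proof -
  have "path_class Y (path_concat \<gamma> \<delta>) = path_class Y (path_concat \<gamma>' \<delta>)"
    if "pathin (subtopology Y U) \<delta>" "\<delta> 0 = \<gamma> 1" for \<delta>
    using that assms
    by (intro path_class_eq path_homotopic_concat path_homotopic_refl) (auto simp: pathin_subtopology)
  then show ?thesis
    unfolding whisker_def conjunct2[OF path_homotopic_ends[OF assms]]
    by (intro Collect_cong ex_cong1) auto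
qed

text \<open>Whisker neighbourhoods over the same \<open>U\<close> coincide or are disjoint, since one may move the reference
  path along \<open>U\<close>.\<close>

lemma whisker_concat_subset:
  assumes \<gamma>: "pathin Y \<gamma>" and \<delta>: "pathin (subtopology Y U) \<delta>" "\<delta> 0 = \<gamma> 1"
  shows "whisker Y U (path_concat \<gamma> \<delta>) \<subseteq> whisker Y U \<gamma>"
proof
  fix z assume "z \<in> whisker Y U (path_concat \<gamma> \<delta>)"
  then obtain \<epsilon> where \<epsilon>: "pathin (subtopology Y U) \<epsilon>" "\<epsilon> 0 = \<delta> 1"
    and z: "z = path_class Y (path_concat (path_concat \<gamma> \<delta>) \<epsilon>)"
    unfolding whisker_def by auto
  have "z = path_class Y (path_concat \<gamma> (path_concat \<delta> \<epsilon>))"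
    unfolding z using assms \<epsilon>
    by (intro path_class_eq path_concat_assoc) (auto simp: pathin_subtopology)
  moreover have "pathin (subtopology Y U) (path_concat \<delta> \<epsilon>)"
    using \<delta> \<epsilon> by (intro pathin_concat) auto
  ultimately show "z \<in> whisker Y U \<gamma>"
    unfolding whisker_def using \<delta>(2) by (auto intro!: exI[of _ "path_concat \<delta> \<epsilon>"])
qed

lemma whisker_concat:
  assumes \<gamma>: "pathin Y \<gamma>" and \<delta>: "pathin (subtopology Y U) \<delta>" "\<delta> 0 = \<gamma> 1"
  shows "whisker Y U (path_concat \<gamma> \<delta>) = whisker Y U \<gamma>"
proof
  have \<delta>Y: "pathin Y \<delta>" using \<delta> by (simp add: pathin_subtopology)
  let ?r = "\<lambda>t. \<delta> (1 - t)"
  note rev = pathin_reverse[OF \<delta>(1)]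
  note cat = pathin_concat_sub[OF \<gamma> \<delta>]
  have "path_homotopic Y (path_concat (path_concat \<gamma> \<delta>) ?r) (path_concat \<gamma> (path_concat \<delta> ?r))"
    using \<gamma> \<delta>Y \<delta>(2) pathin_reverse[OF \<delta>Y] by (intro path_concat_assoc) auto
  also have "path_homotopic Y \<dots> (path_concat \<gamma> (\<lambda>_. \<gamma> 1))"
    using \<gamma> path_concat_reverse_right[OF \<delta>Y] \<delta>(2)
    by (intro path_homotopic_concat path_homotopic_refl) auto
  also have "path_homotopic Y \<dots> \<gamma>" by (rule path_concat_const_right[OF \<gamma> refl])
  finally have "whisker Y U \<gamma> = whisker Y U (path_concat (path_concat \<gamma> \<delta>) ?r)"
    by (rule whisker_cong[OF path_homotopic_sym])
  also have "\<dots> \<subseteq> whisker Y U (path_concat \<gamma> \<delta>)"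
    by (rule whisker_concat_subset[OF cat rev]) simp
  finally show "whisker Y U \<gamma> \<subseteq> whisker Y U (path_concat \<gamma> \<delta>)" .
qed (rule whisker_concat_subset[OF assms])

lemma whisker_eq:
  assumes "pathin Y \<gamma>" "pathin Y \<eta>" "path_class Y \<eta> \<in> whisker Y U \<gamma>"
  shows "whisker Y U \<eta> = whisker Y U \<gamma>" "\<eta> 1 \<in> U"
proof -
  obtain \<delta> where \<delta>: "pathin (subtopology Y U) \<delta>" "\<delta> 0 = \<gamma> 1"
    and eq: "path_class Y \<eta> = path_class Y (path_concat \<gamma> \<delta>)"
    using assms(3) unfolding whisker_def by auto
  have hom: "path_homotopic Y \<eta> (path_concat \<gamma> \<delta>)"
    using path_class_eqD[OF pathin_concat_sub[OF assms(1) \<delta>] eq] .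
  show "whisker Y U \<eta> = whisker Y U \<gamma>"
    using whisker_cong[OF hom] whisker_concat[OF assms(1) \<delta>] by simp
  have "\<delta> 1 \<in> U" using \<delta>(1) by (simp add: pathin_subtopology)
  then show "\<eta> 1 \<in> U" using path_homotopic_ends[OF hom] by simp
qed

lemma openin_whisker:
  assumes "\<gamma> \<in> paths_from Y y" "openin Y U"
  shows "openin (universal_cover Y y) (whisker Y U \<gamma>)"
  unfolding openin_universal_cover
proof (intro conjI ballI impI)
  fix \<eta> assume "\<eta> \<in> paths_from Y y" "path_class Y \<eta> \<in> whisker Y U \<gamma>"
  then have "whisker Y U \<eta> = whisker Y U \<gamma>" "\<eta> 1 \<in> U"
    using whisker_eq[of Y \<gamma> \<eta> U] assms by (auto simp: paths_from_def)
  then show "\<exists>V. openin Y V \<and> \<eta> 1 \<in> V \<and> whisker Y V \<eta> \<subseteq> whisker Y U \<gamma>"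
    using assms(2) by blast
qed (rule whisker_subset[OF assms(1)])

lemma endpoint_whisker:
  assumes "pathin Y \<gamma>" "z \<in> whisker Y U \<gamma>" shows "endpoint z \<in> U"
proof -
  obtain \<delta> where \<delta>: "pathin (subtopology Y U) \<delta>" "\<delta> 0 = \<gamma> 1" "z = path_class Y (path_concat \<gamma> \<delta>)"
    using assms(2) unfolding whisker_def by auto
  have "endpoint z = \<delta> 1"
    using endpoint_path_class[OF pathin_concat_sub[OF assms(1) \<delta>(1,2)]] \<delta>(3) by simp
  then show ?thesis using \<delta>(1) by (auto simp: pathin_subtopology)
qed

lemma continuous_map_endpoint: "continuous_map (universal_cover Y y) Y endpoint"
  unfolding continuous_map_def
proof (intro conjI allI impI)
  show "endpoint \<in> topspace (universal_cover Y y) \<rightarrow> topspace Y"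
    by (auto elim!: in_universal_coverE simp: endpoint_path_class path_finish_in_topspace)
  fix U assume U: "openin Y U"
  show "openin (universal_cover Y y) {z \<in> topspace (universal_cover Y y). endpoint z \<in> U}"
    (is "openin _ ?S")
    unfolding openin_universal_cover
  proof (intro conjI ballI impI)
    fix \<gamma> assume \<gamma>: "\<gamma> \<in> paths_from Y y" "path_class Y \<gamma> \<in> ?S"
    have p: "pathin Y \<gamma>" using \<gamma>(1) by (simp add: paths_from_def)
    have "\<gamma> 1 \<in> U" using \<gamma>(2) endpoint_path_class[OF p] by auto
    moreover have "whisker Y U \<gamma> \<subseteq> ?S"
      using whisker_subset[OF \<gamma>(1)] endpoint_whisker[OF p] by (auto simp: topspace_universal_cover)
    ultimately show "\<exists>V. openin Y V \<and> \<gamma> 1 \<in> V \<and> whisker Y V \<gamma> \<subseteq> ?S" using U by blast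
  qed (auto simp: topspace_universal_cover)
qed

text \<open>Over a path connected open set \<open>U\<close> in which paths with the same ends are homotopic in \<open>Y\<close>,
  the sheets are the whisker neighbourhoods. Local path connectedness makes the endpoint map open.\<close>

lemma homeomorphic_map_endpoint_whisker:
  assumes Y: "locally_path_connected_space Y" and U: "openin Y U" "path_connectedin Y U"
    and sc: "\<And>\<delta> \<delta>'. pathin (subtopology Y U) \<delta> \<Longrightarrow> pathin (subtopology Y U) \<delta>' \<Longrightarrow> \<delta> 0 = \<delta>' 0 \<Longrightarrow>
       \<delta> 1 = \<delta>' 1 \<Longrightarrow> path_homotopic Y \<delta> \<delta>'"
    and \<gamma>: "\<gamma> \<in> paths_from Y y" "\<gamma> 1 \<in> U"
  shows "homeomorphic_map (subtopology (universal_cover Y y) (whisker Y U \<gamma>)) (subtopology Y U) endpoint"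
proof (rule bijective_open_imp_homeomorphic_map)
  let ?W = "whisker Y U \<gamma>" and ?UC = "universal_cover Y y"
  have p: "pathin Y \<gamma>" using \<gamma> by (simp add: paths_from_def)
  have WUC: "?W \<subseteq> topspace ?UC" using whisker_subset[OF \<gamma>(1)] by (simp add: topspace_universal_cover)
  have UY: "U \<subseteq> topspace Y" using U openin_subset by blast
  have end_concat: "endpoint (path_class Y (path_concat \<gamma> \<delta>)) = \<delta> 1"
    if "pathin (subtopology Y U) \<delta>" "\<delta> 0 = \<gamma> 1" for \<delta>
    using endpoint_path_class[OF pathin_concat_sub[OF p that]] by simp
  show "continuous_map (subtopology ?UC ?W) (subtopology Y U) endpoint"
    unfolding continuous_map_in_subtopology
    using continuous_map_endpoint continuous_map_from_subtopology endpoint_whisker[OF p] by fastforce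
  show "inj_on endpoint (topspace (subtopology ?UC ?W))"
  proof (rule inj_onI)
    fix z z' assume "z \<in> topspace (subtopology ?UC ?W)" "z' \<in> topspace (subtopology ?UC ?W)"
      and e: "endpoint z = endpoint z'"
    then obtain \<delta> \<delta>' where \<delta>: "pathin (subtopology Y U) \<delta>" "\<delta> 0 = \<gamma> 1" "z = path_class Y (path_concat \<gamma> \<delta>)"
      and \<delta>': "pathin (subtopology Y U) \<delta>'" "\<delta>' 0 = \<gamma> 1" "z' = path_class Y (path_concat \<gamma> \<delta>')"
      unfolding whisker_def by auto
    have "path_homotopic Y \<delta> \<delta>'"
      using sc[OF \<delta>(1) \<delta>'(1)] e \<delta> \<delta>' end_concat by metis
    then show "z = z'"
      unfolding \<delta>(3) \<delta>'(3) using p \<delta>(2)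
      by (intro path_class_eq path_homotopic_concat path_homotopic_refl) auto
  qed
  show "endpoint ` topspace (subtopology ?UC ?W) = topspace (subtopology Y U)"
  proof
    show "endpoint ` topspace (subtopology ?UC ?W) \<subseteq> topspace (subtopology Y U)"
      using endpoint_whisker[OF p] UY by auto
    show "topspace (subtopology Y U) \<subseteq> endpoint ` topspace (subtopology ?UC ?W)"
    proof
      fix u assume "u \<in> topspace (subtopology Y U)"
      then have "u \<in> U" by simp
      then obtain \<delta> where \<delta>: "pathin (subtopology Y U) \<delta>" "\<delta> 0 = \<gamma> 1" "\<delta> 1 = u"
        using U(2) \<gamma>(2) unfolding path_connectedin_def path_connected_space_def by (metis topspace_subtopology_subset)
      then have "path_class Y (path_concat \<gamma> \<delta>) \<in> ?W" unfolding whisker_def by blast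
      then show "u \<in> endpoint ` topspace (subtopology ?UC ?W)"
        using end_concat[OF \<delta>(1,2)] \<delta>(3) WUC
        by (intro image_eqI[of _ _ "path_class Y (path_concat \<gamma> \<delta>)"]) auto
    qed
  qed
  show "open_map (subtopology ?UC ?W) (subtopology Y U) endpoint"
    unfolding open_map_def
  proof (intro allI impI)
    fix S assume "openin (subtopology ?UC ?W) S"
    then have S: "openin ?UC S" "S \<subseteq> ?W"
      using openin_open_subtopology[OF openin_whisker[OF \<gamma>(1) U(1)]] by auto
    have "\<exists>T. openin (subtopology Y U) T \<and> u \<in> T \<and> T \<subseteq> endpoint ` S" if "u \<in> endpoint ` S" for u
    proof -
      obtain z where z: "z \<in> S" "u = endpoint z" using \<open>u \<in> _\<close> by auto
      then obtain \<eta> where \<eta>: "pathin Y \<eta>" "\<eta> 0 = y" "z = path_class Y \<eta>"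
        using S WUC by (meson in_universal_coverE subsetD)
      then have "\<eta> \<in> paths_from Y y" by (simp add: paths_from_def)
      then obtain V where V: "openin Y V" "\<eta> 1 \<in> V" "whisker Y V \<eta> \<subseteq> S"
        using S(1) z \<eta> unfolding openin_universal_cover by metis
      have u: "u = \<eta> 1" using z \<eta> endpoint_path_class by auto
      have "\<eta> 1 \<in> U" using endpoint_whisker[OF p] z S u by auto
      then obtain T where T: "openin Y T" "path_connectedin Y T" "\<eta> 1 \<in> T" "T \<subseteq> U \<inter> V"
        using Y[unfolded locally_path_connected_space, rule_format, of "U \<inter> V" "\<eta> 1"]
          openin_Int[OF U(1) V(1)] V(2) by blast
      have "T \<subseteq> endpoint ` S"
      proof
        fix t assume "t \<in> T"
        then obtain \<delta> where \<delta>: "pathin (subtopology Y T) \<delta>" "\<delta> 0 = \<eta> 1" "\<delta> 1 = t"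
          using T unfolding path_connectedin_def path_connected_space_def by (metis topspace_subtopology_subset)
        then have "path_class Y (path_concat \<eta> \<delta>) \<in> whisker Y T \<eta>" unfolding whisker_def by blast
        then have "path_class Y (path_concat \<eta> \<delta>) \<in> S" using whisker_mono[of T V Y \<eta>] T(4) V(3) by blast
        moreover have "endpoint (path_class Y (path_concat \<eta> \<delta>)) = t"
          using endpoint_path_class[OF pathin_concat_sub[OF \<eta>(1) \<delta>(1,2)]] \<delta>(3) by simp
        ultimately show "t \<in> endpoint ` S" by blast
      qed
      moreover have "openin (subtopology Y U) T" using openin_open_subtopology[OF U(1)] T(1,4) by blast
      ultimately show ?thesis using T(3) unfolding u by (intro exI[of _ T]) simp
    qed
    then show "openin (subtopology Y U) (endpoint ` S)"
      by (intro openin_subopen[THEN iffD2] ballI)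
  qed
qed

theorem covering_map_endpoint:
  assumes Y: "locally_path_connected_space Y" "semilocally_simply_connected Y" "path_connected_space Y"
    and y: "y \<in> topspace Y"
  shows "covering_map (universal_cover Y y) Y endpoint"
  unfolding covering_map_def
proof (intro conjI ballI)
  let ?UC = "universal_cover Y y"
  show cont: "continuous_map ?UC Y endpoint" by (rule continuous_map_endpoint)
  have "a \<in> endpoint ` topspace ?UC" if "a \<in> topspace Y" for a
  proof -
    obtain \<gamma> where "pathin Y \<gamma>" "\<gamma> 0 = y" "\<gamma> 1 = a"
      using Y(3) y \<open>a \<in> _\<close> unfolding path_connected_space_def by blast
    then show ?thesis
      using endpoint_path_class[of Y \<gamma>] path_class_in_universal_cover[of Y \<gamma> y] by (intro image_eqI) auto
  qed
  then show "endpoint ` topspace ?UC = topspace Y"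
    using continuous_map_in_topspace[OF cont] by auto
  fix a assume a: "a \<in> topspace Y"
  obtain V where V: "openin Y V" "a \<in> V"
    "\<forall>\<delta> \<delta>'. pathin (subtopology Y V) \<delta> \<and> pathin (subtopology Y V) \<delta>' \<and>
        \<delta> 0 = \<delta>' 0 \<and> \<delta> 1 = \<delta>' 1 \<longrightarrow> path_homotopic Y \<delta> \<delta>'"
    using Y(2) a unfolding semilocally_simply_connected_def by blast
  obtain U where U: "openin Y U" "path_connectedin Y U" "a \<in> U" "U \<subseteq> V"
    using Y(1)[unfolded locally_path_connected_space, rule_format, OF conjI[OF V(1,2)]] by (elim exE conjE)
  have sc: "path_homotopic Y \<delta> \<delta>'" if "pathin (subtopology Y U) \<delta>" "pathin (subtopology Y U) \<delta>'"
     "\<delta> 0 = \<delta>' 0" "\<delta> 1 = \<delta>' 1" for \<delta> \<delta>'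
    using V(3) U(4) that by (auto simp: pathin_subtopology subset_iff)
  define \<V> where "\<V> = {whisker Y U \<gamma> |\<gamma>. \<gamma> \<in> paths_from Y y \<and> \<gamma> 1 \<in> U}"
  have "\<Union>\<V> = {z \<in> topspace ?UC. endpoint z \<in> U}"
  proof
    show "\<Union>\<V> \<subseteq> {z \<in> topspace ?UC. endpoint z \<in> U}"
      unfolding \<V>_def using whisker_subset[of _ Y y U] endpoint_whisker[of Y]
      by (auto simp: topspace_universal_cover paths_from_def)
    show "{z \<in> topspace ?UC. endpoint z \<in> U} \<subseteq> \<Union>\<V>"
    proof
      fix z assume z: "z \<in> {z \<in> topspace ?UC. endpoint z \<in> U}"
      then obtain \<gamma> where \<gamma>: "pathin Y \<gamma>" "\<gamma> 0 = y" "z = path_class Y \<gamma>"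
        by (auto elim: in_universal_coverE)
      then have "\<gamma> 1 \<in> U" using z endpoint_path_class[OF \<gamma>(1)] by auto
      then show "z \<in> \<Union>\<V>"
        unfolding \<V>_def using \<gamma> path_class_in_whisker[of Y \<gamma> U] by (auto simp: paths_from_def)
    qed
  qed
  moreover have "pairwise disjnt \<V>"
    unfolding pairwise_def
  proof (intro ballI impI)
    fix A B assume A: "A \<in> \<V>" and B: "B \<in> \<V>" and "A \<noteq> B"
    obtain \<gamma> where \<gamma>: "A = whisker Y U \<gamma>" "\<gamma> \<in> paths_from Y y" using A unfolding \<V>_def by auto
    obtain \<gamma>' where \<gamma>': "B = whisker Y U \<gamma>'" "\<gamma>' \<in> paths_from Y y" using B unfolding \<V>_def by auto
    show "disjnt A B"
    proof (rule ccontr)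
      assume "\<not> disjnt A B"
      then obtain z where z: "z \<in> A" "z \<in> B" by (auto simp: disjnt_def)
      then have "z \<in> topspace ?UC"
        using whisker_subset[OF \<gamma>(2)] \<gamma>(1) by (auto simp: topspace_universal_cover)
      then obtain \<eta> where \<eta>: "pathin Y \<eta>" "z = path_class Y \<eta>" by (auto elim: in_universal_coverE)
      have "whisker Y U \<eta> = A" "whisker Y U \<eta> = B"
        using whisker_eq(1)[of Y \<gamma> \<eta> U] whisker_eq(1)[of Y \<gamma>' \<eta> U] \<gamma> \<gamma>' \<eta> z
        by (auto simp: paths_from_def)
      then show False using \<open>A \<noteq> B\<close> by simp
    qed
  qed
  moreover have "openin ?UC A \<and> homeomorphic_map (subtopology ?UC A) (subtopology Y U) endpoint"
    if "A \<in> \<V>" for A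
  proof -
    obtain \<gamma> where \<gamma>: "A = whisker Y U \<gamma>" "\<gamma> \<in> paths_from Y y" "\<gamma> 1 \<in> U"
      using \<open>A \<in> \<V>\<close> unfolding \<V>_def by auto
    show ?thesis
      unfolding \<gamma>(1)
      using openin_whisker[OF \<gamma>(2) U(1)] homeomorphic_map_endpoint_whisker[OF Y(1) U(1,2) sc \<gamma>(2,3)] by blast
  qed
  ultimately show "\<exists>U. openin Y U \<and> a \<in> U \<and> (\<exists>\<V>. \<Union>\<V> = {z \<in> topspace ?UC. endpoint z \<in> U} \<and>
      pairwise disjnt \<V> \<and> (\<forall>V\<in>\<V>. openin ?UC V \<and>
        homeomorphic_map (subtopology ?UC V) (subtopology Y U) endpoint))"
    using U by (intro exI[of _ U] conjI exI[of _ \<V>]) auto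
qed

text \<open>A path \<open>\<beta>\<close> in the base is lifted by attaching its initial segments.\<close>

lemma pathin_universal_cover:
  assumes \<gamma>: "pathin Y \<gamma>" "\<gamma> 0 = y" and \<beta>: "pathin Y \<beta>" "\<beta> 0 = \<gamma> 1"
  shows "pathin (universal_cover Y y) (\<lambda>t. path_class Y (path_concat \<gamma> (\<lambda>s. \<beta> (s * t))))"
    (is "pathin ?UC ?c")
proof -
  have \<beta>t: "pathin Y (\<lambda>s. \<beta> (s * t))" if "t \<in> {0..1}" for t
    unfolding pathin_def
    by (rule continuous_map_top_of_set_compose[OF \<beta>(1)[unfolded pathin_def]])
      (use that in \<open>auto intro!: continuous_intros mult_le_one\<close>)
  have cat: "pathin Y (path_concat \<gamma> (\<lambda>s. \<beta> (s * t)))" if "t \<in> {0..1}" for t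
    using \<gamma>(1) \<beta>t[OF that] \<beta>(2) by (intro pathin_concat) auto
  show ?thesis
    unfolding pathin_def continuous_map_def
  proof (intro conjI allI impI)
    show "?c \<in> topspace (top_of_set {0..1}) \<rightarrow> topspace ?UC"
      using cat \<gamma>(2) by (auto intro!: path_class_in_universal_cover)
    fix S assume S: "openin ?UC S"
    have "\<exists>e>0. \<forall>t\<in>{0..1}. dist t t0 < e \<longrightarrow> ?c t \<in> S" if t0: "t0 \<in> {0..1}" "?c t0 \<in> S" for t0
    proof -
      let ?\<eta> = "path_concat \<gamma> (\<lambda>s. \<beta> (s * t0))"
      have "?\<eta> \<in> paths_from Y y" using cat[OF t0(1)] \<gamma>(2) by (simp add: paths_from_def)
      then obtain U where U: "openin Y U" "?\<eta> 1 \<in> U" "whisker Y U ?\<eta> \<subseteq> S"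
        using S t0(2) unfolding openin_universal_cover by meson
      have "openin (top_of_set {0..1}) {t \<in> topspace (top_of_set {0..1}). \<beta> t \<in> U}"
        using \<beta>(1) U(1) unfolding pathin_def by (rule openin_continuous_map_preimage)
      then obtain e where e: "e > 0" "\<And>t. t \<in> {0..1} \<Longrightarrow> dist t t0 < e \<Longrightarrow> \<beta> t \<in> U"
        using t0(1) U(2) unfolding openin_euclidean_subtopology_iff by auto
      have "?c t \<in> S" if t: "t \<in> {0..1}" "dist t t0 < e" for t
      proof -
        let ?\<delta> = "\<lambda>s. \<beta> (t0 + s * (t - t0))"
        have seg: "t0 + s * (t - t0) \<in> {0..1}" "dist (t0 + s * (t - t0)) t0 < e" if "s \<in> {0..1}" for s
        proof -
          show "t0 + s * (t - t0) \<in> {0..1}"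
            using convexD[of "{0..1::real}" t0 t "1 - s" s] that t t0 by (simp add: algebra_simps)
          have "\<bar>s * (t - t0)\<bar> \<le> 1 * \<bar>t - t0\<bar>"
            using that unfolding abs_mult by (intro mult_right_mono) auto
          then show "dist (t0 + s * (t - t0)) t0 < e" using t(2) by (simp add: dist_real_def)
        qed
        have "pathin Y ?\<delta>"
          unfolding pathin_def
          by (rule continuous_map_top_of_set_compose[OF \<beta>(1)[unfolded pathin_def]])
            (use seg(1) in \<open>auto intro!: continuous_intros\<close>)
        then have \<delta>: "pathin (subtopology Y U) ?\<delta>"
          using e(2) seg by (simp add: pathin_subtopology)
        then have "path_class Y (path_concat ?\<eta> ?\<delta>) \<in> S"
          using U(3) unfolding whisker_def by fastforce
        moreover have "path_homotopic Y (path_concat ?\<eta> ?\<delta>) (path_concat \<gamma> (\<lambda>s. \<beta> (s * t)))"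
        proof -
          have "path_homotopic Y (path_concat ?\<eta> ?\<delta>)
              (path_concat \<gamma> (path_concat (\<lambda>s. \<beta> (s * t0)) ?\<delta>))"
            using \<gamma>(1) \<beta>t[OF t0(1)] \<open>pathin Y ?\<delta>\<close> \<beta>(2) by (intro path_concat_assoc) auto
          also have "path_homotopic Y \<dots> (path_concat \<gamma> (\<lambda>s. \<beta> (s * t)))"
            using path_concat_subpaths[OF \<beta>(1), of 0 t0 t] t0 t \<gamma>(1) \<beta>(2)
            by (intro path_homotopic_concat path_homotopic_refl) auto
          finally show ?thesis .
        qed
        ultimately show ?thesis using path_class_eq[of Y] by (metis (no_types, lifting))
      qed
      then show ?thesis using e(1) by blast
    qed
    then show "openin (top_of_set {0..1}) {t \<in> topspace (top_of_set {0..1}). ?c t \<in> S}"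
      unfolding openin_euclidean_subtopology_iff by auto
  qed
qed

lemma path_class_concat_const:
  "pathin Y \<gamma> \<Longrightarrow> path_class Y (path_concat \<gamma> (\<lambda>_. \<gamma> 1)) = path_class Y \<gamma>"
  by (intro path_class_eq path_concat_const_right) auto

lemma path_connected_space_universal_cover:
  assumes y: "y \<in> topspace Y"
  shows "path_connected_space (universal_cover Y y)"
proof -
  let ?UC = "universal_cover Y y"
  have base: "path_component_of ?UC (path_class Y (\<lambda>_. y)) z" if z: "z \<in> topspace ?UC" for z
  proof -
    obtain \<gamma> where \<gamma>: "pathin Y \<gamma>" "\<gamma> 0 = y" "z = path_class Y \<gamma>"
      using in_universal_coverE[OF z] .
    let ?c = "\<lambda>t. path_class Y (path_concat (\<lambda>_. y) (\<lambda>s. \<gamma> (s * t)))"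
    have "pathin ?UC ?c"
      by (rule pathin_universal_cover) (use y \<gamma> in auto)
    moreover have "?c 0 = path_class Y (\<lambda>_. y)"
      using path_class_concat_const[of Y "\<lambda>_. y"] y \<gamma>(2) by simp
    moreover have "?c 1 = z"
      using path_class_eq[OF path_concat_const_left[OF \<gamma>(1), of y]] \<gamma> by simp
    ultimately show ?thesis unfolding path_component_of_def by (intro exI[of _ ?c]) simp
  qed
  show ?thesis
    unfolding path_connected_space_iff_path_component
  proof (intro ballI)
    fix z z' assume "z \<in> topspace ?UC" "z' \<in> topspace ?UC"
    then show "path_component_of ?UC z z'"
      using base[of z] base[of z'] path_component_of_sym path_component_of_trans by metis
  qed
qed

text \<open>Both sides end a lift of \<open>endpoint \<circ> c\<close> that starts at the class of \<open>\<gamma>\<close>. For a closed path \<open>c\<close> this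
  shows that its image in \<open>Y\<close> contracts, which is the simple connectedness of the universal cover.\<close>

lemma universal_cover_path_end:
  assumes cov: "covering_map (universal_cover Y y) Y endpoint"
    and c: "pathin (universal_cover Y y) c" and \<gamma>: "pathin Y \<gamma>" "\<gamma> 0 = y" "c 0 = path_class Y \<gamma>"
  shows "c 1 = path_class Y (path_concat \<gamma> (endpoint \<circ> c))"
proof -
  let ?\<beta> = "endpoint \<circ> c"
  let ?d = "\<lambda>t. path_class Y (path_concat \<gamma> (\<lambda>s. ?\<beta> (s * t)))"
  have \<beta>: "pathin Y ?\<beta>" "?\<beta> 0 = \<gamma> 1"
    using pathin_compose[OF c continuous_map_endpoint] endpoint_path_class[OF \<gamma>(1)] \<gamma>(3) by auto
  have d: "pathin (universal_cover Y y) ?d" by (rule pathin_universal_cover[OF \<gamma>(1,2) \<beta>])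
  have "?d 0 = path_class Y \<gamma>"
    using path_class_concat_const[OF \<gamma>(1)] \<beta>(2) by simp
  then have start: "c 0 = ?d 0" using \<gamma>(3) by simp
  have over: "endpoint (c t) = endpoint (?d t)" if t: "0 \<le> t" "t \<le> 1" for t
  proof -
    have "pathin Y (\<lambda>s. ?\<beta> (s * t))"
      unfolding pathin_def
      by (rule continuous_map_top_of_set_compose[OF \<beta>(1)[unfolded pathin_def]])
        (use that in \<open>auto intro!: continuous_intros mult_le_one\<close>)
    then have "pathin Y (path_concat \<gamma> (\<lambda>s. ?\<beta> (s * t)))"
      using \<gamma>(1) \<beta>(2) by (intro pathin_concat) auto
    then show ?thesis by (simp add: endpoint_path_class)
  qed
  have "c 1 = ?d 1" by (rule path_lifts_equal[OF cov c d start over]) auto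
  then show ?thesis by (simp add: o_def)
qed

text \<open>A covering of \<open>Y\<close> receives a map from the universal cover: a path class goes to the end of
  its lift. It is continuous because, when the path is prolonged inside an evenly covered set, the end
  of the lift moves along the sheet.\<close>

lemma universal_cover_map:
  assumes p: "covering_map X Y p" and x: "x \<in> topspace X" "p x = y"
  obtains \<l> where "continuous_map (universal_cover Y y) X \<l>"
    "\<And>z. z \<in> topspace (universal_cover Y y) \<Longrightarrow> p (\<l> z) = endpoint z"
    "\<And>\<beta>. pathin X \<beta> \<Longrightarrow> \<beta> 0 = x \<Longrightarrow> \<l> (path_class Y (p \<circ> \<beta>)) = \<beta> 1"
proof -
  let ?UC = "universal_cover Y y"
  define \<l> where "\<l> z = (SOME e. \<exists>\<beta>. pathin X \<beta> \<and> \<beta> 0 = x \<and> path_class Y (p \<circ> \<beta>) = z \<and> e = \<beta> 1)" for z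
  note pc = covering_map_imp_continuous[OF p]
  have l: "\<l> (path_class Y (p \<circ> \<beta>)) = \<beta> 1" if \<beta>: "pathin X \<beta>" "\<beta> 0 = x" for \<beta>
    unfolding \<l>_def
  proof (rule some_equality)
    show "\<exists>\<beta>'. pathin X \<beta>' \<and> \<beta>' 0 = x \<and> path_class Y (p \<circ> \<beta>') = path_class Y (p \<circ> \<beta>) \<and> \<beta> 1 = \<beta>' 1"
      using \<beta> by blast
    fix e assume "\<exists>\<beta>'. pathin X \<beta>' \<and> \<beta>' 0 = x \<and> path_class Y (p \<circ> \<beta>') = path_class Y (p \<circ> \<beta>) \<and> e = \<beta>' 1"
    then obtain \<beta>' where \<beta>': "pathin X \<beta>'" "\<beta>' 0 = x" "path_class Y (p \<circ> \<beta>') = path_class Y (p \<circ> \<beta>)" "e = \<beta>' 1"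
      by blast
    have "path_homotopic Y (p \<circ> \<beta>') (p \<circ> \<beta>)"
      by (rule path_class_eqD[OF pathin_compose[OF \<beta>(1) pc] \<beta>'(3)])
    from homotopic_path_lifts_end[OF p \<beta>'(1) \<beta>(1) _ this] show "e = \<beta> 1"
      using \<beta> \<beta>' by simp
  qed
  have lift: "\<exists>\<beta>. pathin X \<beta> \<and> \<beta> 0 = x \<and> path_class Y (p \<circ> \<beta>) = z" if z: "z \<in> topspace ?UC" for z
  proof -
    obtain \<gamma> where \<gamma>: "pathin Y \<gamma>" "\<gamma> 0 = y" "z = path_class Y \<gamma>" using in_universal_coverE[OF z] .
    obtain \<beta> where \<beta>: "pathin X \<beta>" "\<beta> 0 = x" "\<And>t. 0 \<le> t \<Longrightarrow> t \<le> 1 \<Longrightarrow> p (\<beta> t) = \<gamma> t"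
      using covering_map_lift_path[OF p \<gamma>(1) x(1)] x(2) \<gamma>(2) by auto
    have "path_homotopic Y (p \<circ> \<beta>) \<gamma>"
      by (rule path_homotopic_eq[OF pathin_compose[OF \<beta>(1) pc]]) (use \<beta>(3) in auto)
    then show ?thesis using \<beta> \<gamma>(3) path_class_eq by blast
  qed
  have pl: "p (\<l> z) = endpoint z" if z: "z \<in> topspace ?UC" for z
  proof -
    obtain \<beta> where \<beta>: "pathin X \<beta>" "\<beta> 0 = x" "path_class Y (p \<circ> \<beta>) = z" using lift[OF z] by blast
    then show ?thesis using l[OF \<beta>(1,2)] endpoint_path_class[OF pathin_compose[OF \<beta>(1) pc]] by simp
  qed
  have "continuous_map ?UC X \<l>"
    unfolding continuous_map_def
  proof (intro conjI allI impI)
    show "\<l> \<in> topspace ?UC \<rightarrow> topspace X"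
    proof
      fix z assume "z \<in> topspace ?UC"
      then obtain \<beta> where \<beta>: "pathin X \<beta>" "\<beta> 0 = x" "path_class Y (p \<circ> \<beta>) = z" using lift by blast
      then show "\<l> z \<in> topspace X" using l[OF \<beta>(1,2)] path_finish_in_topspace[OF \<beta>(1)] by simp
    qed
    fix S assume S: "openin X S"
    show "openin ?UC {z \<in> topspace ?UC. \<l> z \<in> S}" (is "openin _ ?T")
      unfolding openin_universal_cover
    proof (intro conjI ballI impI)
      show "?T \<subseteq> path_class Y ` paths_from Y y" by (auto simp: topspace_universal_cover)
      fix \<gamma> assume \<gamma>: "\<gamma> \<in> paths_from Y y" "path_class Y \<gamma> \<in> ?T"
      then obtain \<beta> where \<beta>: "pathin X \<beta>" "\<beta> 0 = x" "path_class Y (p \<circ> \<beta>) = path_class Y \<gamma>"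
        using lift by blast
      have \<beta>S: "\<beta> 1 \<in> S" using \<gamma>(2) l[OF \<beta>(1,2)] \<beta>(3) by simp
      have hom: "path_homotopic Y (p \<circ> \<beta>) \<gamma>"
        using path_class_eqD[of Y \<gamma> "p \<circ> \<beta>"] \<gamma>(1) \<beta>(3) by (simp add: paths_from_def)
      then have ends: "\<gamma> 1 = p (\<beta> 1)" using path_homotopic_ends by fastforce
      have \<beta>1: "\<beta> 1 \<in> topspace X" using path_finish_in_topspace[OF \<beta>(1)] .
      obtain U where U: "openin Y U" "p (\<beta> 1) \<in> U"
        "\<And>x. x \<in> topspace X \<Longrightarrow> p x \<in> U \<Longrightarrow>
          \<exists>V \<sigma>. openin X V \<and> x \<in> V \<and> continuous_map (subtopology Y U) X \<sigma> \<and>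
            (\<forall>v\<in>V. p v \<in> U \<and> \<sigma> (p v) = v) \<and> (\<forall>u\<in>U. \<sigma> u \<in> V \<and> p (\<sigma> u) = u)"
        using covering_map_evenly_covered[OF p covering_map_in_topspace[OF p \<beta>1]] by blast
      obtain V \<sigma> where V: "\<beta> 1 \<in> V" "continuous_map (subtopology Y U) X \<sigma>"
          "\<forall>v\<in>V. p v \<in> U \<and> \<sigma> (p v) = v" "\<forall>u\<in>U. \<sigma> u \<in> V \<and> p (\<sigma> u) = u"
        using U(3)[OF \<beta>1 U(2)] by blast
      define U' where "U' = {u \<in> topspace (subtopology Y U). \<sigma> u \<in> S}"
      have "openin (subtopology Y U) U'"
        unfolding U'_def using V(2) S by (rule openin_continuous_map_preimage)
      then have "openin Y U'" using openin_trans_full[OF _ U(1)] by blast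
      moreover have "\<gamma> 1 \<in> U'"
        using U(1,2) V(1,3) \<beta>S openin_subset[OF U(1)] unfolding U'_def ends by auto
      moreover have "whisker Y U' \<gamma> \<subseteq> ?T"
      proof
        fix z assume z: "z \<in> whisker Y U' \<gamma>"
        then obtain \<delta> where \<delta>: "pathin (subtopology Y U') \<delta>" "\<delta> 0 = \<gamma> 1" "z = path_class Y (path_concat \<gamma> \<delta>)"
          unfolding whisker_def by blast
        have U'U: "U' \<subseteq> U" "U' \<subseteq> {u. \<sigma> u \<in> S}" unfolding U'_def by auto
        have \<delta>U: "pathin (subtopology Y U) \<delta>" and \<delta>in: "\<And>t. t \<in> {0..1} \<Longrightarrow> \<delta> t \<in> U'" and \<delta>Y: "pathin Y \<delta>"
          using \<delta>(1) U'U by (auto simp: pathin_subtopology)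
        have p\<sigma>: "p (\<sigma> (\<delta> t)) = \<delta> t" if "0 \<le> t" "t \<le> 1" for t
          using \<delta>in[of t] that U'U V(4) by auto
        let ?\<beta> = "path_concat \<beta> (\<sigma> \<circ> \<delta>)"
        have join: "\<beta> 1 = (\<sigma> \<circ> \<delta>) 0" using \<delta>(2) ends V(1,3) by simp
        have path: "pathin X ?\<beta>"
          by (rule pathin_concat[OF \<beta>(1) pathin_compose[OF \<delta>U V(2)] join])
        have "path_homotopic Y (p \<circ> ?\<beta>) (path_concat (p \<circ> \<beta>) \<delta>)"
          by (intro path_homotopic_eq pathin_compose[OF path pc]) (auto simp: path_concat_def p\<sigma>)
        also have "path_homotopic Y \<dots> (path_concat \<gamma> \<delta>)"
          using hom \<delta>(2) ends path_homotopic_refl[OF \<delta>Y] by (intro path_homotopic_concat) auto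
        finally have "path_class Y (p \<circ> ?\<beta>) = z" using path_class_eq \<delta>(3) by blast
        then have "\<l> z = \<sigma> (\<delta> 1)" using l[OF path] \<beta>(2) by auto
        moreover have "\<sigma> (\<delta> 1) \<in> S" using \<delta>in[of 1] U'U by auto
        ultimately show "z \<in> ?T"
          using z whisker_subset[OF \<gamma>(1), of U'] by (auto simp: topspace_universal_cover)
      qed
      ultimately show "\<exists>U. openin Y U \<and> \<gamma> 1 \<in> U \<and> whisker Y U \<gamma> \<subseteq> ?T" by blast
    qed
  qed
  then show thesis using that pl l by blast
qed

section \<open>Principal coverings\<close>

locale continuous_action = group G for G (structure) +
  fixes Z :: "'z topology" and \<alpha> :: "'a \<Rightarrow> 'z \<Rightarrow> 'z"
  assumes act_continuous: "g \<in> carrier G \<Longrightarrow> continuous_map Z Z (\<alpha> g)"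
    and act_one: "z \<in> topspace Z \<Longrightarrow> \<alpha> \<one> z = z"
    and act_mult: "g \<in> carrier G \<Longrightarrow> h \<in> carrier G \<Longrightarrow> z \<in> topspace Z \<Longrightarrow> \<alpha> (g \<otimes> h) z = \<alpha> g (\<alpha> h z)"
begin

lemma act_in: "g \<in> carrier G \<Longrightarrow> z \<in> topspace Z \<Longrightarrow> \<alpha> g z \<in> topspace Z"
  using act_continuous continuous_map_in_topspace by metis

lemma act_inv: "g \<in> carrier G \<Longrightarrow> z \<in> topspace Z \<Longrightarrow> \<alpha> (inv g) (\<alpha> g z) = z"
  using act_mult[of "inv g" g z] by (simp add: act_one)

lemma act_inv': "g \<in> carrier G \<Longrightarrow> z \<in> topspace Z \<Longrightarrow> \<alpha> g (\<alpha> (inv g) z) = z"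
  using act_mult[of g "inv g" z] by (simp add: act_one)

end

locale principal_covering = continuous_action G P \<alpha> for G (structure) and P :: "'z topology" and \<alpha> +
  fixes Y :: "'y topology" and \<pi> :: "'z \<Rightarrow> 'y"
  assumes covering: "covering_map P Y \<pi>"
    and act_fibre: "g \<in> carrier G \<Longrightarrow> z \<in> topspace P \<Longrightarrow> \<pi> (\<alpha> g z) = \<pi> z"
    and transitive: "z \<in> topspace P \<Longrightarrow> z' \<in> topspace P \<Longrightarrow> \<pi> z = \<pi> z' \<Longrightarrow> \<exists>g\<in>carrier G. z' = \<alpha> g z"
    and free: "g \<in> carrier G \<Longrightarrow> z \<in> topspace P \<Longrightarrow> \<alpha> g z = z \<Longrightarrow> g = \<one>"

text \<open>Concatenation on classes of paths. With \<open>A\<close> the class of a loop at the base point it is the deck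
  transformation that \<open>A\<close> represents.\<close>

definition deck_action :: "'a topology \<Rightarrow> (real \<Rightarrow> 'a) set \<Rightarrow> (real \<Rightarrow> 'a) set \<Rightarrow> (real \<Rightarrow> 'a) set" where
  "deck_action Y A z = {r. \<exists>p\<in>A. \<exists>q\<in>z. path_homotopic Y (path_concat p q) r}"

lemma deck_action_path_class:
  assumes "pathin Y \<omega>" "pathin Y \<gamma>" "\<omega> 1 = \<gamma> 0"
  shows "deck_action Y (path_class Y \<omega>) (path_class Y \<gamma>) = path_class Y (path_concat \<omega> \<gamma>)"
proof
  show "path_class Y (path_concat \<omega> \<gamma>) \<subseteq> deck_action Y (path_class Y \<omega>) (path_class Y \<gamma>)"
    unfolding deck_action_def path_class_def using path_homotopic_refl assms by blast
  show "deck_action Y (path_class Y \<omega>) (path_class Y \<gamma>) \<subseteq> path_class Y (path_concat \<omega> \<gamma>)"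
  proof
    fix r assume "r \<in> deck_action Y (path_class Y \<omega>) (path_class Y \<gamma>)"
    then obtain p q where "path_homotopic Y \<omega> p" "path_homotopic Y \<gamma> q" "path_homotopic Y (path_concat p q) r"
      unfolding deck_action_def path_class_def by blast
    then have "path_homotopic Y (path_concat \<omega> \<gamma>) r"
      using path_homotopic_trans[OF path_homotopic_concat[of Y \<omega> p \<gamma> q]] assms(3) by blast
    then show "r \<in> path_class Y (path_concat \<omega> \<gamma>)" by (simp add: path_class_def)
  qed
qed

lemma loop_class_eq_path_class:
  "p 0 = y \<Longrightarrow> p 1 = y \<Longrightarrow> loop_class Y y p = path_class Y p"
  by (simp add: loop_class_def path_class_def loop_homotopic_iff)

lemma fundamental_group_carrier:
  "carrier (fundamental_group Y y) = path_class Y ` {p. pathin Y p \<and> p 0 = y \<and> p 1 = y}"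
  unfolding fundamental_group_def using loop_class_eq_path_class[of _ y Y] by (auto simp: image_def)

lemma fundamental_group_mult:
  assumes "pathin Y p" "p 0 = y" "p 1 = y" "pathin Y q" "q 0 = y" "q 1 = y"
  shows "path_class Y p \<otimes>\<^bsub>fundamental_group Y y\<^esub> path_class Y q = path_class Y (path_concat p q)"
proof -
  have "path_class Y p \<otimes>\<^bsub>fundamental_group Y y\<^esub> path_class Y q
      = {r. \<exists>a\<in>path_class Y p. \<exists>b\<in>path_class Y q. loop_homotopic Y y (path_concat a b) r}"
    by (simp add: fundamental_group_def)
  also have "\<dots> = deck_action Y (path_class Y p) (path_class Y q)"
    unfolding deck_action_def path_class_def loop_homotopic_iff
    using assms path_homotopic_ends[of Y p] path_homotopic_ends[of Y q] by (auto, metis+)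
  finally show ?thesis using deck_action_path_class[of Y p q] assms by simp
qed

text \<open>Two paths with the same end differ by a loop, which gives transitivity on the fibres; a loop whose
  deck transformation fixes a path class contracts, which gives freeness.\<close>

theorem principal_covering_universal_cover:
  assumes G: "group G"
    and Y: "locally_path_connected_space Y" "semilocally_simply_connected Y" "path_connected_space Y"
    and y: "y \<in> topspace Y" and \<psi>: "\<psi> \<in> iso (fundamental_group Y y) G"
  shows "principal_covering G (universal_cover Y y)
     (\<lambda>g. deck_action Y (inv_into (carrier (fundamental_group Y y)) \<psi> g)) Y endpoint"
proof -
  interpret group G by (rule G)
  let ?\<pi> = "fundamental_group Y y" and ?UC = "universal_cover Y y"
  have bij: "bij_betw \<psi> (carrier ?\<pi>) (carrier G)"
    and hom: "\<And>A B. A \<in> carrier ?\<pi> \<Longrightarrow> B \<in> carrier ?\<pi> \<Longrightarrow> \<psi> (A \<otimes>\<^bsub>?\<pi>\<^esub> B) = \<psi> A \<otimes>\<^bsub>G\<^esub> \<psi> B"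
    using \<psi> by (auto simp: iso_def hom_def)
  define loopat where "loopat = {p. pathin Y p \<and> p 0 = y \<and> p 1 = y}"
  have car: "carrier ?\<pi> = path_class Y ` loopat" by (simp add: fundamental_group_carrier loopat_def)
  have loop: "\<exists>\<omega>. \<omega> \<in> loopat \<and> inv_into (carrier ?\<pi>) \<psi> g = path_class Y \<omega>"
    if "g \<in> carrier G" for g
    using bij_betw_imp_surj_on[OF bij] inv_into_into[of g \<psi> "carrier ?\<pi>"] that car by blast
  define \<omega> where "\<omega> g = (SOME p. p \<in> loopat \<and> inv_into (carrier ?\<pi>) \<psi> g = path_class Y p)" for g
  have \<omega>: "\<omega> g \<in> loopat" "inv_into (carrier ?\<pi>) \<psi> g = path_class Y (\<omega> g)" if "g \<in> carrier G" for g
    using someI_ex[OF loop[OF that]] unfolding \<omega>_def by blast+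
  have \<psi>\<omega>: "\<psi> (path_class Y (\<omega> g)) = g" if "g \<in> carrier G" for g
    using f_inv_into_f[of g \<psi> "carrier ?\<pi>"] bij_betw_imp_surj_on[OF bij] \<omega>(2)[OF that] that by simp
  have inj: "path_homotopic Y a b"
    if "a \<in> loopat" "b \<in> loopat" "\<psi> (path_class Y a) = \<psi> (path_class Y b)" for a b
    using bij_betw_imp_inj_on[OF bij] that path_class_eqD[of Y b a] unfolding car
    by (auto simp: inj_on_def loopat_def)
  have \<psi>mult: "\<psi> (path_class Y (path_concat a b)) = \<psi> (path_class Y a) \<otimes>\<^bsub>G\<^esub> \<psi> (path_class Y b)"
    if "a \<in> loopat" "b \<in> loopat" for a b
    using hom[of "path_class Y a" "path_class Y b"] fundamental_group_mult[of Y a y b] that car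
    by (simp add: loopat_def)
  have \<psi>car: "\<psi> (path_class Y a) \<in> carrier G" if "a \<in> loopat" for a
    using bij_betwE[OF bij] that car by blast
  have cl: "path_concat a b \<in> loopat" if "a \<in> loopat" "b \<in> loopat" for a b
    using that by (auto simp: loopat_def intro: pathin_concat)
  have const: "(\<lambda>_. y) \<in> loopat" using y by (simp add: loopat_def)
  have \<psi>one: "\<psi> (path_class Y (\<lambda>_. y)) = \<one>\<^bsub>G\<^esub>"
  proof -
    have "path_class Y (path_concat (\<lambda>_. y) (\<lambda>_. y)) = path_class Y (\<lambda>_. y)"
      using path_class_concat_const[of Y "\<lambda>_. y"] y by simp
    then show ?thesis using \<psi>mult[OF const const] l_cancel_one[OF \<psi>car[OF const] \<psi>car[OF const]] by simp
  qed
  define act where "act = (\<lambda>g. deck_action Y (inv_into (carrier ?\<pi>) \<psi> g))"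
  have act: "act g (path_class Y \<gamma>) = path_class Y (path_concat (\<omega> g) \<gamma>)"
    if "g \<in> carrier G" "pathin Y \<gamma>" "\<gamma> 0 = y" for g \<gamma>
    unfolding act_def \<omega>(2)[OF that(1)]
    by (rule deck_action_path_class) (use \<omega>(1)[OF that(1)] that in \<open>auto simp: loopat_def\<close>)
  have cat: "pathin Y (path_concat a \<gamma>)" "path_concat a \<gamma> 0 = y"
    if "a \<in> loopat" "pathin Y \<gamma>" "\<gamma> 0 = y" for a \<gamma>
    using that by (auto simp: loopat_def intro: pathin_concat)
  have cong: "path_homotopic Y (path_concat a \<gamma>) (path_concat b \<gamma>)"
    if "path_homotopic Y a b" "a \<in> loopat" "pathin Y \<gamma>" "\<gamma> 0 = y" for a b \<gamma>
    using that by (intro path_homotopic_concat path_homotopic_refl) (auto simp: loopat_def)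
  have "principal_covering G ?UC act Y endpoint"
  proof (unfold_locales, goal_cases)
    case (1 g)
    show ?case
      unfolding continuous_map_def
    proof (intro conjI allI impI)
      show "act g \<in> topspace ?UC \<rightarrow> topspace ?UC"
        using act[OF 1] cat[OF \<omega>(1)[OF 1]]
        by (auto elim!: in_universal_coverE intro!: path_class_in_universal_cover)
      fix S assume S: "openin ?UC S"
      show "openin ?UC {z \<in> topspace ?UC. act g z \<in> S}" (is "openin _ ?T")
        unfolding openin_universal_cover
      proof (intro conjI ballI impI)
        show "?T \<subseteq> path_class Y ` paths_from Y y" by (auto simp: topspace_universal_cover)
        fix \<gamma> assume \<gamma>: "\<gamma> \<in> paths_from Y y" "path_class Y \<gamma> \<in> ?T"
        then have p: "pathin Y \<gamma>" "\<gamma> 0 = y" by (auto simp: paths_from_def)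
        have "path_concat (\<omega> g) \<gamma> \<in> paths_from Y y" "path_class Y (path_concat (\<omega> g) \<gamma>) \<in> S"
          using \<gamma>(2) act[OF 1 p] cat[OF \<omega>(1)[OF 1] p] by (auto simp: paths_from_def)
        then obtain U where U: "openin Y U" "\<gamma> 1 \<in> U" "whisker Y U (path_concat (\<omega> g) \<gamma>) \<subseteq> S"
          using S unfolding openin_universal_cover by (metis path_concat_ends(2))
        have "whisker Y U \<gamma> \<subseteq> ?T"
        proof
          fix z assume z: "z \<in> whisker Y U \<gamma>"
          then obtain \<delta> where \<delta>: "pathin (subtopology Y U) \<delta>" "\<delta> 0 = \<gamma> 1" "z = path_class Y (path_concat \<gamma> \<delta>)"
            unfolding whisker_def by blast
          have \<delta>Y: "pathin Y \<delta>" using \<delta>(1) by (simp add: pathin_subtopology)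
          have "act g z = path_class Y (path_concat (\<omega> g) (path_concat \<gamma> \<delta>))"
            unfolding \<delta>(3) using p \<delta>(2) \<delta>Y by (intro act[OF 1] pathin_concat) auto
          also have "\<dots> = path_class Y (path_concat (path_concat (\<omega> g) \<gamma>) \<delta>)"
            using \<omega>(1)[OF 1] p \<delta>Y \<delta>(2)
            by (intro path_class_eq path_homotopic_sym[OF path_concat_assoc]) (auto simp: loopat_def)
          also have "\<dots> \<in> S" using U(3) \<delta>(1,2) unfolding whisker_def by auto
          finally show "z \<in> ?T"
            using z whisker_subset[OF \<gamma>(1), of U] by (auto simp: topspace_universal_cover)
        qed
        then show "\<exists>U. openin Y U \<and> \<gamma> 1 \<in> U \<and> whisker Y U \<gamma> \<subseteq> ?T" using U by blast
      qed
    qed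
  next
    case (2 z)
    then obtain \<gamma> where \<gamma>: "pathin Y \<gamma>" "\<gamma> 0 = y" "z = path_class Y \<gamma>" using in_universal_coverE by metis
    have "path_homotopic Y (\<omega> \<one>\<^bsub>G\<^esub>) (\<lambda>_. y)"
      using inj[OF \<omega>(1) const] \<psi>\<omega> \<psi>one by simp
    from path_homotopic_trans[OF cong[OF this \<omega>(1) \<gamma>(1,2)] path_concat_const_left[OF \<gamma>(1)]]
    show ?case using act[OF _ \<gamma>(1,2)] \<gamma> path_class_eq by simp
  next
    case (3 g h z)
    then obtain \<gamma> where \<gamma>: "pathin Y \<gamma>" "\<gamma> 0 = y" "z = path_class Y \<gamma>" using in_universal_coverE by metis
    note L = \<omega>(1)[OF 3(1)] \<omega>(1)[OF 3(2)]
    have "path_homotopic Y (\<omega> (g \<otimes>\<^bsub>G\<^esub> h)) (path_concat (\<omega> g) (\<omega> h))"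
      using inj[OF \<omega>(1) cl[OF L]] \<psi>\<omega> \<psi>mult[OF L] 3 by simp
    from cong[OF this \<omega>(1) \<gamma>(1,2)] 3
    have "path_homotopic Y (path_concat (\<omega> (g \<otimes>\<^bsub>G\<^esub> h)) \<gamma>) (path_concat (path_concat (\<omega> g) (\<omega> h)) \<gamma>)" by simp
    also have "path_homotopic Y \<dots> (path_concat (\<omega> g) (path_concat (\<omega> h) \<gamma>))"
      using L \<gamma> by (intro path_concat_assoc) (auto simp: loopat_def)
    finally show ?case
      using act[OF _ \<gamma>(1,2)] act[OF 3(1) cat[OF L(2) \<gamma>(1,2)]] 3 \<gamma>(3) path_class_eq by simp
  next
    case 4 show ?case by (rule covering_map_endpoint[OF Y y])
  next
    case (5 g z)
    then obtain \<gamma> where \<gamma>: "pathin Y \<gamma>" "\<gamma> 0 = y" "z = path_class Y \<gamma>" using in_universal_coverE by metis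
    show ?case
      using act[OF 5(1) \<gamma>(1,2)] endpoint_path_class[OF cat(1)[OF \<omega>(1)[OF 5(1)] \<gamma>(1,2)]]
        endpoint_path_class[OF \<gamma>(1)] \<gamma>(3) by simp
  next
    case (6 z z')
    obtain \<gamma> where \<gamma>: "pathin Y \<gamma>" "\<gamma> 0 = y" "z = path_class Y \<gamma>" using in_universal_coverE[OF 6(1)] .
    obtain \<gamma>' where \<gamma>': "pathin Y \<gamma>'" "\<gamma>' 0 = y" "z' = path_class Y \<gamma>'" using in_universal_coverE[OF 6(2)] .
    have e: "\<gamma>' 1 = \<gamma> 1" using 6(3) \<gamma> \<gamma>' by (simp add: endpoint_path_class)
    let ?w = "path_concat \<gamma>' (\<lambda>t. \<gamma> (1 - t))"
    have w: "?w \<in> loopat"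
      using \<gamma> \<gamma>' e pathin_reverse[OF \<gamma>(1)] by (auto simp: loopat_def intro: pathin_concat)
    let ?g = "\<psi> (path_class Y ?w)"
    note g = \<psi>car[OF w]
    have "path_homotopic Y (\<omega> ?g) ?w" using inj[OF \<omega>(1)[OF g] w] \<psi>\<omega>[OF g] by simp
    from path_homotopic_trans[OF cong[OF this \<omega>(1)[OF g] \<gamma>(1,2)] path_concat_reverse_cancel[OF \<gamma>'(1) \<gamma>(1) e]]
    have "act ?g z = z'" using act[OF g \<gamma>(1,2)] \<gamma>(3) \<gamma>'(3) path_class_eq by simp
    then show ?case using g by blast
  next
    case (7 g z)
    then obtain \<gamma> where \<gamma>: "pathin Y \<gamma>" "\<gamma> 0 = y" "z = path_class Y \<gamma>" using in_universal_coverE by metis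
    let ?r = "\<lambda>t. \<gamma> (1 - t)"
    note L = \<omega>(1)[OF 7(1)] and r = pathin_reverse[OF \<gamma>(1)]
    have Lp: "pathin Y (\<omega> g)" "\<omega> g 0 = y" "\<omega> g 1 = y" using L by (auto simp: loopat_def)
    have fix\<gamma>: "path_homotopic Y (path_concat (\<omega> g) \<gamma>) \<gamma>"
      using path_class_eqD[OF \<gamma>(1)] act[OF 7(1) \<gamma>(1,2)] 7(3) \<gamma>(3) by simp
    have "path_homotopic Y (path_concat (\<omega> g) (path_concat \<gamma> ?r)) (path_concat (\<omega> g) (\<lambda>_. y))"
      using Lp \<gamma>(2) path_concat_reverse_right[OF \<gamma>(1)] by (intro path_homotopic_concat path_homotopic_refl) auto
    also have "path_homotopic Y \<dots> (\<omega> g)" using Lp by (intro path_concat_const_right) auto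
    finally have "path_homotopic Y (\<omega> g) (path_concat (\<omega> g) (path_concat \<gamma> ?r))" by (rule path_homotopic_sym)
    also have "path_homotopic Y \<dots> (path_concat (path_concat (\<omega> g) \<gamma>) ?r)"
      by (rule path_homotopic_sym, rule path_concat_assoc) (use Lp \<gamma> r in auto)
    also have "path_homotopic Y \<dots> (path_concat \<gamma> ?r)"
      using fix\<gamma> r by (intro path_homotopic_concat path_homotopic_refl) auto
    also have "path_homotopic Y \<dots> (\<lambda>_. y)" using path_concat_reverse_right[OF \<gamma>(1)] \<gamma>(2) by simp
    finally have "path_class Y (\<omega> g) = path_class Y (\<lambda>_. y)" by (rule path_class_eq)
    then show ?case using \<psi>\<omega>[OF 7(1)] \<psi>one by simp
  qed
  then show ?thesis by (simp add: act_def)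
qed


section \<open>Discs\<close>

lemma Euclidean_space_top_of_set: "Euclidean_space n = top_of_set {x. \<forall>i\<ge>n. x i = 0}"
  by (simp add: Euclidean_space_def euclidean_product_topology)

lemma disc_top_of_set: "disc n = top_of_set {x. (\<forall>i\<ge>n. x i = 0) \<and> (\<Sum>i<n. (x i)\<^sup>2) \<le> 1}"
  by (simp add: disc_def Euclidean_space_top_of_set subtopology_subtopology Collect_conj_eq)

lemma topspace_disc: "topspace (disc n) = {x. (\<forall>i\<ge>n. x i = 0) \<and> (\<Sum>i<n. (x i)\<^sup>2) \<le> 1}"
  by (simp add: disc_top_of_set)

lemma topspace_open_disc: "topspace (open_disc n) = {x. (\<forall>i\<ge>n. x i = 0) \<and> (\<Sum>i<n. (x i)\<^sup>2) < 1}"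
  by (auto simp: open_disc_def topspace_Euclidean_space)

lemma disc_boundary_eq: "disc_boundary n = {x. (\<forall>i\<ge>n. x i = 0) \<and> (\<Sum>i<n. (x i)\<^sup>2) = 1}"
  by (auto simp: disc_boundary_def topspace_Euclidean_space)

lemma topspace_disc_Un: "topspace (disc n) = topspace (open_disc n) \<union> disc_boundary n"
  by (auto simp: topspace_disc topspace_open_disc disc_boundary_eq)

lemma open_disc_top_of_set:
  "open_disc n = top_of_set {x. (\<forall>i\<ge>n. x i = 0) \<and> (\<Sum>i<n. (x i)\<^sup>2) < 1}"
  by (simp add: open_disc_def Euclidean_space_top_of_set subtopology_subtopology Collect_conj_eq)

lemma continuous_on_sum_squares: "continuous_on UNIV (\<lambda>x::nat \<Rightarrow> real. \<Sum>i<n. (x i)\<^sup>2)"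
  by (intro continuous_intros continuous_on_product_coordinates)

lemma closed_disc: "closed (topspace (disc n))"
proof -
  have "topspace (disc n) = (\<Inter>i\<in>{n..}. {x. x i = 0}) \<inter> {x. (\<Sum>i<n. (x i)\<^sup>2) \<le> 1}"
    by (auto simp: topspace_disc)
  moreover have "closed {x :: nat \<Rightarrow> real. x i = 0}" for i
    by (intro closed_Collect_eq continuous_on_product_coordinates continuous_on_const)
  moreover have "closed {x :: nat \<Rightarrow> real. (\<Sum>i<n. (x i)\<^sup>2) \<le> 1}"
    by (intro closed_Collect_le continuous_on_sum_squares continuous_on_const)
  ultimately show ?thesis by (simp only:) (intro closed_Int closed_INT ballI)
qed

lemma compact_disc: "compact (topspace (disc n))"
proof -
  have "compactin (powertop_real UNIV) (PiE UNIV (\<lambda>_. {-1..1}))"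
    by (simp add: compactin_PiE)
  then have K: "compact (PiE (UNIV :: nat set) (\<lambda>_. {-1..1::real}))"
    by (simp add: euclidean_product_topology)
  have "topspace (disc n) \<subseteq> PiE UNIV (\<lambda>_. {-1..1})"
  proof
    fix x assume x: "x \<in> topspace (disc n)"
    have "x i \<in> {-1..1}" for i
    proof (cases "i < n")
      case True
      then have "(x i)\<^sup>2 \<le> (\<Sum>i<n. (x i)\<^sup>2)" by (intro member_le_sum) auto
      then have "(x i)\<^sup>2 \<le> 1" using x by (simp add: topspace_disc)
      then show ?thesis using abs_square_le_1 by (auto simp: abs_le_iff)
    qed (use x in \<open>auto simp: topspace_disc\<close>)
    then show "x \<in> PiE UNIV (\<lambda>_. {-1..1})" by auto
  qed
  then show ?thesis using closed_Int_compact[OF closed_disc K, of n] by (simp add: Int_absorb2)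
qed

lemma compact_space_disc: "compact_space (disc n)"
  using compact_disc[of n] by (metis compact_space_subtopology compactin_euclidean_iff disc_top_of_set topspace_disc)

lemma compactin_disc_boundary: "compactin (disc n) (disc_boundary n)"
proof (rule closedin_compact_space[OF compact_space_disc])
  have "closed {x :: nat \<Rightarrow> real. (\<Sum>i<n. (x i)\<^sup>2) = 1}"
    by (intro closed_Collect_eq continuous_on_sum_squares continuous_on_const)
  moreover have "disc_boundary n = topspace (disc n) \<inter> {x. (\<Sum>i<n. (x i)\<^sup>2) = 1}"
    by (auto simp: topspace_disc disc_boundary_eq)
  ultimately show "closedin (disc n) (disc_boundary n)"
    unfolding disc_top_of_set by (simp add: closedin_closed_Int topspace_disc)
qed

text \<open>The disc is a retract of Euclidean space, which is known to be locally path connected.\<close>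

lemma locally_path_connected_disc: "locally_path_connected_space (disc n)"
proof (rule locally_path_connected_space_retraction_map_image)
  show "locally_path_connected_space (Euclidean_space n)" by (rule locally_path_connected_Euclidean_space)
  let ?N = "\<lambda>x::nat \<Rightarrow> real. sqrt (\<Sum>i<n. (x i)\<^sup>2)"
  let ?r = "\<lambda>x::nat \<Rightarrow> real. (\<lambda>i. x i / max 1 (?N x))"
  have N: "continuous_on A ?N" for A
    by (intro continuous_intros continuous_on_subset[OF continuous_on_sum_squares]) auto
  have r: "continuous_on A ?r" for A
    by (intro continuous_on_coordinatewise_then_product continuous_on_divide
        continuous_on_product_then_coordinatewise[OF continuous_on_id] continuous_on_max
        continuous_on_const N) auto
  have in_disc: "?r x \<in> topspace (disc n)" if "x \<in> topspace (Euclidean_space n)" for x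
  proof -
    have "(\<Sum>i<n. (?r x i)\<^sup>2) = (\<Sum>i<n. (x i)\<^sup>2) / (max 1 (?N x))\<^sup>2"
      by (simp add: power_divide sum_divide_distrib)
    also have "\<dots> = (?N x)\<^sup>2 / (max 1 (?N x))\<^sup>2" by (simp add: sum_nonneg)
    also have "\<dots> \<le> 1" by (auto simp: divide_le_eq_1 intro!: power_mono sum_nonneg)
    finally show ?thesis using that by (simp add: topspace_disc topspace_Euclidean_space)
  qed
  have "retraction_maps (Euclidean_space n) (disc n) ?r id"
    unfolding retraction_maps_def
  proof (intro conjI ballI)
    show "continuous_map (Euclidean_space n) (disc n) ?r"
      using in_disc unfolding disc_top_of_set Euclidean_space_top_of_set
      by (auto simp: topspace_Euclidean_space intro!: r)
    show "continuous_map (disc n) (Euclidean_space n) id"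
      unfolding disc_top_of_set Euclidean_space_top_of_set by auto
    show "?r (id x) = x" if "x \<in> topspace (disc n)" for x
      using that by (simp add: topspace_disc)
  qed
  then show "retraction_map (Euclidean_space n) (disc n) ?r"
    unfolding retraction_map_def by blast
qed

section \<open>The weak topology of a CW complex\<close>

locale cw =
  fixes X :: "'a topology" and \<C> :: "'a set set" and d :: "'a set \<Rightarrow> nat"
    and \<Phi> :: "'a set \<Rightarrow> (nat \<Rightarrow> real) \<Rightarrow> 'a"
  assumes cw: "CW_structure X \<C> d \<Phi>"
begin

abbreviation closed_cell :: "'a set \<Rightarrow> 'a set" where
  "closed_cell C \<equiv> \<Phi> C ` topspace (disc (d C))"

text \<open>Cells of dimension less than \<open>k\<close>; with \<open>k = \<infinity>\<close> this is the whole space, so that the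
  weak topology on \<open>X\<close> and on its skeleta become one statement.\<close>

definition skel :: "enat \<Rightarrow> 'a set" where
  "skel k = \<Union>{C\<in>\<C>. enat (d C) < k}"

lemma hausdorff: "Hausdorff_space X"
  using cw by (simp add: CW_structure_def)

lemma cells_cover: "\<Union>\<C> = topspace X"
  using cw by (simp add: CW_structure_def)

lemma cells_disjoint: "B \<in> \<C> \<Longrightarrow> C \<in> \<C> \<Longrightarrow> z \<in> B \<Longrightarrow> z \<in> C \<Longrightarrow> B = C"
  using cw unfolding CW_structure_def pairwise_def disjnt_iff by blast

lemma char_continuous: "C \<in> \<C> \<Longrightarrow> continuous_map (disc (d C)) X (\<Phi> C)"
  using cw by (simp add: CW_structure_def)

lemma char_homeomorphic:
  "C \<in> \<C> \<Longrightarrow> homeomorphic_map (open_disc (d C)) (subtopology X C) (\<Phi> C)"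
  using cw by (simp add: CW_structure_def)

lemma char_image: assumes "C \<in> \<C>" shows "\<Phi> C ` topspace (open_disc (d C)) = C"
  using homeomorphic_imp_surjective_map[OF char_homeomorphic[OF assms]] cells_cover assms by auto

lemma char_inj: "C \<in> \<C> \<Longrightarrow> inj_on (\<Phi> C) (topspace (open_disc (d C)))"
  using homeomorphic_imp_injective_map[OF char_homeomorphic] .

lemma closure_finite:
  assumes "C \<in> \<C>"
  obtains \<F> where "finite \<F>" "\<F> \<subseteq> {B\<in>\<C>. d B < d C}" "\<Phi> C ` disc_boundary (d C) \<subseteq> \<Union>\<F>"
  using cw assms unfolding CW_structure_def by meson

lemma closed_cell_eq: "C \<in> \<C> \<Longrightarrow> closed_cell C = C \<union> \<Phi> C ` disc_boundary (d C)"
  using char_image by (auto simp: topspace_disc_Un image_Un)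

lemma char_boundary: "C \<in> \<C> \<Longrightarrow> x \<in> disc_boundary (d C) \<Longrightarrow> \<Phi> C x \<in> skel (enat (d C))"
proof -
  assume C: "C \<in> \<C>" and x: "x \<in> disc_boundary (d C)"
  obtain \<F> where "\<F> \<subseteq> {B\<in>\<C>. d B < d C}" "\<Phi> C ` disc_boundary (d C) \<subseteq> \<Union>\<F>"
    using closure_finite[OF C] .
  moreover from this x obtain B where "B \<in> \<F>" "\<Phi> C x \<in> B" by blast
  ultimately show ?thesis unfolding skel_def by auto
qed

lemma char_in_cell: "C \<in> \<C> \<Longrightarrow> x \<in> topspace (open_disc (d C)) \<Longrightarrow> \<Phi> C x \<in> C"
  using char_image by blast

lemma skel_mono: "k \<le> l \<Longrightarrow> skel k \<subseteq> skel l"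
  unfolding skel_def using order.strict_trans2 by blast

lemma skel_subset: "skel k \<subseteq> topspace X"
  using cells_cover by (auto simp: skel_def)

lemma cell_disjoint_skel: "C \<in> \<C> \<Longrightarrow> k \<le> enat (d C) \<Longrightarrow> z \<in> C \<Longrightarrow> z \<notin> skel k"
  unfolding skel_def using cells_disjoint by fastforce

lemma closed_cell_subset_skel:
  assumes "C \<in> \<C>" "enat (d C) < k" shows "closed_cell C \<subseteq> skel k"
proof -
  have "C \<subseteq> skel k" using assms by (auto simp: skel_def)
  moreover have "\<Phi> C ` disc_boundary (d C) \<subseteq> skel k"
    using char_boundary[OF assms(1)] skel_mono[OF less_imp_le[OF assms(2)]] by blast
  ultimately show ?thesis using closed_cell_eq[OF assms(1)] by blast
qed

lemma closedin_char_image: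
  assumes "C \<in> \<C>" "compactin (disc (d C)) K" shows "closedin X (\<Phi> C ` K)"
  using compactin_imp_closedin[OF hausdorff image_compactin[OF assms(2) char_continuous[OF assms(1)]]] .

lemma closedin_closed_cell: "C \<in> \<C> \<Longrightarrow> closedin X (closed_cell C)"
  using closedin_char_image compact_space_disc unfolding compact_space_def by blast

text \<open>Cells of dimension at least \<open>k\<close> impose no condition on a subset of \<^term>\<open>skel k\<close>: by
  closure finiteness such a subset meets a closed cell in a finite union of sets that have already
  been seen to be closed.\<close>

lemma closedin_weak:
  assumes S: "S \<subseteq> skel k" and clo: "\<And>C. C \<in> \<C> \<Longrightarrow> enat (d C) < k \<Longrightarrow> closedin X (S \<inter> closed_cell C)"
  shows "closedin X S"
proof -
  have "closedin X (S \<inter> closed_cell C)" if "C \<in> \<C>" for C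
    using that
  proof (induction "d C" arbitrary: C rule: less_induct)
    case less
    show ?case
    proof (cases "enat (d C) < k")
      case False
      obtain \<F> where F: "finite \<F>" "\<F> \<subseteq> {B\<in>\<C>. d B < d C}" "\<Phi> C ` disc_boundary (d C) \<subseteq> \<Union>\<F>"
        using closure_finite[OF less.prems] .
      have "S \<inter> closed_cell C = closed_cell C \<inter> (\<Union>B\<in>\<F>. S \<inter> closed_cell B)"
      proof (intro equalityI subsetI)
        fix z assume z: "z \<in> S \<inter> closed_cell C"
        then have "z \<notin> C" using cell_disjoint_skel[OF less.prems, of k z] S False by (auto simp: not_less)
        then have "z \<in> \<Union>\<F>" using z closed_cell_eq[OF less.prems] F(3) by auto
        then obtain B where "B \<in> \<F>" "z \<in> B" by blast
        moreover then have "z \<in> closed_cell B" using closed_cell_eq[of B] F(2) by auto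
        ultimately show "z \<in> closed_cell C \<inter> (\<Union>B\<in>\<F>. S \<inter> closed_cell B)" using z by auto
      qed auto
      moreover have "closedin X (\<Union>B\<in>\<F>. S \<inter> closed_cell B)"
        using F less.hyps by (intro closedin_Union) auto
      ultimately show ?thesis using closedin_closed_cell[OF less.prems] by (simp add: closedin_Int)
    qed (use clo less.prems in auto)
  qed
  then show ?thesis
    using cw S skel_subset[of k] unfolding CW_structure_def by (meson order_trans)
qed

lemma closedin_weak_preimage:
  assumes S: "S \<subseteq> skel k"
    and clo: "\<And>C. C \<in> \<C> \<Longrightarrow> enat (d C) < k \<Longrightarrow> closedin (disc (d C)) {x \<in> topspace (disc (d C)). \<Phi> C x \<in> S}"
  shows "closedin X S"
proof (rule closedin_weak[OF S])
  fix C assume C: "C \<in> \<C>" "enat (d C) < k"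
  have "S \<inter> closed_cell C = \<Phi> C ` {x \<in> topspace (disc (d C)). \<Phi> C x \<in> S}" by auto
  then show "closedin X (S \<inter> closed_cell C)"
    using closedin_char_image[OF C(1) closedin_compact_space[OF compact_space_disc clo[OF C]]] by simp
qed

lemma closedin_skel: "closedin X (skel k)"
proof (rule closedin_weak[of _ k])
  fix C assume C: "C \<in> \<C>" "enat (d C) < k"
  have "skel k \<inter> closed_cell C = closed_cell C" using closed_cell_subset_skel[OF C] by blast
  then show "closedin X (skel k \<inter> closed_cell C)" using closedin_closed_cell[OF C(1)] by simp
qed simp

lemma skel_infinity: "skel \<infinity> = topspace X"
  using cells_cover by (auto simp: skel_def)

lemma skel_pair_map: "(C, x) \<in> topspace (sum_topology (\<lambda>C. disc (d C)) {C\<in>\<C>. enat (d C) < k}) \<Longrightarrow> \<Phi> C x \<in> skel k"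
  using closed_cell_subset_skel by auto

text \<open>As a quotient of a sum of discs, the complex is locally path connected, and homotopies on subsets of
  its skeleta can be defined disc by disc.\<close>

lemma quotient_map_cells:
  "quotient_map (sum_topology (\<lambda>C. disc (d C)) {C\<in>\<C>. enat (d C) < k}) (subtopology X (skel k))
     (\<lambda>(C, x). \<Phi> C x)"
  (is "quotient_map ?Q ?S ?q")
  unfolding quotient_map_closedin
proof (intro conjI allI impI)
  have topS: "topspace ?S = skel k" using skel_subset by auto
  have "z \<in> ?q ` topspace ?Q" if z: "z \<in> skel k" for z
  proof -
    obtain C where C: "C \<in> \<C>" "enat (d C) < k" "z \<in> C" using z by (auto simp: skel_def)
    then obtain x where x: "x \<in> topspace (open_disc (d C))" "z = \<Phi> C x" using char_image[OF C(1)] by blast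
    then show ?thesis using C by (auto simp: topspace_disc_Un intro!: image_eqI[of _ _ "(C, x)"])
  qed
  moreover have "?q w \<in> skel k" if "w \<in> topspace ?Q" for w
    using that skel_pair_map[of "fst w" "snd w" k] by (auto simp: case_prod_beta)
  ultimately show "?q ` topspace ?Q = topspace ?S"
    unfolding topS by (intro equalityI subsetI) auto
  fix U assume U: "U \<subseteq> topspace ?S"
  have pre: "{x. (C, x) \<in> {w \<in> topspace ?Q. ?q w \<in> U}} = {x \<in> topspace (disc (d C)). \<Phi> C x \<in> U}"
    if "C \<in> \<C>" "enat (d C) < k" for C
    using that by auto
  have sub: "{w \<in> topspace ?Q. ?q w \<in> U} \<subseteq> Sigma {C\<in>\<C>. enat (d C) < k} (topspace \<circ> (\<lambda>C. disc (d C)))"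
    by auto
  have cloS: "closedin ?S U \<longleftrightarrow> closedin X U"
    using closedin_closed_subtopology[OF closedin_skel] U by (auto simp: topS)
  show "closedin ?Q {w \<in> topspace ?Q. ?q w \<in> U} \<longleftrightarrow> closedin ?S U"
  proof
    assume L: "closedin ?Q {w \<in> topspace ?Q. ?q w \<in> U}"
    have "closedin X U"
    proof (rule closedin_weak_preimage)
      show "U \<subseteq> skel k" using U by (simp add: topS)
      fix C assume C: "C \<in> \<C>" "enat (d C) < k"
      then show "closedin (disc (d C)) {x \<in> topspace (disc (d C)). \<Phi> C x \<in> U}"
        using L pre[OF C] unfolding closedin_sum_topology by auto
    qed
    then show "closedin ?S U" using cloS by simp
  next
    assume "closedin ?S U"
    then have "closedin X U" using cloS by simp
    then have "closedin (disc (d C)) {x \<in> topspace (disc (d C)). \<Phi> C x \<in> U}" if "C \<in> \<C>" for C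
      using closedin_continuous_map_preimage[OF char_continuous[OF that]] by blast
    then show "closedin ?Q {w \<in> topspace ?Q. ?q w \<in> U}"
      unfolding closedin_sum_topology using pre sub by auto
  qed
qed

lemma locally_path_connected: "locally_path_connected_space X"
  using locally_path_connected_space_quotient_map_image[OF quotient_map_cells[of \<infinity>]]
  by (simp add: locally_path_connected_space_sum_topology locally_path_connected_disc skel_infinity)

text \<open>If a compact set met cells of unbounded dimension, points chosen in such cells would form an
  infinite set all of whose subsets are closed.\<close>

lemma compactin_subset_skel:
  assumes K: "compactin X K"
  shows "\<exists>n::nat. K \<subseteq> skel (enat n)"
proof (rule ccontr)
  assume no: "\<not> ?thesis"
  have "\<exists>z. z \<in> K \<and> z \<notin> skel (enat n)" for n using no by blast
  then obtain z where z: "\<And>n. z n \<in> K" "\<And>n. z n \<notin> skel (enat n)" by metis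
  define T where "T n = z ` {n..}" for n :: nat
  have zX: "z n \<in> topspace X" for n using z(1) compactin_subset_topspace[OF K] by blast
  have fin: "finite (T n \<inter> skel (enat m))" for n m
  proof -
    have "T n \<inter> skel (enat m) \<subseteq> z ` {..m}"
    proof
      fix w assume "w \<in> T n \<inter> skel (enat m)"
      then obtain i where i: "w = z i" "z i \<in> skel (enat m)" by (auto simp: T_def)
      have "i \<le> m"
      proof (rule ccontr)
        assume "\<not> i \<le> m"
        then show False using skel_mono[of "enat m" "enat i"] i(2) z(2)[of i] by auto
      qed
      then show "w \<in> z ` {..m}" using i(1) by blast
    qed
    then show ?thesis using finite_subset by blast
  qed
  have "closedin X (T n)" for n
  proof (rule closedin_weak[of _ \<infinity>])
    show "T n \<subseteq> skel \<infinity>" using zX by (auto simp: T_def skel_infinity)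
    fix C assume C: "C \<in> \<C>"
    have "T n \<inter> closed_cell C \<subseteq> T n \<inter> skel (enat (Suc (d C)))"
      using closed_cell_subset_skel[OF C, of "enat (Suc (d C))"] by auto
    then have "finite (T n \<inter> closed_cell C)" using fin finite_subset by blast
    moreover have "T n \<inter> closed_cell C \<subseteq> topspace X" using zX by (auto simp: T_def)
    ultimately show "closedin X (T n \<inter> closed_cell C)"
      using hausdorff closedin_Hausdorff_finite by blast
  qed
  then have op: "openin X (topspace X - T n)" for n by blast
  have "K \<subseteq> (\<Union>n. topspace X - T n)"
  proof
    fix w assume w: "w \<in> K"
    then have wX: "w \<in> topspace X" using compactin_subset_topspace[OF K] by blast
    then obtain C where C: "C \<in> \<C>" "w \<in> C" using cells_cover by blast
    have "w \<notin> T (Suc (d C))"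
    proof
      assume "w \<in> T (Suc (d C))"
      then obtain i where i: "i \<ge> Suc (d C)" "w = z i" by (auto simp: T_def)
      then have "w \<in> skel (enat i)" using C by (auto simp: skel_def)
      then show False using z(2) i by simp
    qed
    then show "w \<in> (\<Union>n. topspace X - T n)" using wX by blast
  qed
  then obtain \<F> where F: "finite \<F>" "\<F> \<subseteq> range (\<lambda>n. topspace X - T n)" "K \<subseteq> \<Union>\<F>"
    using compactinD[OF K, of "range (\<lambda>n. topspace X - T n)"] op by blast
  then obtain I where I: "finite I" "\<F> = (\<lambda>n. topspace X - T n) ` I"
    using finite_subset_image[OF F(1,2)] by (elim exE conjE)
  obtain N where N: "\<And>i. i \<in> I \<Longrightarrow> i \<le> N" using I(1) unfolding finite_nat_set_iff_bounded_le by blast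
  have "z N \<in> T i" if "i \<in> I" for i using N[OF that] by (auto simp: T_def)
  then show False using F(3) z(1)[of N] I(2) by auto
qed

end

lemma continuous_map_prod_sum_topology:
  assumes f: "\<And>i. i \<in> I \<Longrightarrow> continuous_map (prod_topology T (D i)) Y (\<lambda>(t, x). f (t, (i, x)))"
  shows "continuous_map (prod_topology T (sum_topology D I)) Y f"
  unfolding continuous_map_def
proof (intro conjI allI impI)
  let ?P = "prod_topology T (sum_topology D I)"
  show "f \<in> topspace ?P \<rightarrow> topspace Y"
  proof
    fix w assume "w \<in> topspace ?P"
    then obtain t i x where w: "w = (t, (i, x))" "t \<in> topspace T" "i \<in> I" "x \<in> topspace (D i)" by auto
    then show "f w \<in> topspace Y" using continuous_map_in_topspace[OF f, of i "(t, x)"] by simp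
  qed
  fix W assume W: "openin Y W"
  have "\<exists>B. openin ?P B \<and> w \<in> B \<and> B \<subseteq> {w \<in> topspace ?P. f w \<in> W}"
    if w0: "w \<in> {w \<in> topspace ?P. f w \<in> W}" for w
  proof -
    obtain t i x where w: "w = (t, (i, x))" "t \<in> topspace T" "i \<in> I" "x \<in> topspace (D i)" "f (t, (i, x)) \<in> W"
      using w0 by auto
    have "openin (prod_topology T (D i)) {u \<in> topspace (prod_topology T (D i)). (\<lambda>(t, x). f (t, (i, x))) u \<in> W}"
      using f[OF w(3)] W by (rule openin_continuous_map_preimage)
    moreover have "(t, x) \<in> {u \<in> topspace (prod_topology T (D i)). (\<lambda>(t, x). f (t, (i, x))) u \<in> W}"
      using w by simp
    ultimately obtain A N where A: "openin T A" "t \<in> A" and N: "openin (D i) N" "x \<in> N"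
      and AN: "A \<times> N \<subseteq> {u \<in> topspace (prod_topology T (D i)). (\<lambda>(t, x). f (t, (i, x))) u \<in> W}"
      unfolding openin_prod_topology_alt by meson
    have "openin (sum_topology D I) (Pair i ` N)"
      using open_map_component_injection[OF w(3), of D] N(1) unfolding open_map_def by blast
    then have "openin ?P (A \<times> Pair i ` N)" using A(1) by (simp add: openin_prod_Times_iff)
    moreover have "w \<in> A \<times> Pair i ` N" using A(2) N(2) w(1) by auto
    moreover have "A \<times> Pair i ` N \<subseteq> {w \<in> topspace ?P. f w \<in> W}" using AN w(3) by auto
    ultimately show ?thesis by (intro exI[of _ "A \<times> Pair i ` N"]) simp
  qed
  then show "openin ?P {w \<in> topspace ?P. f w \<in> W}"
    by (intro openin_subopen[THEN iffD2] ballI)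
qed

text \<open>Radial projection of the punctured disc to its bounding sphere, and the straight line homotopy
  to it.\<close>

definition radius :: "nat \<Rightarrow> (nat \<Rightarrow> real) \<Rightarrow> real" where
  "radius n x = sqrt (\<Sum>i<n. (x i)\<^sup>2)"

definition push :: "nat \<Rightarrow> real \<Rightarrow> (nat \<Rightarrow> real) \<Rightarrow> nat \<Rightarrow> real" where
  "push n t x = (\<lambda>i. (1 - t + t / radius n x) * x i)"

lemma radius_nonneg: "0 \<le> radius n x"
  by (simp add: radius_def sum_nonneg)

lemma radius_mult: "radius n (\<lambda>i. a * x i) = \<bar>a\<bar> * radius n x"
  by (simp add: radius_def power_mult_distrib real_sqrt_mult flip: sum_distrib_left)

lemma continuous_on_radius: "continuous_on A (radius n)"
  unfolding radius_def
  by (intro continuous_intros continuous_on_subset[OF continuous_on_sum_squares]) auto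

lemma in_disc_iff: "x \<in> topspace (disc n) \<longleftrightarrow> (\<forall>i\<ge>n. x i = 0) \<and> radius n x \<le> 1"
  using radius_nonneg[of n x] by (auto simp: topspace_disc radius_def)

lemma in_open_disc_iff: "x \<in> topspace (open_disc n) \<longleftrightarrow> (\<forall>i\<ge>n. x i = 0) \<and> radius n x < 1"
  by (auto simp: topspace_open_disc radius_def)

lemma in_disc_boundary_iff: "x \<in> disc_boundary n \<longleftrightarrow> (\<forall>i\<ge>n. x i = 0) \<and> radius n x = 1"
  by (auto simp: disc_boundary_eq radius_def)

lemma push_0: "push n 0 x = x"
  by (simp add: push_def)

lemma push_boundary: "radius n x = 1 \<Longrightarrow> push n t x = x"
  by (simp add: push_def)

lemma radius_push:
  assumes "0 < radius n x" "0 \<le> t" "t \<le> 1"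
  shows "radius n (push n t x) = (1 - t) * radius n x + t"
proof -
  have "0 \<le> 1 - t + t / radius n x" using assms by simp
  then show ?thesis using assms unfolding push_def radius_mult by (simp add: algebra_simps)
qed

lemma push_in_disc:
  assumes "x \<in> topspace (disc n)" "0 < radius n x" "0 \<le> t" "t \<le> 1"
  shows "push n t x \<in> topspace (disc n)"
  unfolding in_disc_iff
proof
  show "\<forall>i\<ge>n. push n t x i = 0" using assms(1) by (simp add: in_disc_iff push_def)
  have "(1 - t) * radius n x \<le> (1 - t) * 1"
    using assms by (intro mult_left_mono) (auto simp: in_disc_iff)
  then show "radius n (push n t x) \<le> 1" using radius_push[OF assms(2-)] by simp
qed

lemma push_1_boundary:
  assumes "x \<in> topspace (disc n)" "0 < radius n x" shows "push n 1 x \<in> disc_boundary n"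
  using assms push_in_disc[OF assms, of 1] radius_push[OF assms(2), of 1]
  by (auto simp: in_disc_boundary_iff in_disc_iff)

lemma continuous_on_push:
  assumes "\<And>w. w \<in> A \<Longrightarrow> 0 < radius n (snd w)"
  shows "continuous_on A (\<lambda>(t, x). push n t x)"
proof -
  have "continuous_on A (\<lambda>w. radius n (snd w))"
    by (rule continuous_on_compose2[OF continuous_on_radius[of UNIV] continuous_on_snd[OF continuous_on_id]]) simp
  moreover have "continuous_on A (\<lambda>w. snd w i)" for i
    by (rule continuous_on_compose2[of UNIV "\<lambda>x. x i" A snd])
      (simp_all add: continuous_on_snd[OF continuous_on_id])
  ultimately show ?thesis
    unfolding push_def split_def
    by (intro continuous_on_coordinatewise_then_product continuous_on_mult continuous_on_add
        continuous_on_diff continuous_on_divide continuous_on_const continuous_on_fst continuous_on_id)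
      (use assms in \<open>force\<close>)+
qed

section \<open>CW complexes are semilocally simply connected\<close>

context cw
begin

text \<open>An open cell \<open>C\<^sub>0\<close> of dimension \<open>m\<close> is thickened through the higher skeleta: to the part of the
  neighbourhood in the \<open>m + j\<close>-skeleton, step \<open>j\<close> adds the points of the open \<open>m + j + 1\<close>-cells that
  radial projection sends into that part.\<close>

primrec thick :: "'a set \<Rightarrow> nat \<Rightarrow> 'a set" where
  "thick C\<^sub>0 0 = C\<^sub>0"
| "thick C\<^sub>0 (Suc j) = thick C\<^sub>0 j \<union> (\<Union>C\<in>{C\<in>\<C>. d C = Suc (d C\<^sub>0 + j)}.
      \<Phi> C ` {x \<in> topspace (open_disc (d C)). 0 < radius (d C) x \<and> \<Phi> C (push (d C) 1 x) \<in> thick C\<^sub>0 j})"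

lemma thick_subset_skel:
  assumes "C\<^sub>0 \<in> \<C>" shows "thick C\<^sub>0 j \<subseteq> skel (enat (Suc (d C\<^sub>0 + j)))"
proof (induction j)
  case 0 show ?case using assms by (auto simp: skel_def)
next
  case (Suc j)
  have "skel (enat (Suc (d C\<^sub>0 + j))) \<subseteq> skel (enat (Suc (d C\<^sub>0 + Suc j)))" by (rule skel_mono) simp
  moreover have "\<Phi> C x \<in> skel (enat (Suc (d C\<^sub>0 + Suc j)))"
    if "C \<in> \<C>" "d C = Suc (d C\<^sub>0 + j)" "x \<in> topspace (open_disc (d C))" for C x
    using char_in_cell[OF that(1,3)] that(1,2) by (auto simp: skel_def)
  ultimately show ?case using Suc.IH by fastforce
qed

lemma thick_mono: "i \<le> j \<Longrightarrow> thick C\<^sub>0 i \<subseteq> thick C\<^sub>0 j"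
  by (rule lift_Suc_mono_le[of "thick C\<^sub>0"]) auto

lemma thick_Suc_Int_skel:
  assumes C0: "C\<^sub>0 \<in> \<C>" and z: "z \<in> thick C\<^sub>0 (Suc j)" "z \<in> skel (enat (Suc (d C\<^sub>0 + j)))"
  shows "z \<in> thick C\<^sub>0 j"
proof (rule ccontr)
  assume "z \<notin> thick C\<^sub>0 j"
  then obtain C x where "C \<in> \<C>" "d C = Suc (d C\<^sub>0 + j)" "x \<in> topspace (open_disc (d C))" "z = \<Phi> C x"
    using z(1) by auto
  then show False
    using cell_disjoint_skel[of C "enat (Suc (d C\<^sub>0 + j))" z] char_in_cell[of C x] z(2) by simp
qed

lemma thick_Int_skel:
  assumes C0: "C\<^sub>0 \<in> \<C>" and z: "z \<in> thick C\<^sub>0 j" "z \<in> skel (enat (Suc (d C\<^sub>0 + i)))"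
  shows "z \<in> thick C\<^sub>0 i"
proof (cases "j \<le> i")
  case True then show ?thesis using thick_mono z(1) by blast
next
  case False
  then have "i \<le> j" by simp
  then show ?thesis
    using z(1)
  proof (induction j rule: dec_induct)
    case (step l)
    have "z \<in> skel (enat (Suc (d C\<^sub>0 + l)))"
      using z(2) skel_mono[of "enat (Suc (d C\<^sub>0 + i))" "enat (Suc (d C\<^sub>0 + l))"] step.hyps by auto
    then show ?case using thick_Suc_Int_skel[OF C0 step.prems] step.IH by blast
  qed
qed

lemma char_in_thick_Suc_iff:
  assumes C0: "C\<^sub>0 \<in> \<C>" and C: "C \<in> \<C>" "d C = Suc (d C\<^sub>0 + j)" and x: "x \<in> topspace (disc (d C))"
  shows "\<Phi> C x \<in> thick C\<^sub>0 (Suc j) \<longleftrightarrow> 0 < radius (d C) x \<and> \<Phi> C (push (d C) 1 x) \<in> thick C\<^sub>0 j"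
proof (cases "x \<in> disc_boundary (d C)")
  case True
  then have "\<Phi> C x \<in> skel (enat (Suc (d C\<^sub>0 + j)))" using char_boundary[OF C(1)] C(2) by simp
  then show ?thesis
    using thick_Suc_Int_skel[OF C0] True by (auto simp: in_disc_boundary_iff push_boundary)
next
  case False
  then have x': "x \<in> topspace (open_disc (d C))" using x topspace_disc_Un by blast
  have zC: "\<Phi> C x \<in> C" by (rule char_in_cell[OF C(1) x'])
  have notj: "\<Phi> C x \<notin> thick C\<^sub>0 j"
    using cell_disjoint_skel[OF C(1), of "enat (Suc (d C\<^sub>0 + j))"] zC C(2) thick_subset_skel[OF C0, of j] by auto
  show ?thesis
  proof
    assume "\<Phi> C x \<in> thick C\<^sub>0 (Suc j)"
    then obtain B w where B: "B \<in> \<C>" "w \<in> topspace (open_disc (d B))" "\<Phi> C x = \<Phi> B w"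
      "0 < radius (d B) w" "\<Phi> B (push (d B) 1 w) \<in> thick C\<^sub>0 j"
      using notj by auto
    have "B = C" using cells_disjoint[OF B(1) C(1)] char_in_cell[OF B(1,2)] zC B(3) by simp
    moreover have "w = x" using char_inj[OF C(1)] B(2,3) x' \<open>B = C\<close> by (auto simp: inj_on_def)
    ultimately show "0 < radius (d C) x \<and> \<Phi> C (push (d C) 1 x) \<in> thick C\<^sub>0 j" using B by simp
  next
    assume "0 < radius (d C) x \<and> \<Phi> C (push (d C) 1 x) \<in> thick C\<^sub>0 j"
    then show "\<Phi> C x \<in> thick C\<^sub>0 (Suc j)" using C x' by auto
  qed
qed

declare thick.simps(2) [simp del]

lemma closed_cell_disjoint_cell:
  assumes "C\<^sub>0 \<in> \<C>" "C \<in> \<C>" "d C \<le> d C\<^sub>0" "C \<noteq> C\<^sub>0"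
  shows "closed_cell C \<inter> C\<^sub>0 = {}"
proof -
  have "\<Phi> C ` disc_boundary (d C) \<inter> C\<^sub>0 = {}"
    using char_boundary[OF assms(2)] cell_disjoint_skel[OF assms(1), of "enat (d C)"] assms(3) by auto
  then show ?thesis
    using closed_cell_eq[OF assms(2)] cells_disjoint[OF assms(1,2)] assms(4) by blast
qed

text \<open>Openness of the thickening is shown by induction over the skeleta in terms of closed sets, for
  which the weak topology is stated. In a disc of the new dimension, the points outside the
  thickening are the centre and those projected radially outside the previous stage.\<close>

lemma closedin_skel_diff_thick:
  assumes C0: "C\<^sub>0 \<in> \<C>"
  shows "closedin X (skel (enat (Suc (d C\<^sub>0 + j))) - thick C\<^sub>0 j)"
proof (induction j)
  case 0
  show ?case
  proof (rule closedin_weak[of _ "enat (Suc (d C\<^sub>0 + 0))"])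
    fix C assume C: "C \<in> \<C>" "enat (d C) < enat (Suc (d C\<^sub>0 + 0))"
    have sub: "closed_cell C \<subseteq> skel (enat (Suc (d C\<^sub>0 + 0)))" by (rule closed_cell_subset_skel[OF C])
    show "closedin X ((skel (enat (Suc (d C\<^sub>0 + 0))) - thick C\<^sub>0 0) \<inter> closed_cell C)"
    proof (cases "C = C\<^sub>0")
      case True
      have "\<Phi> C ` disc_boundary (d C) \<inter> C\<^sub>0 = {}"
        using char_boundary[OF C(1)] cell_disjoint_skel[OF C0, of "enat (d C)"] True by auto
      then have "(skel (enat (Suc (d C\<^sub>0 + 0))) - thick C\<^sub>0 0) \<inter> closed_cell C = \<Phi> C ` disc_boundary (d C)"
        using sub True closed_cell_eq[OF C(1)] by auto
      then show ?thesis using closedin_char_image[OF C(1) compactin_disc_boundary] by simp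
    next
      case False
      then have "(skel (enat (Suc (d C\<^sub>0 + 0))) - thick C\<^sub>0 0) \<inter> closed_cell C = closed_cell C"
        using sub closed_cell_disjoint_cell[OF C0 C(1)] C(2) by auto
      then show ?thesis using closedin_closed_cell[OF C(1)] by simp
    qed
  qed auto
next
  case (Suc j)
  let ?k = "enat (Suc (d C\<^sub>0 + j))" and ?k' = "enat (Suc (d C\<^sub>0 + Suc j))"
  show ?case
  proof (rule closedin_weak_preimage[of _ ?k'])
    fix C assume C: "C \<in> \<C>" "enat (d C) < ?k'"
    have in_skel: "\<Phi> C x \<in> skel ?k'" if "x \<in> topspace (disc (d C))" for x
      using closed_cell_subset_skel[OF C] that by blast
    show "closedin (disc (d C)) {x \<in> topspace (disc (d C)). \<Phi> C x \<in> skel ?k' - thick C\<^sub>0 (Suc j)}"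
    proof (cases "d C = Suc (d C\<^sub>0 + j)")
      case False
      then have lt: "enat (d C) < ?k" using C(2) by simp
      have "\<Phi> C x \<in> skel ?k" if "x \<in> topspace (disc (d C))" for x
        using closed_cell_subset_skel[OF C(1) lt] that by blast
      then have "{x \<in> topspace (disc (d C)). \<Phi> C x \<in> skel ?k' - thick C\<^sub>0 (Suc j)} =
          {x \<in> topspace (disc (d C)). \<Phi> C x \<in> skel ?k - thick C\<^sub>0 j}"
        using in_skel thick_Suc_Int_skel[OF C0] thick_mono[of j "Suc j" C\<^sub>0] by auto
      then show ?thesis
        using closedin_continuous_map_preimage[OF char_continuous[OF C(1)] Suc.IH] by simp
    next
      case True
      let ?D = "topspace (disc (d C))"
      let ?A = "{x \<in> ?D. 0 < radius (d C) x}"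
      have opA: "openin (disc (d C)) ?A"
      proof -
        have "open {x. 0 < radius (d C) x}"
          by (intro open_Collect_less continuous_on_radius continuous_on_const)
        moreover have "?A = ?D \<inter> {x. 0 < radius (d C) x}" by auto
        ultimately show ?thesis unfolding disc_top_of_set by (simp add: openin_open_Int)
      qed
      have push: "continuous_map (subtopology (disc (d C)) ?A) (disc (d C)) (push (d C) 1)"
      proof -
        have "continuous_on ({1} \<times> ?A) (\<lambda>(t, x). push (d C) t x)" by (rule continuous_on_push) auto
        then have "continuous_on ?A (\<lambda>x. (\<lambda>(t, x). push (d C) t x) (1, x))"
          by (rule continuous_on_compose2) (auto intro!: continuous_intros)
        then have cont: "continuous_on ?A (push (d C) 1)" by simp
        have sub: "subtopology (disc (d C)) ?A = top_of_set ?A"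
          unfolding disc_top_of_set subtopology_subtopology by (rule arg_cong[where f = top_of_set]) auto
        have D: "top_of_set ?D = disc (d C)" by (simp add: disc_top_of_set)
        have "continuous_map (top_of_set ?A) (top_of_set ?D) (push (d C) 1)"
          using cont push_in_disc[of _ "d C" 1] by auto
        then show ?thesis by (simp only: D sub)
      qed
      have "closedin X (skel ?k - thick C\<^sub>0 j)" by (rule Suc.IH)
      from closedin_continuous_map_preimage[OF continuous_map_compose[OF push char_continuous[OF C(1)]] this]
      have "closedin (subtopology (disc (d C)) ?A) {x \<in> ?A. \<Phi> C (push (d C) 1 x) \<in> skel ?k - thick C\<^sub>0 j}"
        by (simp add: Int_def conj_ac cong: conj_cong)
      moreover have "\<Phi> C (push (d C) 1 x) \<in> skel ?k" if "x \<in> ?A" for x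
        using char_boundary[OF C(1) push_1_boundary] that True by auto
      ultimately have "closedin (subtopology (disc (d C)) ?A) {x \<in> ?A. \<Phi> C (push (d C) 1 x) \<notin> thick C\<^sub>0 j}"
        by (auto cong: conj_cong)
      then have "openin (subtopology (disc (d C)) ?A) (?A - {x \<in> ?A. \<Phi> C (push (d C) 1 x) \<notin> thick C\<^sub>0 j})"
        unfolding closedin_def by (auto simp: Int_absorb1)
      then have "openin (disc (d C)) (?A - {x \<in> ?A. \<Phi> C (push (d C) 1 x) \<notin> thick C\<^sub>0 j})"
        using openin_trans_full opA by blast
      then have "closedin (disc (d C)) (?D - (?A - {x \<in> ?A. \<Phi> C (push (d C) 1 x) \<notin> thick C\<^sub>0 j}))" by blast
      moreover have "{x \<in> ?D. \<Phi> C x \<in> skel ?k' - thick C\<^sub>0 (Suc j)} =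
          ?D - (?A - {x \<in> ?A. \<Phi> C (push (d C) 1 x) \<notin> thick C\<^sub>0 j})"
        using char_in_thick_Suc_iff[OF C0 C(1) True] in_skel by blast
      ultimately show ?thesis by simp
    qed
  qed auto
qed

lemma openin_thick:
  assumes C0: "C\<^sub>0 \<in> \<C>" shows "openin (subtopology X (skel (enat (Suc (d C\<^sub>0 + j))))) (thick C\<^sub>0 j)"
proof -
  let ?S = "skel (enat (Suc (d C\<^sub>0 + j)))"
  have "thick C\<^sub>0 j = (topspace X - (?S - thick C\<^sub>0 j)) \<inter> ?S"
    using thick_subset_skel[OF C0, of j] skel_subset by blast
  then show ?thesis
    using closedin_skel_diff_thick[OF C0, of j] unfolding openin_subtopology by blast
qed

text \<open>On a closed cell the union is reached at a finite stage, because later stages add only cells of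
  higher dimension.\<close>

lemma openin_Union_thick:
  assumes C0: "C\<^sub>0 \<in> \<C>" shows "openin X (\<Union>j. thick C\<^sub>0 j)"
proof -
  let ?U = "\<Union>j. thick C\<^sub>0 j"
  have sub: "?U \<subseteq> topspace X" using thick_subset_skel[OF C0] skel_subset by blast
  have "closedin X (topspace X - ?U)"
  proof (rule closedin_weak[of _ \<infinity>])
    show "topspace X - ?U \<subseteq> skel \<infinity>" by (simp add: skel_infinity)
    fix C assume C: "C \<in> \<C>"
    let ?S = "skel (enat (Suc (d C\<^sub>0 + d C)))"
    have "closed_cell C \<subseteq> ?S" using closed_cell_subset_skel[OF C] by simp
    then have "(topspace X - ?U) \<inter> closed_cell C = (?S - thick C\<^sub>0 (d C)) \<inter> closed_cell C"
      using thick_Int_skel[OF C0, of _ _ "d C"] skel_subset by blast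
    then show "closedin X ((topspace X - ?U) \<inter> closed_cell C)"
      using closedin_Int[OF closedin_skel_diff_thick[OF C0] closedin_closed_cell[OF C]] by simp
  qed
  then show ?thesis using sub openin_closedin_eq by blast
qed

text \<open>The radial homotopies of the individual discs fit together to a homotopy on the product of an
  interval with the thickened set: an interval is locally compact, so the product of the quotient map
  from the discs with the interval is again a quotient map.\<close>

lemma thick_Suc_deformation:
  assumes C0: "C\<^sub>0 \<in> \<C>"
  obtains H where
    "continuous_map (prod_topology (top_of_set {0..1::real}) (subtopology X (thick C\<^sub>0 (Suc j)))) X H"
    "\<And>z. z \<in> thick C\<^sub>0 (Suc j) \<Longrightarrow> H (0, z) = z"
    "\<And>z. z \<in> thick C\<^sub>0 (Suc j) \<Longrightarrow> H (1, z) \<in> thick C\<^sub>0 j"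
proof -
  let ?A = "thick C\<^sub>0 (Suc j)" and ?k = "enat (Suc (d C\<^sub>0 + Suc j))" and ?I = "top_of_set {0..1::real}"
  define K where "K = {C\<in>\<C>. enat (d C) < ?k}"
  define N where "N C = {x \<in> topspace (disc (d C)). \<Phi> C x \<in> ?A}" for C
  let ?q = "\<lambda>(C, x). \<Phi> C x"
  let ?Q = "sum_topology (\<lambda>C. subtopology (disc (d C)) (N C)) K"
  define f where "f = (\<lambda>(t, (C, x)). if d C = Suc (d C\<^sub>0 + j) then \<Phi> C (push (d C) t x) else \<Phi> C x)"
  have Apre: "{w \<in> topspace (sum_topology (\<lambda>C. disc (d C)) K). ?q w \<in> ?A} = Sigma K N"
    by (auto simp: N_def)
  have sk: "?A \<subseteq> skel ?k" by (rule thick_subset_skel[OF C0])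
  then have "subtopology (subtopology X (skel ?k)) ?A = subtopology X ?A"
    by (simp add: subtopology_subtopology Int_absorb1)
  moreover have "quotient_map (subtopology (sum_topology (\<lambda>C. disc (d C)) K) (Sigma K N))
      (subtopology (subtopology X (skel ?k)) ?A) ?q"
    using quotient_map_restriction[OF quotient_map_cells[of ?k, folded K_def] Apre] openin_thick[OF C0] by blast
  ultimately have q: "quotient_map ?Q (subtopology X ?A) ?q"
    by (simp add: subtopology_sum_topology)
  have lc: "locally_compact_space ?I"
    by (simp add: compact_imp_locally_compact_space compact_space_subtopology)
  have qI: "quotient_map (prod_topology ?I ?Q) (prod_topology ?I (subtopology X ?A)) (\<lambda>(t, w). (t, ?q w))"
    by (rule quotient_map_prod_right[OF lc _ q]) (simp add: Hausdorff_space_subtopology)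
  have top: "C \<in> K \<and> x \<in> N C \<and> x \<in> topspace (disc (d C)) \<and> t \<in> {0..1}"
    if "(t, (C, x)) \<in> topspace (prod_topology ?I ?Q)" for t C x
    using that by auto
  have pos: "0 < radius (d C) x" "\<Phi> C (push (d C) 1 x) \<in> thick C\<^sub>0 j"
    if "C \<in> K" "x \<in> N C" "d C = Suc (d C\<^sub>0 + j)" for C x
    using char_in_thick_Suc_iff[OF C0 _ that(3), of x] that by (auto simp: K_def N_def)
  have f_cont: "continuous_map (prod_topology ?I ?Q) X f"
  proof (rule continuous_map_prod_sum_topology)
    fix C assume CK: "C \<in> K"
    then have C: "C \<in> \<C>" by (simp add: K_def)
    let ?DN = "subtopology (disc (d C)) (N C)"
    show "continuous_map (prod_topology ?I ?DN) X (\<lambda>(t, x). f (t, (C, x)))"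
    proof (cases "d C = Suc (d C\<^sub>0 + j)")
      case True
      have D: "disc (d C) = top_of_set (topspace (disc (d C)))" by (simp add: disc_top_of_set)
      have ND: "N C \<subseteq> topspace (disc (d C))" by (auto simp: N_def)
      have DN: "?DN = top_of_set (N C)"
        using ND by (subst D) (simp add: subtopology_subtopology Int_absorb1)
      have "continuous_on ({0..1} \<times> N C) (\<lambda>(t, x). push (d C) t x)"
        by (rule continuous_on_push) (use pos[OF CK _ True] in auto)
      then have "continuous_map (top_of_set ({0..1} \<times> N C)) (top_of_set (topspace (disc (d C)))) (\<lambda>(t, x). push (d C) t x)"
        using push_in_disc pos[OF CK _ True] ND by auto
      then have "continuous_map (prod_topology ?I ?DN) (disc (d C)) (\<lambda>(t, x). push (d C) t x)"
        unfolding DN prod_topology_top_of_set by (subst D)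
      from continuous_map_compose[OF this char_continuous[OF C]] True show ?thesis
        by (simp add: f_def o_def split_def)
    next
      case False
      have "continuous_map (prod_topology ?I ?DN) X (\<Phi> C \<circ> snd)"
        using continuous_map_compose[OF continuous_map_snd
            continuous_map_from_subtopology[OF char_continuous[OF C]]] .
      with False show ?thesis by (simp add: f_def o_def split_def)
    qed
  qed
  have f_alt: "f (t, (C, x)) = (if d C = Suc (d C\<^sub>0 + j) \<and> x \<in> topspace (open_disc (d C))
      then \<Phi> C (push (d C) t x) else \<Phi> C x)" if "x \<in> topspace (disc (d C))" for t C x
    using that topspace_disc_Un[of "d C"] by (auto simp: f_def in_disc_boundary_iff push_boundary)
  have low: "\<Phi> C x \<in> skel (enat (Suc (d C\<^sub>0 + j)))"
    if "C \<in> K" "x \<in> topspace (disc (d C))" "\<not> (d C = Suc (d C\<^sub>0 + j) \<and> x \<in> topspace (open_disc (d C)))" for C x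
  proof (cases "d C = Suc (d C\<^sub>0 + j)")
    case True
    then have "x \<in> disc_boundary (d C)" using that topspace_disc_Un by blast
    then show ?thesis using char_boundary[of C x] that(1) True by (simp add: K_def)
  next
    case False
    then have "enat (d C) < enat (Suc (d C\<^sub>0 + j))" using that(1) by (simp add: K_def)
    moreover have "C \<in> \<C>" using that(1) by (simp add: K_def)
    ultimately show ?thesis using closed_cell_subset_skel that(2) by blast
  qed
  have high: "\<Phi> C x \<notin> skel (enat (Suc (d C\<^sub>0 + j)))"
    if "C \<in> K" "d C = Suc (d C\<^sub>0 + j)" "x \<in> topspace (open_disc (d C))" for C x
    using cell_disjoint_skel[of C "enat (Suc (d C\<^sub>0 + j))" "\<Phi> C x"] char_in_cell[of C x] that by (simp add: K_def)
  have f_resp: "f u = f v" if u: "u \<in> topspace (prod_topology ?I ?Q)" and v: "v \<in> topspace (prod_topology ?I ?Q)"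
    and eq: "(\<lambda>(t, w). (t, ?q w)) u = (\<lambda>(t, w). (t, ?q w)) v" for u v
  proof -
    obtain t C x where u': "u = (t, (C, x))" by (metis prod_cases3)
    obtain s B w where v': "v = (s, (B, w))" by (metis prod_cases3)
    have C: "C \<in> K" "x \<in> topspace (disc (d C))" and B: "B \<in> K" "w \<in> topspace (disc (d B))"
      using top u v u' v' by blast+
    have e: "s = t" "\<Phi> C x = \<Phi> B w" using eq u' v' by auto
    let ?hi = "\<lambda>C x. d C = Suc (d C\<^sub>0 + j) \<and> x \<in> topspace (open_disc (d C))"
    have "?hi C x \<longleftrightarrow> ?hi B w" using low[OF C] low[OF B] high[OF C(1)] high[OF B(1)] e(2) by metis
    moreover have "C = B \<and> x = w" if "?hi C x" "?hi B w"
    proof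
      have CB: "C \<in> \<C>" "B \<in> \<C>" using C(1) B(1) by (auto simp: K_def)
      have "\<Phi> C x \<in> C" "\<Phi> B w \<in> B" using char_in_cell[OF CB(1)] char_in_cell[OF CB(2)] that by blast+
      then show "C = B" using cells_disjoint[OF CB, of "\<Phi> C x"] e(2) by simp
      then show "x = w"
        using char_inj[of C] C(1) that e(2) by (auto simp: K_def inj_on_def)
    qed
    ultimately show ?thesis
      unfolding u' v' f_alt[OF C(2)] f_alt[OF B(2)] using e by auto
  qed
  have "\<exists>H. continuous_map (prod_topology ?I (subtopology X ?A)) X H \<and>
    (\<forall>u\<in>topspace (prod_topology ?I ?Q). H ((\<lambda>(t, w). (t, ?q w)) u) = f u)"
  proof (rule quotient_map_lift_exists[OF qI f_cont f_resp])
    fix H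
    assume "continuous_map (prod_topology ?I (subtopology X ?A)) X H"
      "\<And>u. u \<in> topspace (prod_topology ?I ?Q) \<Longrightarrow> H ((\<lambda>(t, w). (t, ?q w)) u) = f u"
    then show ?thesis by (intro exI[of _ H]) blast
  qed
  then obtain H where H: "continuous_map (prod_topology ?I (subtopology X ?A)) X H"
    "\<forall>u\<in>topspace (prod_topology ?I ?Q). H ((\<lambda>(t, w). (t, ?q w)) u) = f u"
    by (elim exE conjE)
  have Hf: "\<exists>C x. C \<in> K \<and> x \<in> N C \<and> x \<in> topspace (disc (d C)) \<and> z = \<Phi> C x \<and> (\<forall>t\<in>{0..1}. H (t, z) = f (t, (C, x)))"
    if z: "z \<in> ?A" for z
  proof -
    have "topspace (subtopology X ?A) = ?A" using sk skel_subset[of ?k] by auto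
    then have "z \<in> ?q ` topspace ?Q" using z quotient_imp_surjective_map[OF q] by simp
    then obtain w where w: "w \<in> topspace ?Q" "z = ?q w" by (elim imageE)
    obtain C x where Cx: "w = (C, x)" by (metis surj_pair)
    have "H (t, z) = f (t, (C, x))" if "t \<in> {0..1}" for t
      using bspec[OF H(2), of "(t, w)"] w that Cx by simp
    moreover have "C \<in> K \<and> x \<in> N C \<and> x \<in> topspace (disc (d C))" using w(1) Cx by auto
    ultimately show ?thesis using w(2) Cx by auto
  qed
  show thesis
  proof (rule that[OF H(1)])
    fix z assume z: "z \<in> ?A"
    obtain C x where Cx: "C \<in> K" "x \<in> N C" "x \<in> topspace (disc (d C))" "z = \<Phi> C x"
      and Ht: "\<And>t. t \<in> {0..1} \<Longrightarrow> H (t, z) = f (t, (C, x))" using Hf[OF z] by blast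
    show "H (0, z) = z" using Ht[of 0] Cx(4) by (simp add: f_def push_0)
    show "H (1, z) \<in> thick C\<^sub>0 j"
    proof (cases "d C = Suc (d C\<^sub>0 + j)")
      case True
      then show ?thesis using Ht[of 1] pos(2)[OF Cx(1,2) True] by (simp add: f_def)
    next
      case False
      then have "z \<in> skel (enat (Suc (d C\<^sub>0 + j)))" using low[OF Cx(1,3)] Cx(4) by blast
      then show ?thesis using thick_Suc_Int_skel[OF C0 z] Ht[of 1] Cx(4) False by (simp add: f_def)
    qed
  qed
qed

text \<open>The deformations push the loop down into the open cell, which is contractible.\<close>

lemma loop_in_thick_null_homotopic:
  assumes C0: "C\<^sub>0 \<in> \<C>" and c: "pathin (subtopology X (thick C\<^sub>0 j)) c" "c 0 = c 1"
  shows "\<exists>a. homotopic_with (\<lambda>r. r 0 = r 1) (top_of_set {0..1}) X c (\<lambda>_. a)"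
  using c
proof (induction j arbitrary: c)
  case 0
  have c: "continuous_map (top_of_set {0..1}) (subtopology X C\<^sub>0) c"
    using 0 by (simp add: pathin_def)
  obtain \<sigma> where \<sigma>: "homeomorphic_maps (open_disc (d C\<^sub>0)) (subtopology X C\<^sub>0) (\<Phi> C\<^sub>0) \<sigma>"
    using char_homeomorphic[OF C0] by (auto simp: homeomorphic_map_maps)
  let ?O = "topspace (open_disc (d C\<^sub>0))"
  have \<sigma>c: "continuous_map (top_of_set {0..1}) (open_disc (d C\<^sub>0)) (\<sigma> \<circ> c)"
    using \<sigma> continuous_map_compose[OF c] unfolding homeomorphic_maps_def by blast
  have "top_of_set ?O = open_disc (d C\<^sub>0)"
    by (simp add: open_disc_top_of_set topspace_open_disc)
  then have "continuous_map (top_of_set {0..1}) (top_of_set ?O) (\<sigma> \<circ> c)" using \<sigma>c by (simp only:)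
  then have u: "continuous_on {0..1} (\<sigma> \<circ> c)" "\<And>s. s \<in> {0..1} \<Longrightarrow> \<sigma> (c s) \<in> ?O"
    by auto
  let ?h = "\<lambda>(t::real, s). (\<lambda>i. (1 - t) * \<sigma> (c s) i)"
  have "continuous_on ({0..1} \<times> {0..1}) ?h"
  proof -
    have "continuous_on ({0..1} \<times> {0..1}) (\<lambda>w. \<sigma> (c (snd w)))"
      by (rule continuous_on_compose2[OF u(1)[unfolded o_def] continuous_on_snd[OF continuous_on_id]]) auto
    then have ci: "continuous_on ({0..1} \<times> {0..1}) (\<lambda>w. \<sigma> (c (snd w)) i)" for i
      by (rule continuous_on_product_then_coordinatewise)
    show ?thesis
      unfolding split_def
      by (intro continuous_on_coordinatewise_then_product continuous_on_mult continuous_on_diff ci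
          continuous_on_const continuous_on_fst continuous_on_id)
  qed
  moreover have "?h w \<in> topspace (disc (d C\<^sub>0))" if "w \<in> {0..1} \<times> {0..1}" for w
  proof -
    obtain t s where w: "w = (t, s)" "0 \<le> t" "t \<le> 1" "s \<in> {0..1}" using \<open>w \<in> _\<close> by auto
    have "(1 - t) * radius (d C\<^sub>0) (\<sigma> (c s)) \<le> 1 * 1"
      using w u(2)[of s] radius_nonneg by (intro mult_mono) (auto simp: in_open_disc_iff)
    then show ?thesis using w u(2)[of s] by (auto simp: in_disc_iff in_open_disc_iff radius_mult)
  qed
  ultimately have "continuous_map (top_of_set ({0..1} \<times> {0..1})) (disc (d C\<^sub>0)) ?h"
    by (auto simp: disc_top_of_set)
  from continuous_map_compose[OF this char_continuous[OF C0]]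
  have hom: "homotopic_with (\<lambda>r. r 0 = r 1) (top_of_set {0..1}) X (\<lambda>s. \<Phi> C\<^sub>0 (\<sigma> (c s))) (\<lambda>_. \<Phi> C\<^sub>0 (\<lambda>_. 0))"
    unfolding homotopic_with_def prod_topology_top_of_set using \<open>c 0 = c 1\<close>
    by (intro exI[of _ "\<Phi> C\<^sub>0 \<circ> ?h"]) auto
  have id: "\<Phi> C\<^sub>0 (\<sigma> (c s)) = c s" if "s \<in> topspace (top_of_set {0..1})" for s
    using \<sigma> continuous_map_in_topspace[OF c that] unfolding homeomorphic_maps_def by blast
  have "homotopic_with (\<lambda>r. r 0 = r 1) (top_of_set {0..1}) X c (\<lambda>_. \<Phi> C\<^sub>0 (\<lambda>_. 0))"
    by (rule homotopic_with_eq[OF hom]) (use id in auto)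
  then show ?case by blast
next
  case (Suc j)
  obtain H where H:
    "continuous_map (prod_topology (top_of_set {0..1::real}) (subtopology X (thick C\<^sub>0 (Suc j)))) X H"
    "\<And>z. z \<in> thick C\<^sub>0 (Suc j) \<Longrightarrow> H (0, z) = z"
    "\<And>z. z \<in> thick C\<^sub>0 (Suc j) \<Longrightarrow> H (1, z) \<in> thick C\<^sub>0 j"
    by (rule thick_Suc_deformation[OF C0, of j]) (rule that)
  have c: "continuous_map (top_of_set {0..1}) (subtopology X (thick C\<^sub>0 (Suc j))) c"
    using Suc.prems(1) by (simp add: pathin_def)
  have cin: "c s \<in> thick C\<^sub>0 (Suc j)" if "s \<in> {0..1}" for s
    using Suc.prems(1) that by (simp add: pathin_subtopology)
  let ?h = "H \<circ> (\<lambda>(t, s). (t, c s))"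
  have "continuous_map (prod_topology (top_of_set {0..1::real}) (top_of_set {0..1}))
      (prod_topology (top_of_set {0..1::real}) (subtopology X (thick C\<^sub>0 (Suc j)))) (\<lambda>(t, s). (t, c s))"
    unfolding split_def
    by (intro continuous_map_pairedI continuous_map_fst
        continuous_map_compose[OF continuous_map_snd c, unfolded o_def])
  from continuous_map_compose[OF this H(1)]
  have h: "continuous_map (prod_topology (top_of_set {0..1}) (top_of_set {0..1})) X ?h" .
  have hom: "homotopic_with (\<lambda>r. r 0 = r 1) (top_of_set {0..1}) X (\<lambda>s. H (0, c s)) (\<lambda>s. H (1, c s))"
    unfolding homotopic_with_def using h Suc.prems(2) by (intro exI[of _ ?h]) auto
  have "homotopic_with (\<lambda>r. r 0 = r 1) (top_of_set {0..1}) X c (\<lambda>s. H (1, c s))"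
    by (rule homotopic_with_eq[OF hom]) (use H(2)[OF cin] in auto)
  moreover have "pathin X (\<lambda>s. H (1, c s))"
    using homotopic_with_imp_continuous_maps[OF hom] by (simp add: pathin_def)
  then have "pathin (subtopology X (thick C\<^sub>0 j)) (\<lambda>s. H (1, c s))"
    using H(3)[OF cin] by (simp add: pathin_subtopology)
  then obtain a where "homotopic_with (\<lambda>r. r 0 = r 1) (top_of_set {0..1}) X (\<lambda>s. H (1, c s)) (\<lambda>_. a)"
    using Suc.IH[of "\<lambda>s. H (1, c s)"] Suc.prems(2) by auto
  ultimately show ?case using homotopic_with_trans by blast
qed

text \<open>By compactness, a loop in the union of the thickenings lies in one of them.\<close>

theorem semilocally_simply_connected: "semilocally_simply_connected X"
  unfolding semilocally_simply_connected_def
proof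
  fix a assume "a \<in> topspace X"
  then obtain C\<^sub>0 where C0: "C\<^sub>0 \<in> \<C>" "a \<in> C\<^sub>0" using cells_cover by blast
  let ?U = "\<Union>j. thick C\<^sub>0 j"
  have "path_homotopic X \<delta> \<delta>'"
    if \<delta>: "pathin (subtopology X ?U) \<delta>" and \<delta>': "pathin (subtopology X ?U) \<delta>'"
      and ends: "\<delta> 0 = \<delta>' 0" "\<delta> 1 = \<delta>' 1" for \<delta> \<delta>'
  proof -
    let ?c = "path_concat \<delta> (\<lambda>t. \<delta>' (1 - t))"
    have c: "pathin (subtopology X ?U) ?c"
      by (rule pathin_concat[OF \<delta> pathin_reverse[OF \<delta>']]) (use ends in simp)
    have \<delta>X: "pathin X \<delta>" "pathin X \<delta>'" and cX: "pathin X ?c"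
      using \<delta> \<delta>' c by (simp_all add: pathin_subtopology)
    obtain n where n: "?c ` {0..1} \<subseteq> skel (enat n)"
      using compactin_subset_skel[OF compactin_path_image[OF cX]] by blast
    have "?c t \<in> thick C\<^sub>0 n" if t: "t \<in> {0..1}" for t
    proof -
      have "?c t \<in> ?U" using c t unfolding pathin_subtopology by blast
      then obtain j where "?c t \<in> thick C\<^sub>0 j" by blast
      moreover have "?c t \<in> skel (enat (Suc (d C\<^sub>0 + n)))"
      proof -
        have "?c t \<in> skel (enat n)" using n t by blast
        moreover have "skel (enat n) \<subseteq> skel (enat (Suc (d C\<^sub>0 + n)))" by (rule skel_mono) simp
        ultimately show ?thesis by blast
      qed
      ultimately show ?thesis by (rule thick_Int_skel[OF C0(1)])
    qed
    then have "pathin (subtopology X (thick C\<^sub>0 n)) ?c" using cX by (simp add: pathin_subtopology)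
    then obtain b where "homotopic_with (\<lambda>r. r 0 = r 1) (top_of_set {0..1}) X ?c (\<lambda>_. b)"
      using loop_in_thick_null_homotopic[OF C0(1)] ends(1) by fastforce
    then have null: "path_homotopic X ?c (\<lambda>_. \<delta> 0)" using loop_null_homotopic by fastforce
    have "path_homotopic X \<delta> (path_concat ?c \<delta>')"
      by (rule path_homotopic_sym[OF path_concat_reverse_cancel[OF \<delta>X ends(2)]])
    also have "path_homotopic X \<dots> (path_concat (\<lambda>_. \<delta> 0) \<delta>')"
      by (rule path_homotopic_concat[OF null path_homotopic_refl[OF \<delta>X(2)]]) simp
    also have "path_homotopic X \<dots> \<delta>'" by (rule path_concat_const_left[OF \<delta>X(2) ends(1)])
    finally show ?thesis .
  qed
  moreover have "a \<in> ?U" using C0(2) by (auto intro!: exI[of _ 0])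
  ultimately show "\<exists>U. openin X U \<and> a \<in> U \<and> (\<forall>\<delta> \<delta>'. pathin (subtopology X U) \<delta> \<and>
      pathin (subtopology X U) \<delta>' \<and> \<delta> 0 = \<delta>' 0 \<and> \<delta> 1 = \<delta>' 1 \<longrightarrow> path_homotopic X \<delta> \<delta>')"
    using openin_Union_thick[OF C0(1)] by (intro exI[of _ ?U]) simp
qed

end


section \<open>Equivariant maps out of free cell complexes\<close>

text \<open>For \<open>n = 0\<close> the sphere is empty and the condition says that \<open>W\<close> is not; for \<open>n = 1\<close> it says that \<open>W\<close> is
  path connected.\<close>

definition fills_spheres :: "'w topology \<Rightarrow> bool" where
  "fills_spheres W \<longleftrightarrow> (\<forall>n f. continuous_map (subtopology (disc n) (disc_boundary n)) W f \<longrightarrow>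
     (\<exists>F. continuous_map (disc n) W F \<and> (\<forall>x\<in>disc_boundary n. F x = f x)))"

definition orbit_skeleton ::
  "('g, 'm) monoid_scheme \<Rightarrow> ('g \<Rightarrow> 'z \<Rightarrow> 'z) \<Rightarrow> 'r set \<Rightarrow> ('r \<Rightarrow> nat) \<Rightarrow>
     ('r \<Rightarrow> (nat \<Rightarrow> real) \<Rightarrow> 'z) \<Rightarrow> enat \<Rightarrow> 'z set" where
  "orbit_skeleton G \<alpha> R n \<xi> k = {\<alpha> g (\<xi> r x) |g r x. g \<in> carrier G \<and> r \<in> R \<and>
     x \<in> topspace (open_disc (n r)) \<and> enat (n r) < k}"

text \<open>The members of \<open>R\<close> stand for the orbits of cells, and \<open>\<xi> r\<close> is the characteristic map of one
  cell of the orbit; the others are its translates. In this form the equivariant cells \<open>G \<times> D\<^sup>n\<close> of a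
  free \<open>G\<close>-CW complex can be treated one at a time. The assumption \<open>weak\<close> is the weak topology for
  \<open>k = \<infinity>\<close>, and for finite \<open>k\<close> that of the skeleta.\<close>

locale free_cells = continuous_action G Z \<alpha> for G (structure) and Z :: "'z topology" and \<alpha> +
  fixes R :: "'r set" and n :: "'r \<Rightarrow> nat" and \<xi> :: "'r \<Rightarrow> (nat \<Rightarrow> real) \<Rightarrow> 'z"
  assumes char_cont: "r \<in> R \<Longrightarrow> continuous_map (disc (n r)) Z (\<xi> r)"
    and decomp: "z \<in> topspace Z \<Longrightarrow>
      \<exists>g\<in>carrier G. \<exists>r\<in>R. \<exists>x\<in>topspace (open_disc (n r)). z = \<alpha> g (\<xi> r x)"
    and unique: "\<lbrakk>g \<in> carrier G; g' \<in> carrier G; r \<in> R; r' \<in> R; x \<in> topspace (open_disc (n r));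
      x' \<in> topspace (open_disc (n r')); \<alpha> g (\<xi> r x) = \<alpha> g' (\<xi> r' x')\<rbrakk> \<Longrightarrow> g = g' \<and> r = r' \<and> x = x'"
    and boundary: "\<lbrakk>r \<in> R; x \<in> disc_boundary (n r)\<rbrakk> \<Longrightarrow>
      \<exists>g\<in>carrier G. \<exists>r'\<in>R. \<exists>x'\<in>topspace (open_disc (n r')). n r' < n r \<and> \<xi> r x = \<alpha> g (\<xi> r' x')"
    and weak: "\<lbrakk>S \<subseteq> orbit_skeleton G \<alpha> R n \<xi> k;
      \<And>r g. r \<in> R \<Longrightarrow> g \<in> carrier G \<Longrightarrow> enat (n r) < k \<Longrightarrow>
        closedin (disc (n r)) {x \<in> topspace (disc (n r)). \<alpha> g (\<xi> r x) \<in> S}\<rbrakk> \<Longrightarrow> closedin Z S"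
begin

abbreviation sk :: "enat \<Rightarrow> 'z set" where "sk k \<equiv> orbit_skeleton G \<alpha> R n \<xi> k"

lemma sk_mono: "k \<le> l \<Longrightarrow> sk k \<subseteq> sk l"
  unfolding orbit_skeleton_def using order.strict_trans2 by blast

lemma open_in_sk:
  "g \<in> carrier G \<Longrightarrow> r \<in> R \<Longrightarrow> x \<in> topspace (open_disc (n r)) \<Longrightarrow> enat (n r) < k \<Longrightarrow> \<alpha> g (\<xi> r x) \<in> sk k"
  unfolding orbit_skeleton_def by blast

lemma open_not_in_sk:
  "g \<in> carrier G \<Longrightarrow> r \<in> R \<Longrightarrow> x \<in> topspace (open_disc (n r)) \<Longrightarrow> k \<le> enat (n r) \<Longrightarrow> \<alpha> g (\<xi> r x) \<notin> sk k"
  unfolding orbit_skeleton_def using unique[of g _ r _ x] by (auto simp: not_less dest: leD)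

lemma char_in: "r \<in> R \<Longrightarrow> x \<in> topspace (disc (n r)) \<Longrightarrow> \<xi> r x \<in> topspace Z"
  using char_cont continuous_map_in_topspace by metis

lemma open_in_disc: "x \<in> topspace (open_disc m) \<Longrightarrow> x \<in> topspace (disc m)"
  using topspace_disc_Un by blast

lemma boundary_in_disc: "x \<in> disc_boundary m \<Longrightarrow> x \<in> topspace (disc m)"
  using topspace_disc_Un by blast

lemma boundary_in_sk:
  assumes "g \<in> carrier G" "r \<in> R" "x \<in> disc_boundary (n r)"
  shows "\<alpha> g (\<xi> r x) \<in> sk (enat (n r))"
proof -
  obtain h r' x' where h: "h \<in> carrier G" "r' \<in> R" "x' \<in> topspace (open_disc (n r'))" "n r' < n r"
    "\<xi> r x = \<alpha> h (\<xi> r' x')" using boundary[OF assms(2,3)] by blast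
  have "\<alpha> g (\<xi> r x) = \<alpha> (g \<otimes> h) (\<xi> r' x')"
    using act_mult[OF assms(1) h(1) char_in[OF h(2) open_in_disc[OF h(3)]]] h(5) by simp
  then show ?thesis using open_in_sk[of "g \<otimes> h" r' x' "enat (n r)"] h assms(1) by simp
qed

lemma cell_in_sk:
  assumes "g \<in> carrier G" "r \<in> R" "x \<in> topspace (disc (n r))" "enat (n r) < k"
  shows "\<alpha> g (\<xi> r x) \<in> sk k"
proof (cases "x \<in> disc_boundary (n r)")
  case True
  then show ?thesis using boundary_in_sk[OF assms(1,2)] sk_mono[OF less_imp_le[OF assms(4)]] by blast
next
  case False
  then have "x \<in> topspace (open_disc (n r))" using assms(3) topspace_disc_Un by blast
  then show ?thesis using open_in_sk assms by blast
qed

lemma sk_subset: "sk k \<subseteq> topspace Z"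
  unfolding orbit_skeleton_def using act_in char_in open_in_disc by auto

lemma act_sk:
  assumes "g \<in> carrier G" "z \<in> sk k" shows "\<alpha> g z \<in> sk k"
proof -
  obtain h r x where h: "h \<in> carrier G" "r \<in> R" "x \<in> topspace (open_disc (n r))" "enat (n r) < k"
    "z = \<alpha> h (\<xi> r x)" using assms(2) unfolding orbit_skeleton_def by blast
  have "\<alpha> g z = \<alpha> (g \<otimes> h) (\<xi> r x)"
    using act_mult[OF assms(1) h(1) char_in[OF h(2) open_in_disc[OF h(3)]]] h(5) by simp
  then show ?thesis using open_in_sk[of "g \<otimes> h" r x k] h assms(1) by simp
qed

lemma translated_char_cont:
  "g \<in> carrier G \<Longrightarrow> r \<in> R \<Longrightarrow> continuous_map (disc (n r)) Z (\<lambda>x. \<alpha> g (\<xi> r x))"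
  using continuous_map_compose[OF char_cont act_continuous] by (simp add: o_def)

lemma translated_char_cont_sk:
  assumes "g \<in> carrier G" "r \<in> R" "enat (n r) < k"
  shows "continuous_map (disc (n r)) (subtopology Z (sk k)) (\<lambda>x. \<alpha> g (\<xi> r x))"
  unfolding continuous_map_in_subtopology
  using translated_char_cont[OF assms(1,2)] cell_in_sk[OF assms(1,2) _ assms(3)] by blast

text \<open>The extension over the cells of one more dimension is chosen on one cell of each orbit and
  transported to the translates, which is unambiguous because the action is free.\<close>

lemma extend_over_skeleton:
  assumes W: "continuous_action G W \<beta>" "fills_spheres W"
    and f: "continuous_map (subtopology Z (sk (enat k))) W f"
    and eq: "\<And>g z. g \<in> carrier G \<Longrightarrow> z \<in> sk (enat k) \<Longrightarrow> f (\<alpha> g z) = \<beta> g (f z)"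
  obtains f' where "continuous_map (subtopology Z (sk (enat (Suc k)))) W f'"
    "\<And>g z. g \<in> carrier G \<Longrightarrow> z \<in> sk (enat (Suc k)) \<Longrightarrow> f' (\<alpha> g z) = \<beta> g (f' z)"
    "\<And>z. z \<in> sk (enat k) \<Longrightarrow> f' z = f z"
proof -
  interpret W: continuous_action G W \<beta> by (rule W(1))
  have topsk: "topspace (subtopology Z (sk l)) = sk l" for l using sk_subset by auto
  have "\<exists>F. continuous_map (disc (n r)) W F \<and> (\<forall>x\<in>disc_boundary (n r). F x = f (\<xi> r x))"
    if r: "r \<in> R" "n r = k" for r
  proof -
    have one: "\<xi> r x = \<alpha> \<one> (\<xi> r x)" if "x \<in> topspace (disc (n r))" for x
      using act_one[OF char_in[OF r(1) that]] by simp
    have "continuous_map (subtopology (disc (n r)) (disc_boundary (n r))) (subtopology Z (sk (enat k))) (\<xi> r)"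
      unfolding continuous_map_in_subtopology
      using continuous_map_from_subtopology[OF char_cont[OF r(1)]] boundary_in_sk[OF one_closed r(1)]
        one[OF boundary_in_disc] r(2) by auto
    from continuous_map_compose[OF this f] show ?thesis
      using W(2) unfolding fills_spheres_def o_def by blast
  qed
  then obtain e where e: "\<And>r. r \<in> R \<Longrightarrow> n r = k \<Longrightarrow> continuous_map (disc (n r)) W (e r)"
    "\<And>r x. r \<in> R \<Longrightarrow> n r = k \<Longrightarrow> x \<in> disc_boundary (n r) \<Longrightarrow> e r x = f (\<xi> r x)"
    by metis
  define Q where "Q z w \<longleftrightarrow> (\<exists>g\<in>carrier G. \<exists>r\<in>R. \<exists>x\<in>topspace (open_disc (n r)).
      n r = k \<and> z = \<alpha> g (\<xi> r x) \<and> w = \<beta> g (e r x))" for z w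
  define f' where "f' z = (if z \<in> sk (enat k) then f z else (SOME w. Q z w))" for z
  have f'_low: "f' z = f z" if "z \<in> sk (enat k)" for z using that by (simp add: f'_def)
  have f'_cell: "f' (\<alpha> g (\<xi> r x)) = \<beta> g (e r x)"
    if g: "g \<in> carrier G" and r: "r \<in> R" "n r = k" and x: "x \<in> topspace (disc (n r))" for g r x
  proof (cases "x \<in> disc_boundary (n r)")
    case True
    have bd: "\<alpha> h (\<xi> r x) \<in> sk (enat k)" if "h \<in> carrier G" for h
      using boundary_in_sk[OF that r(1) True] r(2) by simp
    have "\<xi> r x \<in> sk (enat k)" using bd[OF one_closed] act_one[OF char_in[OF r(1) x]] by simp
    then show ?thesis using f'_low[OF bd[OF g]] eq[OF g] e(2)[OF r True] by simp
  next
    case False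
    then have x': "x \<in> topspace (open_disc (n r))" using x topspace_disc_Un by blast
    have "Q (\<alpha> g (\<xi> r x)) w \<longleftrightarrow> w = \<beta> g (e r x)" for w
      unfolding Q_def using unique[OF g _ r(1) _ x'] g r x' by (auto; metis)
    then have "Q (\<alpha> g (\<xi> r x)) = (\<lambda>w. w = \<beta> g (e r x))" by blast
    then show ?thesis using open_not_in_sk[OF g r(1) x', of "enat k"] r(2) by (simp add: f'_def)
  qed
  have dims: "enat (n r) < enat (Suc k) \<longleftrightarrow> n r = k \<or> enat (n r) < enat k" for r by auto
  have "continuous_map (subtopology Z (sk (enat (Suc k)))) W f'"
    unfolding continuous_map_closedin
  proof (intro conjI allI impI)
    show "f' \<in> topspace (subtopology Z (sk (enat (Suc k)))) \<rightarrow> topspace W"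
      unfolding topsk
    proof
      fix z assume "z \<in> sk (enat (Suc k))"
      then obtain g r x where z: "g \<in> carrier G" "r \<in> R" "x \<in> topspace (open_disc (n r))"
        "enat (n r) < enat (Suc k)" "z = \<alpha> g (\<xi> r x)" unfolding orbit_skeleton_def by blast
      show "f' z \<in> topspace W"
      proof (cases "n r = k")
        case True
        then show ?thesis
          unfolding z(5) f'_cell[OF z(1,2) True open_in_disc[OF z(3)]]
          by (intro W.act_in z(1) continuous_map_in_topspace[OF e(1)[OF z(2) True]] open_in_disc z(3))
      next
        case False
        then have "z \<in> sk (enat k)" using open_in_sk[OF z(1-3), of "enat k"] z(4,5) by auto
        then show ?thesis using f'_low continuous_map_in_topspace[OF f, unfolded topsk] by simp
      qed
    qed
    fix T assume T: "closedin W T"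
    let ?S = "{z \<in> topspace (subtopology Z (sk (enat (Suc k)))). f' z \<in> T}"
    have S: "?S = {z \<in> sk (enat (Suc k)). f' z \<in> T}" unfolding topsk ..
    have "closedin Z ?S"
      unfolding S
    proof (rule weak[of _ "enat (Suc k)"])
      fix r g assume r: "r \<in> R" and g: "g \<in> carrier G" and lt: "enat (n r) < enat (Suc k)"
      have in_sk: "\<alpha> g (\<xi> r x) \<in> sk (enat (Suc k))" if "x \<in> topspace (disc (n r))" for x
        by (rule cell_in_sk[OF g r that lt])
      show "closedin (disc (n r)) {x \<in> topspace (disc (n r)). \<alpha> g (\<xi> r x) \<in> {z \<in> sk (enat (Suc k)). f' z \<in> T}}"
      proof (cases "n r = k")
        case True
        have "{x \<in> topspace (disc (n r)). \<alpha> g (\<xi> r x) \<in> {z \<in> sk (enat (Suc k)). f' z \<in> T}} =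
            {x \<in> topspace (disc (n r)). \<beta> g (e r x) \<in> T}"
          using in_sk f'_cell[OF g r True] by auto
        moreover have "continuous_map (disc (n r)) W (\<lambda>x. \<beta> g (e r x))"
          using continuous_map_compose[OF e(1)[OF r True] W.act_continuous[OF g]] by (simp add: o_def)
        ultimately show ?thesis using closedin_continuous_map_preimage[OF _ T] by simp
      next
        case False
        then have lt': "enat (n r) < enat k" using lt by simp
        have "{x \<in> topspace (disc (n r)). \<alpha> g (\<xi> r x) \<in> {z \<in> sk (enat (Suc k)). f' z \<in> T}} =
            {x \<in> topspace (disc (n r)). f (\<alpha> g (\<xi> r x)) \<in> T}"
          using in_sk f'_low[OF cell_in_sk[OF g r _ lt']] by auto
        moreover have "continuous_map (disc (n r)) W (\<lambda>x. f (\<alpha> g (\<xi> r x)))"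
          using continuous_map_compose[OF translated_char_cont_sk[OF g r lt'] f] by (simp add: o_def)
        ultimately show ?thesis using closedin_continuous_map_preimage[OF _ T] by simp
      qed
    qed auto
    then show "closedin (subtopology Z (sk (enat (Suc k)))) ?S"
      by (intro closedin_subset_topspace) (auto simp: topsk)
  qed
  moreover have "f' (\<alpha> g z) = \<beta> g (f' z)" if g: "g \<in> carrier G" and z: "z \<in> sk (enat (Suc k))" for g z
  proof (cases "z \<in> sk (enat k)")
    case True
    then show ?thesis using f'_low act_sk[OF g] eq[OF g] by simp
  next
    case False
    obtain h r x where h: "h \<in> carrier G" "r \<in> R" "x \<in> topspace (open_disc (n r))"
        "enat (n r) < enat (Suc k)" "z = \<alpha> h (\<xi> r x)" using z unfolding orbit_skeleton_def by blast
    have r: "n r = k" using False open_in_sk[OF h(1-3), of "enat k"] h(4,5) by (auto simp: less_Suc_eq)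
    note x = open_in_disc[OF h(3)]
    have "\<alpha> g z = \<alpha> (g \<otimes> h) (\<xi> r x)" using act_mult[OF g h(1) char_in[OF h(2) x]] h(5) by simp
    then have "f' (\<alpha> g z) = \<beta> (g \<otimes> h) (e r x)" using f'_cell[OF m_closed[OF g h(1)] h(2) r x] by simp
    also have "\<dots> = \<beta> g (\<beta> h (e r x))"
      by (rule W.act_mult[OF g h(1) continuous_map_in_topspace[OF e(1)[OF h(2) r] x]])
    also have "\<dots> = \<beta> g (f' z)" using f'_cell[OF h(1,2) r x] h(5) by simp
    finally show ?thesis .
  qed
  ultimately show thesis using that f'_low by blast
qed

text \<open>The maps on the skeleta extend each other, and by the weak topology their union is continuous.\<close>

theorem equivariant_map_exists:
  assumes W: "continuous_action G W \<beta>" "fills_spheres W"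
  obtains F where "continuous_map Z W F" "\<And>g z. g \<in> carrier G \<Longrightarrow> z \<in> topspace Z \<Longrightarrow> F (\<alpha> g z) = \<beta> g (F z)"
proof -
  interpret W: continuous_action G W \<beta> by (rule W(1))
  have topsk: "topspace (subtopology Z (sk l)) = sk l" for l using sk_subset by auto
  define P where "P k f \<longleftrightarrow> continuous_map (subtopology Z (sk (enat k))) W f \<and>
     (\<forall>g\<in>carrier G. \<forall>z\<in>sk (enat k). f (\<alpha> g z) = \<beta> g (f z))" for k f
  have sk0: "sk (enat 0) = {}" by (simp add: orbit_skeleton_def enat_0)
  have "\<exists>f. \<forall>k. P k (f k) \<and> (\<forall>z\<in>sk (enat k). f (Suc k) z = f k z)"
  proof (rule dependent_nat_choice)
    have "subtopology Z (sk (enat 0)) = trivial_topology" unfolding sk0 by simp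
    then show "\<exists>f. P 0 f" unfolding P_def using sk0 by (auto simp: continuous_map_on_empty)
    fix f k assume "P k f"
    then show "\<exists>f'. P (Suc k) f' \<and> (\<forall>z\<in>sk (enat k). f' z = f z)"
      unfolding P_def using extend_over_skeleton[OF W, of k f] by metis
  qed
  then obtain f where f: "\<And>k. P k (f k)" "\<And>k z. z \<in> sk (enat k) \<Longrightarrow> f (Suc k) z = f k z"
    by blast
  have fcont: "continuous_map (subtopology Z (sk (enat k))) W (f k)" for k
    using f(1)[of k] by (simp add: P_def)
  have agree: "f m z = f k z" if "k \<le> m" "z \<in> sk (enat k)" for k m z
    using that
  proof (induction m rule: dec_induct)
    case (step m)
    then have "z \<in> sk (enat m)" using sk_mono[of "enat k" "enat m"] by auto
    then show ?case using f(2) step by simp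
  qed simp
  have cov: "\<exists>k. z \<in> sk (enat k)" if z: "z \<in> topspace Z" for z
  proof -
    obtain g r x where "g \<in> carrier G" "r \<in> R" "x \<in> topspace (open_disc (n r))" "z = \<alpha> g (\<xi> r x)"
      using decomp[OF z] by blast
    then show ?thesis using open_in_sk[of g r x "enat (Suc (n r))"] by auto
  qed
  define F where "F z = f (LEAST k. z \<in> sk (enat k)) z" for z
  have F: "F z = f k z" if "z \<in> sk (enat k)" for k z
    unfolding F_def using agree[OF Least_le[of "\<lambda>k. z \<in> sk (enat k)", OF that] LeastI[of "\<lambda>k. z \<in> sk (enat k)", OF that]] by simp
  have Fcell: "continuous_map (disc (n r)) W (\<lambda>x. F (\<alpha> g (\<xi> r x)))" if g: "g \<in> carrier G" and r: "r \<in> R" for g r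
  proof (rule continuous_map_eq)
    show "continuous_map (disc (n r)) W (\<lambda>x. f (Suc (n r)) (\<alpha> g (\<xi> r x)))"
      using continuous_map_compose[OF translated_char_cont_sk[OF g r] fcont[of "Suc (n r)"]]
      by (simp add: o_def)
    show "f (Suc (n r)) (\<alpha> g (\<xi> r x)) = F (\<alpha> g (\<xi> r x))" if "x \<in> topspace (disc (n r))" for x
      using F[OF cell_in_sk[OF g r that, of "enat (Suc (n r))"]] by simp
  qed
  have "continuous_map Z W F"
    unfolding continuous_map_closedin
  proof (intro conjI allI impI)
    show "F \<in> topspace Z \<rightarrow> topspace W"
    proof
      fix z assume z: "z \<in> topspace Z"
      then obtain k where k: "z \<in> sk (enat k)" using cov by blast
      then show "F z \<in> topspace W"
        using F[OF k] f(1)[of k] continuous_map_in_topspace[of "subtopology Z (sk (enat k))" W "f k" z]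
        by (simp add: P_def topsk z)
    qed
    fix T assume T: "closedin W T"
    show "closedin Z {z \<in> topspace Z. F z \<in> T}"
    proof (rule weak[of _ \<infinity>])
      have "topspace Z \<subseteq> sk \<infinity>" using cov sk_mono[of _ \<infinity>] by auto
      then show "{z \<in> topspace Z. F z \<in> T} \<subseteq> sk \<infinity>" by blast
      fix r g assume r: "r \<in> R" and g: "g \<in> carrier G"
      have "{x \<in> topspace (disc (n r)). \<alpha> g (\<xi> r x) \<in> {z \<in> topspace Z. F z \<in> T}} =
          {x \<in> topspace (disc (n r)). F (\<alpha> g (\<xi> r x)) \<in> T}"
        using act_in[OF g char_in[OF r]] by auto
      then show "closedin (disc (n r)) {x \<in> topspace (disc (n r)). \<alpha> g (\<xi> r x) \<in> {z \<in> topspace Z. F z \<in> T}}"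
        using closedin_continuous_map_preimage[OF Fcell[OF g r] T] by simp
    qed
  qed
  moreover have "F (\<alpha> g z) = \<beta> g (F z)" if g: "g \<in> carrier G" and z: "z \<in> topspace Z" for g z
  proof -
    obtain k where k: "z \<in> sk (enat k)" using cov[OF z] by blast
    show ?thesis using F[OF k] F[OF act_sk[OF g k]] f(1)[of k] g k by (simp add: P_def)
  qed
  ultimately show thesis using that by blast
qed

end

text \<open>The contraction of the disc to its centre, run backwards, is lifted as a homotopy.\<close>

lemma lift_char:
  assumes p: "covering_map P Y \<pi>" and f: "continuous_map (disc n) Y f"
  obtains \<xi> where "continuous_map (disc n) P \<xi>" "\<And>x. x \<in> topspace (disc n) \<Longrightarrow> \<pi> (\<xi> x) = f x"
proof -
  have D: "disc n = top_of_set (topspace (disc n))" by (simp add: disc_top_of_set)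
  let ?c = "\<lambda>(t::real, x). (\<lambda>i::nat. t * x i :: real)"
  have "continuous_on ({0..1} \<times> topspace (disc n)) ?c"
    unfolding split_def
    by (intro continuous_on_coordinatewise_then_product continuous_on_mult continuous_on_fst continuous_on_id
        continuous_on_product_then_coordinatewise[OF continuous_on_snd[OF continuous_on_id]])
  moreover have "?c w \<in> topspace (disc n)" if w0: "w \<in> {0..1} \<times> topspace (disc n)" for w
  proof -
    obtain t x where w: "w = (t, x)" "0 \<le> t" "t \<le> 1" "x \<in> topspace (disc n)" using w0 by auto
    have "t * radius n x \<le> 1 * 1"
      using w radius_nonneg[of n x] by (intro mult_mono) (auto simp: in_disc_iff)
    then show ?thesis using w by (auto simp: in_disc_iff radius_mult)
  qed
  ultimately have "continuous_map (top_of_set ({0..1} \<times> topspace (disc n))) (top_of_set (topspace (disc n))) ?c"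
    by auto
  then have "continuous_map (prod_topology (top_of_set {0..1}) (top_of_set (topspace (disc n))))
      (top_of_set (topspace (disc n))) ?c"
    by (simp only: prod_topology_top_of_set)
  then have "continuous_map (prod_topology (top_of_set {0..1}) (disc n)) (disc n) ?c"
    by (simp only: D[symmetric])
  from continuous_map_compose[OF this f]
  have h: "continuous_map (prod_topology (top_of_set {0..1}) (disc n)) Y (f \<circ> ?c)" .
  have zero: "(\<lambda>_. 0) \<in> topspace (disc n)" by (simp add: topspace_disc)
  have "f (\<lambda>_. 0) \<in> \<pi> ` topspace P"
    using p continuous_map_in_topspace[OF f zero] by (simp add: covering_map_def)
  then obtain z where z: "z \<in> topspace P" "\<pi> z = f (\<lambda>_. 0)" by auto
  have s: "continuous_map (disc n) P (\<lambda>_. z)" "\<And>x. x \<in> topspace (disc n) \<Longrightarrow> \<pi> z = (f \<circ> ?c) (0, x)"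
    using z by auto
  show thesis
  proof (rule covering_map_lift_homotopy[OF p h s])
    fix H
    assume H: "continuous_map (prod_topology (top_of_set {0..1::real}) (disc n)) P H"
      "\<And>t x. t \<in> {0..1} \<Longrightarrow> x \<in> topspace (disc n) \<Longrightarrow> \<pi> (H (t, x)) = (f \<circ> ?c) (t, x)"
    have "continuous_map (disc n) P (H \<circ> Pair 1)"
      by (rule continuous_map_o_Pair[OF H(1)]) simp
    then show thesis by (rule that) (use H(2)[of 1] in auto)
  qed
qed

text \<open>A principal covering inherits the cells of its base: the lifts of one characteristic map are the
  translates of any one of them.\<close>

lemma free_cells_principal_covering:
  assumes P: "principal_covering G P \<alpha> Y \<pi>" and Y: "cw Y \<C> d \<Phi>"
  shows "\<exists>\<xi>. free_cells G P \<alpha> \<C> d \<xi>"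
proof -
  interpret principal_covering G P \<alpha> Y \<pi> by (rule P)
  interpret cw Y \<C> d \<Phi> by (rule Y)
  have "\<exists>\<xi>. continuous_map (disc (d C)) P \<xi> \<and> (\<forall>x\<in>topspace (disc (d C)). \<pi> (\<xi> x) = \<Phi> C x)"
    if "C \<in> \<C>" for C
    using lift_char[OF covering char_continuous[OF that]] by metis
  then obtain \<xi> where \<xi>: "\<And>C. C \<in> \<C> \<Longrightarrow> continuous_map (disc (d C)) P (\<xi> C)"
    "\<And>C x. C \<in> \<C> \<Longrightarrow> x \<in> topspace (disc (d C)) \<Longrightarrow> \<pi> (\<xi> C x) = \<Phi> C x" by metis
  have open_in: "x \<in> topspace (open_disc m) \<Longrightarrow> x \<in> topspace (disc m)" for x m
    using topspace_disc_Un by blast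
  have \<xi>P: "\<xi> C x \<in> topspace P" if "C \<in> \<C>" "x \<in> topspace (disc (d C))" for C x
    using continuous_map_in_topspace[OF \<xi>(1)] that by blast
  have \<pi>cell: "\<pi> (\<alpha> g (\<xi> C x)) = \<Phi> C x" if "g \<in> carrier G" "C \<in> \<C>" "x \<in> topspace (disc (d C))" for g C x
    using act_fibre[OF that(1) \<xi>P[OF that(2,3)]] \<xi>(2)[OF that(2,3)] by simp
  have hit: "\<exists>g\<in>carrier G. z = \<alpha> g (\<xi> C x)"
    if "z \<in> topspace P" "C \<in> \<C>" "x \<in> topspace (disc (d C))" "\<pi> z = \<Phi> C x" for z C x
    using transitive[OF \<xi>P[OF that(2,3)] that(1)] \<xi>(2)[OF that(2,3)] that(4) by simp
  have low: "\<pi> z \<in> skel k" if z0: "z \<in> orbit_skeleton G \<alpha> \<C> d \<xi> k" for z k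
  proof -
    obtain g C x where z: "g \<in> carrier G" "C \<in> \<C>" "x \<in> topspace (open_disc (d C))" "enat (d C) < k"
      "z = \<alpha> g (\<xi> C x)" using z0 unfolding orbit_skeleton_def by blast
    then show ?thesis
      using \<pi>cell[OF z(1,2) open_in[OF z(3)]] char_in_cell[OF z(2,3)] by (auto simp: skel_def)
  qed
  have "free_cells G P \<alpha> \<C> d \<xi>"
  proof (unfold_locales, goal_cases)
    case (1 C) then show ?case by (rule \<xi>(1))
  next
    case (2 z)
    have "\<pi> z \<in> \<Union>\<C>" using covering_map_in_topspace[OF covering 2] cells_cover by simp
    then obtain C where C: "C \<in> \<C>" "\<pi> z \<in> C" by blast
    then obtain x where x: "x \<in> topspace (open_disc (d C))" "\<pi> z = \<Phi> C x" using char_image[OF C(1)] by blast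
    then show ?case using hit[OF 2 C(1) open_in[OF x(1)] x(2)] C(1) by blast
  next
    case (3 g g' C C' x x')
    have e: "\<Phi> C x = \<Phi> C' x'"
      using \<pi>cell[OF 3(1,3) open_in[OF 3(5)]] \<pi>cell[OF 3(2,4) open_in[OF 3(6)]] 3(7) by simp
    have CC: "C = C'"
      using cells_disjoint[OF 3(3,4) char_in_cell[OF 3(3,5)]] char_in_cell[OF 3(4,6)] e by simp
    have xx: "x = x'" using char_inj[OF 3(3)] 3(5,6) e CC by (auto simp: inj_on_def)
    let ?w = "\<xi> C x"
    note w = \<xi>P[OF 3(3) open_in[OF 3(5)]]
    have "\<alpha> (inv\<^bsub>G\<^esub> g' \<otimes>\<^bsub>G\<^esub> g) ?w = \<alpha> (inv\<^bsub>G\<^esub> g') (\<alpha> g' ?w)"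
      using act_mult[OF inv_closed[OF 3(2)] 3(1) w] 3(7) CC xx by simp
    then have "\<alpha> (inv\<^bsub>G\<^esub> g' \<otimes>\<^bsub>G\<^esub> g) ?w = ?w" using act_inv[OF 3(2) w] by simp
    then have "inv\<^bsub>G\<^esub> g' \<otimes>\<^bsub>G\<^esub> g = \<one>\<^bsub>G\<^esub>" using free[OF _ w] 3(1,2) by simp
    then have "g = g'" using 3(1,2) by (metis inv_closed inv_equality inv_inv)
    then show ?case using CC xx by simp
  next
    case (4 C x)
    obtain B where B: "B \<in> \<C>" "d B < d C" "\<Phi> C x \<in> B"
      using char_boundary[OF 4] by (auto simp: skel_def)
    then obtain x' where x': "x' \<in> topspace (open_disc (d B))" "\<Phi> C x = \<Phi> B x'"
      using char_image[OF B(1)] by blast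
    have x: "x \<in> topspace (disc (d C))" using 4(2) topspace_disc_Un by blast
    then show ?case
      using hit[OF \<xi>P[OF 4(1) x] B(1) open_in[OF x'(1)]] \<xi>(2)[OF 4(1) x] x' B by auto
  next
    case (5 S k)
    have SP: "S \<subseteq> topspace P"
      using 5(1) act_in \<xi>P open_in unfolding orbit_skeleton_def by blast
    \<comment> \<open>Only the weak topology of the base is known, so the complement of \<open>S\<close> is shown to be open on
      one sheet \<open>V\<close> at a time: there it is the complement of the preimage of \<open>L\<close>, where \<open>L\<close> is the
      projection of the part of \<open>S\<close> in \<open>V\<close>, enlarged by all of the skeleton that lies outside \<open>U\<close>.\<close>
    have "\<exists>T. openin P T \<and> z \<in> T \<and> T \<subseteq> topspace P - S" if z: "z \<in> topspace P - S" for z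
    proof -
      have zP: "z \<in> topspace P" using z by blast
      obtain U where U: "openin Y U" "\<pi> z \<in> U"
        "\<And>x. x \<in> topspace P \<Longrightarrow> \<pi> x \<in> U \<Longrightarrow>
          \<exists>V \<sigma>. openin P V \<and> x \<in> V \<and> continuous_map (subtopology Y U) P \<sigma> \<and>
            (\<forall>v\<in>V. \<pi> v \<in> U \<and> \<sigma> (\<pi> v) = v) \<and> (\<forall>u\<in>U. \<sigma> u \<in> V \<and> \<pi> (\<sigma> u) = u)"
        using covering_map_evenly_covered[OF covering covering_map_in_topspace[OF covering zP]] by blast
      obtain V \<sigma> where V: "openin P V" "z \<in> V" "continuous_map (subtopology Y U) P \<sigma>"
          "\<forall>v\<in>V. \<pi> v \<in> U \<and> \<sigma> (\<pi> v) = v" "\<forall>u\<in>U. \<sigma> u \<in> V \<and> \<pi> (\<sigma> u) = u"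
        using U(3)[OF zP U(2)] by blast
      define L where "L = {b \<in> skel k. b \<in> U \<longrightarrow> \<sigma> b \<in> S}"
      have "closedin Y L"
      proof (rule closedin_weak_preimage)
        show "L \<subseteq> skel k" by (auto simp: L_def)
        fix C assume C: "C \<in> \<C>" "enat (d C) < k"
        let ?N = "{x \<in> topspace (disc (d C)). \<Phi> C x \<in> U}"
        let ?O = "{x \<in> ?N. \<sigma> (\<Phi> C x) \<notin> S}"
        have opN: "openin (disc (d C)) ?N"
          by (rule openin_continuous_map_preimage[OF char_continuous[OF C(1)] U(1)])
        have topN: "topspace (subtopology (disc (d C)) ?N) = ?N" by auto
        have c1: "continuous_map (subtopology (disc (d C)) ?N) P (\<lambda>x. \<sigma> (\<Phi> C x))"
        proof -
          have "continuous_map (subtopology (disc (d C)) ?N) (subtopology Y U) (\<Phi> C)"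
            unfolding continuous_map_in_subtopology
            using continuous_map_from_subtopology[OF char_continuous[OF C(1)]] by auto
          from continuous_map_compose[OF this V(3)] show ?thesis by (simp add: o_def)
        qed
        \<comment> \<open>Near \<open>x0\<close> the lift of \<open>\<Phi> C\<close> to the sheet \<open>V\<close> coincides with a translate of \<open>\<xi> C\<close>, for which
          the hypothesis on \<open>S\<close> speaks.\<close>
        have "\<exists>T. openin (disc (d C)) T \<and> x0 \<in> T \<and> T \<subseteq> ?O" if x0: "x0 \<in> ?O" for x0
        proof -
          have s0: "\<sigma> (\<Phi> C x0) \<in> topspace P" "\<pi> (\<sigma> (\<Phi> C x0)) = \<Phi> C x0"
            using continuous_map_in_topspace[OF c1] x0 V(5) by auto
          then obtain g where g: "g \<in> carrier G" "\<sigma> (\<Phi> C x0) = \<alpha> g (\<xi> C x0)"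
            using hit[OF s0(1) C(1), of x0] x0 by auto
          have c2': "continuous_map (disc (d C)) P (\<lambda>x. \<alpha> g (\<xi> C x))"
            using continuous_map_compose[OF \<xi>(1)[OF C(1)] act_continuous[OF g(1)]] by (simp add: o_def)
          let ?A = "{x \<in> topspace (subtopology (disc (d C)) ?N). \<sigma> (\<Phi> C x) = \<alpha> g (\<xi> C x)}"
          have "openin (subtopology (disc (d C)) ?N) ?A"
            by (rule openin_lifts_agree[OF covering c1 continuous_map_from_subtopology[OF c2']])
              (use V(5) \<pi>cell[OF g(1) C(1)] in auto)
          then have opA: "openin (disc (d C)) ?A" using openin_trans_full[OF _ opN] by blast
          let ?B = "topspace (disc (d C)) - {x \<in> topspace (disc (d C)). \<alpha> g (\<xi> C x) \<in> S}"
          have "openin (disc (d C)) ?B"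
            by (rule openin_diff[OF openin_topspace 5(2)[OF C(1) g(1) C(2)]])
          then have "openin (disc (d C)) (?A \<inter> ?B)" by (rule openin_Int[OF opA])
          moreover have "x0 \<in> ?A \<inter> ?B" using x0 g(2) by auto
          moreover have "?A \<inter> ?B \<subseteq> ?O" by auto
          ultimately show ?thesis by (intro exI[of _ "?A \<inter> ?B"] conjI)
        qed
        then have "openin (disc (d C)) ?O" by (intro openin_subopen[THEN iffD2] ballI)
        then have "closedin (disc (d C)) (topspace (disc (d C)) - ?O)" by blast
        moreover have "{x \<in> topspace (disc (d C)). \<Phi> C x \<in> L} = topspace (disc (d C)) - ?O"
          using closed_cell_subset_skel[OF C] by (auto simp: L_def)
        ultimately show "closedin (disc (d C)) {x \<in> topspace (disc (d C)). \<Phi> C x \<in> L}" by simp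
      qed
      then have opUL: "openin Y (U - L)" by (rule openin_diff[OF U(1)])
      let ?T = "V \<inter> {v \<in> topspace P. \<pi> v \<in> U - L}"
      have "openin P ?T"
        by (rule openin_Int[OF V(1) openin_continuous_map_preimage[OF covering_map_imp_continuous[OF covering] opUL]])
      moreover have "z \<in> ?T" using z V(2,4) U(2) by (auto simp: L_def)
      moreover have "?T \<subseteq> topspace P - S"
      proof
        fix v assume v: "v \<in> ?T"
        have "v \<notin> S"
        proof
          assume "v \<in> S"
          then have "\<pi> v \<in> L" using low[of v k] 5(1) v V(4) by (auto simp: L_def)
          then show False using v by blast
        qed
        then show "v \<in> topspace P - S" using v by blast
      qed
      ultimately show ?thesis by (intro exI[of _ ?T] conjI)
    qed
    then have "openin P (topspace P - S)" by (intro openin_subopen[THEN iffD2] ballI)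
    then show ?case using SP by (simp add: closedin_def)
  qed
  then show ?thesis by blast
qed

text \<open>A translation of a \<open>G\<close>-CW complex permutes the open cells but need not carry one characteristic map
  to another. That it permutes the closed cells follows by describing them as closures.\<close>

lemma disc_closure_open_disc: "topspace (disc n) \<subseteq> disc n closure_of topspace (open_disc n)"
proof
  fix x assume x: "x \<in> topspace (disc n)"
  show "x \<in> disc n closure_of topspace (open_disc n)"
    unfolding in_closure_of
  proof (intro conjI allI impI)
    fix T assume T: "x \<in> T \<and> openin (disc n) T"
    have c: "continuous_map (top_of_set {0..1}) (disc n) (\<lambda>t. (\<lambda>i. t * x i))"
    proof -
      have "(\<lambda>i. t * x i) \<in> topspace (disc n)" if "t \<in> {0..1}" for t
      proof -
        have "t * radius n x \<le> 1 * 1"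
          using x that radius_nonneg[of n x] by (intro mult_mono) (auto simp: in_disc_iff)
        then show ?thesis using x that by (auto simp: in_disc_iff radius_mult)
      qed
      moreover have "continuous_on {0..1} (\<lambda>t::real. (\<lambda>i. t * x i))"
        by (intro continuous_on_coordinatewise_then_product continuous_intros)
      ultimately have "continuous_map (top_of_set {0..1}) (top_of_set (topspace (disc n))) (\<lambda>t::real. (\<lambda>i. t * x i))"
        by auto
      then show ?thesis by (simp add: disc_top_of_set)
    qed
    have "openin (top_of_set {0..1}) {t \<in> topspace (top_of_set {0..1}). (\<lambda>i. t * x i) \<in> T}"
      using openin_continuous_map_preimage[OF c] T by blast
    moreover have "1 \<in> {t \<in> topspace (top_of_set {0..1::real}). (\<lambda>i. t * x i) \<in> T}" using T by simp
    ultimately obtain e where e: "e > 0"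
      "\<And>t. t \<in> {0..1} \<Longrightarrow> dist t 1 < e \<Longrightarrow> t \<in> {t \<in> topspace (top_of_set {0..1::real}). (\<lambda>i. t * x i) \<in> T}"
      unfolding openin_euclidean_subtopology_iff by meson
    define t where "t = max 0 (1 - e / 2)"
    have t: "0 \<le> t" "t < 1" "dist t 1 < e" using e(1) by (auto simp: t_def dist_real_def max_def)
    have "t * radius n x \<le> t * 1" using x t by (intro mult_left_mono) (auto simp: in_disc_iff)
    then have "(\<lambda>i. t * x i) \<in> topspace (open_disc n)"
      using x t by (auto simp: in_disc_iff in_open_disc_iff radius_mult)
    moreover have "(\<lambda>i. t * x i) \<in> T" using e(2)[of t] t by simp
    ultimately show "\<exists>y. y \<in> topspace (open_disc n) \<and> y \<in> T" by blast
  qed (rule x)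
qed

lemma (in cw) closed_cell_closure:
  assumes "C \<in> \<C>" shows "closed_cell C = X closure_of C"
proof
  have "\<Phi> C ` topspace (disc (d C)) \<subseteq> \<Phi> C ` (disc (d C) closure_of topspace (open_disc (d C)))"
    using disc_closure_open_disc by blast
  also have "\<dots> \<subseteq> X closure_of (\<Phi> C ` topspace (open_disc (d C)))"
    by (rule continuous_map_image_closure_subset[OF char_continuous[OF assms]])
  finally show "closed_cell C \<subseteq> X closure_of C" by (simp add: char_image[OF assms])
  show "X closure_of C \<subseteq> closed_cell C"
    using closure_of_minimal[OF _ closedin_closed_cell[OF assms]] closed_cell_eq[OF assms] by blast
qed

lemma (in continuous_action) homeomorphic_map_act:
  assumes g: "g \<in> carrier G" shows "homeomorphic_map Z Z (\<alpha> g)"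
  unfolding homeomorphic_map_maps
proof (intro exI[of _ "\<alpha> (inv g)"])
  show "homeomorphic_maps Z Z (\<alpha> g) (\<alpha> (inv g))"
    unfolding homeomorphic_maps_def using g act_continuous act_inv act_inv' by auto
qed

lemma continuous_action_G_space:
  assumes "G_space G E \<alpha>" shows "continuous_action G E \<alpha>"
proof -
  interpret A: group_action G "topspace E" \<alpha> using assms by (simp add: G_space_def)
  interpret group G by (rule A.group_hom[THEN group_hom.axioms(1)])
  show ?thesis
  proof unfold_locales
    show "continuous_map E E (\<alpha> g)" if "g \<in> carrier G" for g
      using assms that by (simp add: G_space_def)
    show "\<alpha> \<one>\<^bsub>G\<^esub> z = z" if "z \<in> topspace E" for z
      using A.id_eq_one that by (metis restrict_apply')
    show "\<alpha> (g \<otimes>\<^bsub>G\<^esub> h) z = \<alpha> g (\<alpha> h z)"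
      if "g \<in> carrier G" "h \<in> carrier G" "z \<in> topspace E" for g h z
      using A.composition_rule that by blast
  qed
qed

text \<open>The indices are representatives of the orbits of cells. Choosing a representative by the orbit
  alone makes the choice invariant under translation. An element that maps a cell to itself fixes its
  points and is therefore trivial, so each cell is a translate of its representative in one way.\<close>

lemma free_cells_EG:
  fixes E :: "'e topology"
  assumes E: "is_EG G E \<alpha>"
  shows "\<exists>(R :: 'e set set) n \<xi>. free_cells G E \<alpha> R n \<xi>"
proof -
  interpret continuous_action G E \<alpha>
    using E continuous_action_G_space by (auto simp: is_EG_def G_CW_complex_def)
  obtain \<C> d \<Phi> where cwE: "CW_structure E \<C> d \<Phi>"
    and perm': "\<forall>g\<in>carrier G. \<forall>C\<in>\<C>. \<alpha> g ` C \<in> \<C> \<and> d (\<alpha> g ` C) = d C \<and>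
           (\<alpha> g ` C = C \<longrightarrow> (\<forall>x\<in>C. \<alpha> g x = x))"
    using E unfolding is_EG_def G_CW_complex_def by (elim exE conjE)
  note perm = perm'[rule_format]
  interpret cw E \<C> d \<Phi> by unfold_locales (rule cwE)
  have free: "g = \<one>\<^bsub>G\<^esub>" if "g \<in> carrier G" "x \<in> topspace E" "\<alpha> g x = x" for g x
    using E that unfolding is_EG_def by blast
  have cellE: "C \<subseteq> topspace E" if "C \<in> \<C>" for C using cells_cover that by blast
  have act_image: "\<alpha> g ` \<alpha> h ` C = \<alpha> (g \<otimes>\<^bsub>G\<^esub> h) ` C"
    if "g \<in> carrier G" "h \<in> carrier G" "C \<in> \<C>" for g h C
    unfolding image_image using act_mult[OF that(1,2)] cellE[OF that(3)] by (intro image_cong) auto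
  have act_image_one: "\<alpha> \<one>\<^bsub>G\<^esub> ` C = C" if "C \<in> \<C>" for C
    using act_one cellE[OF that] by (auto simp: image_iff subset_iff)
  define orb where "orb C = {\<alpha> g ` C |g. g \<in> carrier G}" for C
  have orb_self: "C \<in> orb C" if "C \<in> \<C>" for C
    using act_image_one[OF that] unfolding orb_def by force
  have orb_act: "orb (\<alpha> h ` C) = orb C" if h: "h \<in> carrier G" and C: "C \<in> \<C>" for h C
  proof
    show "orb (\<alpha> h ` C) \<subseteq> orb C"
    proof
      fix B assume "B \<in> orb (\<alpha> h ` C)"
      then obtain g where g: "g \<in> carrier G" "B = \<alpha> g ` \<alpha> h ` C" by (auto simp: orb_def)
      then have "B = \<alpha> (g \<otimes>\<^bsub>G\<^esub> h) ` C" using act_image[OF g(1) h C] by simp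
      then show "B \<in> orb C" unfolding orb_def using m_closed[OF g(1) h] by blast
    qed
    show "orb C \<subseteq> orb (\<alpha> h ` C)"
    proof
      fix B assume "B \<in> orb C"
      then obtain g where g: "g \<in> carrier G" "B = \<alpha> g ` C" by (auto simp: orb_def)
      have "\<alpha> (g \<otimes>\<^bsub>G\<^esub> inv\<^bsub>G\<^esub> h) ` \<alpha> h ` C = \<alpha> (g \<otimes>\<^bsub>G\<^esub> inv\<^bsub>G\<^esub> h \<otimes>\<^bsub>G\<^esub> h) ` C"
        using g h C by (intro act_image) auto
      also have "\<dots> = B" using g h by (simp add: m_assoc)
      finally have "B = \<alpha> (g \<otimes>\<^bsub>G\<^esub> inv\<^bsub>G\<^esub> h) ` \<alpha> h ` C" by (rule sym)
      then show "B \<in> orb (\<alpha> h ` C)" unfolding orb_def using m_closed[OF g(1) inv_closed[OF h]] by blast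
    qed
  qed
  define rep where "rep C = (SOME B. B \<in> orb C)" for C
  have rep_orb: "rep C \<in> orb C" if "C \<in> \<C>" for C
    unfolding rep_def using orb_self[OF that] by (rule someI)
  have rep_act: "rep (\<alpha> h ` C) = rep C" if "h \<in> carrier G" "C \<in> \<C>" for h C
    unfolding rep_def orb_act[OF that] ..
  have rep: "\<exists>g\<in>carrier G. rep C = \<alpha> g ` C" if "C \<in> \<C>" for C
    using rep_orb[OF that] by (auto simp: orb_def)
  have rep_in: "rep C \<in> \<C>" "d (rep C) = d C" "rep (rep C) = rep C" if C: "C \<in> \<C>" for C
    using rep[OF C] perm[OF _ C] rep_act[OF _ C] by auto
  have from_rep: "\<exists>g\<in>carrier G. C = \<alpha> g ` rep C" if C: "C \<in> \<C>" for C
  proof -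
    obtain g where g: "g \<in> carrier G" "rep C = \<alpha> g ` C" using rep[OF C] by blast
    have "\<alpha> (inv\<^bsub>G\<^esub> g) ` rep C = C"
      using act_image[OF inv_closed[OF g(1)] g(1) C] act_image_one[OF C] g by simp
    then show ?thesis using g(1) inv_closed by metis
  qed
  define R where "R = rep ` \<C>"
  have RC: "r \<in> \<C>" "rep r = r" if "r \<in> R" for r using that rep_in by (auto simp: R_def)
  have open_in: "x \<in> topspace (open_disc m) \<Longrightarrow> x \<in> topspace (disc m)" for x m
    using topspace_disc_Un by blast
  have \<Phi>E: "\<Phi> r x \<in> topspace E" if "r \<in> R" "x \<in> topspace (disc (d r))" for r x
    using continuous_map_in_topspace[OF char_continuous[OF RC(1)[OF that(1)]] that(2)] .
  have hit: "\<exists>g\<in>carrier G. \<exists>x\<in>topspace (open_disc (d (rep C))). z = \<alpha> g (\<Phi> (rep C) x)"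
    if C: "C \<in> \<C>" "z \<in> C" for C z
  proof -
    obtain g where g: "g \<in> carrier G" "C = \<alpha> g ` rep C" using from_rep[OF C(1)] by blast
    then obtain w where w: "w \<in> rep C" "z = \<alpha> g w" using C(2) by blast
    then obtain x where "x \<in> topspace (open_disc (d (rep C)))" "w = \<Phi> (rep C) x"
      using char_image[OF rep_in(1)[OF C(1)]] by blast
    then show ?thesis using g w by blast
  qed
  have "free_cells G E \<alpha> R d \<Phi>"
  proof (unfold_locales, goal_cases)
    case (1 r) then show ?case using char_continuous RC(1) by blast
  next
    case (2 z)
    then obtain C where C: "C \<in> \<C>" "z \<in> C" using cells_cover by blast
    then show ?case using hit[OF C] by (auto simp: R_def)
  next
    case (3 g g' r r' x x')
    note r = RC(1)[OF 3(3)] and r' = RC(1)[OF 3(4)]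
    note w = \<Phi>E[OF 3(3) open_in[OF 3(5)]] and w' = \<Phi>E[OF 3(4) open_in[OF 3(6)]]
    have "\<alpha> g (\<Phi> r x) \<in> \<alpha> g ` r" by (rule imageI[OF char_in_cell[OF r 3(5)]])
    moreover have "\<alpha> g (\<Phi> r x) \<in> \<alpha> g' ` r'"
      unfolding 3(7) by (rule imageI[OF char_in_cell[OF r' 3(6)]])
    ultimately have eq: "\<alpha> g ` r = \<alpha> g' ` r'"
      using cells_disjoint[of "\<alpha> g ` r" "\<alpha> g' ` r'"] perm[OF 3(1) r] perm[OF 3(2) r'] by simp
    have rr: "r = r'"
      using rep_act[OF 3(1) r] rep_act[OF 3(2) r'] eq RC(2)[OF 3(3)] RC(2)[OF 3(4)] by simp
    have ginv: "inv\<^bsub>G\<^esub> g' \<otimes>\<^bsub>G\<^esub> g \<in> carrier G" using 3(1,2) by simp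
    have "\<alpha> (inv\<^bsub>G\<^esub> g' \<otimes>\<^bsub>G\<^esub> g) ` r = \<alpha> (inv\<^bsub>G\<^esub> g') ` \<alpha> g' ` r"
      using act_image[OF inv_closed[OF 3(2)] 3(1) r] eq rr by simp
    also have "\<dots> = r" using act_image[OF inv_closed[OF 3(2)] 3(2) r] act_image_one[OF r] 3(2) by simp
    finally have "\<alpha> (inv\<^bsub>G\<^esub> g' \<otimes>\<^bsub>G\<^esub> g) (\<Phi> r x) = \<Phi> r x"
      using perm[OF ginv r] char_in_cell[OF r 3(5)] by blast
    then have one: "inv\<^bsub>G\<^esub> g' \<otimes>\<^bsub>G\<^esub> g = \<one>\<^bsub>G\<^esub>" by (rule free[OF ginv w])
    have "g = g' \<otimes>\<^bsub>G\<^esub> (inv\<^bsub>G\<^esub> g' \<otimes>\<^bsub>G\<^esub> g)"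
      by (simp only: m_assoc[symmetric, OF 3(2) inv_closed[OF 3(2)] 3(1)] r_inv[OF 3(2)] l_one[OF 3(1)])
    also have "\<dots> = g'" by (simp only: one r_one[OF 3(2)])
    finally have gg: "g = g'" .
    have "\<Phi> r x = \<alpha> (inv\<^bsub>G\<^esub> g) (\<alpha> g (\<Phi> r x))" by (rule act_inv[OF 3(1) w, symmetric])
    also have "\<dots> = \<alpha> (inv\<^bsub>G\<^esub> g') (\<alpha> g' (\<Phi> r' x'))" by (simp only: 3(7)) (simp only: gg)
    also have "\<dots> = \<Phi> r' x'" by (rule act_inv[OF 3(2) w'])
    finally have "x = x'" using char_inj[OF r] 3(5,6) rr by (auto simp: inj_on_def)
    then show ?case using gg rr by simp
  next
    case (4 r x)
    obtain B where B: "B \<in> \<C>" "d B < d r" "\<Phi> r x \<in> B"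
      using char_boundary[OF RC(1)[OF 4(1)] 4(2)] by (auto simp: skel_def)
    obtain g x' where "g \<in> carrier G" "x' \<in> topspace (open_disc (d (rep B)))" "\<Phi> r x = \<alpha> g (\<Phi> (rep B) x')"
      using hit[OF B(1,3)] by blast
    then show ?case
      using B rep_in(2)[OF B(1)] by (intro bexI[of _ g] bexI[of _ "rep B"] bexI[of _ x'] conjI) (auto simp: R_def)
  next
    case (5 S k)
    have "S \<subseteq> skel k"
    proof
      fix z assume "z \<in> S"
      then obtain g r x where z: "g \<in> carrier G" "r \<in> R" "x \<in> topspace (open_disc (d r))" "enat (d r) < k"
        "z = \<alpha> g (\<Phi> r x)" using 5(1) unfolding orbit_skeleton_def by blast
      then have "z \<in> \<alpha> g ` r" "\<alpha> g ` r \<in> \<C>" "d (\<alpha> g ` r) = d r"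
        using char_in_cell[OF RC(1)[OF z(2)] z(3)] perm[OF z(1) RC(1)[OF z(2)]] by auto
      then show "z \<in> skel k" using z(4) unfolding skel_def by auto
    qed
    then show ?case
    proof (rule closedin_weak)
      fix C assume C: "C \<in> \<C>" "enat (d C) < k"
      obtain g where g: "g \<in> carrier G" "C = \<alpha> g ` rep C" using from_rep[OF C(1)] by blast
      have r: "rep C \<in> R" "rep C \<in> \<C>" "enat (d (rep C)) < k" using rep_in[OF C(1)] C by (auto simp: R_def)
      have "closed_cell C = E closure_of (\<alpha> g ` rep C)" using closed_cell_closure[OF C(1)] g(2) by simp
      also have "\<dots> = \<alpha> g ` (E closure_of rep C)"
        by (rule homeomorphic_map_closure_of[OF homeomorphic_map_act[OF g(1)] cellE[OF r(2)]])
      also have "\<dots> = \<alpha> g ` closed_cell (rep C)" using closed_cell_closure[OF r(2)] by simp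
      finally have eq: "S \<inter> closed_cell C =
          (\<lambda>x. \<alpha> g (\<Phi> (rep C) x)) ` {x \<in> topspace (disc (d (rep C))). \<alpha> g (\<Phi> (rep C) x) \<in> S}" by auto
      have cont: "continuous_map (disc (d (rep C))) E (\<lambda>x. \<alpha> g (\<Phi> (rep C) x))"
        using continuous_map_compose[OF char_continuous[OF r(2)] act_continuous[OF g(1)]] by (simp add: o_def)
      show "closedin E (S \<inter> closed_cell C)"
        unfolding eq
        by (rule compactin_imp_closedin[OF hausdorff image_compactin[OF
              closedin_compact_space[OF compact_space_disc 5(2)[OF r(1) g(1) r(3)]] cont]])
    qed
  qed
  then show ?thesis by blast
qed


section \<open>Filling spheres\<close>

lemma sphere_top_of_set: "subtopology (disc n) (disc_boundary n) = top_of_set (disc_boundary n)"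
  unfolding disc_top_of_set subtopology_subtopology
  by (rule arg_cong[where f = top_of_set]) (auto simp: disc_boundary_eq)

text \<open>The disc is the quotient of the cylinder over its bounding sphere that collapses one end to the
  centre; a null-homotopy is a map on the cylinder that is constant on that end.\<close>

lemma null_homotopic_imp_fills:
  assumes n: "0 < n"
    and hom: "homotopic_with (\<lambda>_. True) (subtopology (disc n) (disc_boundary n)) W f (\<lambda>_. a)"
  obtains F where "continuous_map (disc n) W F" "\<And>x. x \<in> disc_boundary n \<Longrightarrow> F x = f x"
proof -
  let ?B = "disc_boundary n"
  obtain h where h: "continuous_map (top_of_set ({0..1::real} \<times> ?B)) W h"
    "\<And>x. h (0, x) = f x" "\<And>x. h (1, x) = a"
    using hom unfolding homotopic_with_def sphere_top_of_set prod_topology_top_of_set by auto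
  let ?m = "\<lambda>(t::real, x). (\<lambda>i::nat. (1 - t) * x i :: real)"
  have B: "radius n x = 1" "\<forall>i\<ge>n. x i = 0" if "x \<in> ?B" for x
    using that by (auto simp: in_disc_boundary_iff)
  have rad: "radius n (?m (t, x)) = 1 - t" if "t \<in> {0..1}" "x \<in> ?B" for t x
    using that B by (simp add: radius_mult)
  have cont: "continuous_on ({0..1} \<times> ?B) ?m"
    unfolding split_def
    by (intro continuous_on_coordinatewise_then_product continuous_on_mult continuous_on_diff
        continuous_on_const continuous_on_fst continuous_on_id
        continuous_on_product_then_coordinatewise[OF continuous_on_snd[OF continuous_on_id]])
  have im: "?m ` ({0..1} \<times> ?B) = topspace (disc n)"
  proof
    show "?m ` ({0..1} \<times> ?B) \<subseteq> topspace (disc n)"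
      using rad B by (auto simp: in_disc_iff)
    show "topspace (disc n) \<subseteq> ?m ` ({0..1} \<times> ?B)"
    proof
      fix x assume x: "x \<in> topspace (disc n)"
      show "x \<in> ?m ` ({0..1} \<times> ?B)"
      proof (cases "radius n x = 0")
        case True
        then have "x i = 0" for i
          using x by (cases "i < n") (auto simp: radius_def sum_nonneg_eq_0_iff in_disc_iff)
        moreover have "(\<lambda>i. if i = 0 then 1 else 0) \<in> ?B"
          using n by (auto simp: disc_boundary_eq if_distrib[of "\<lambda>x. x\<^sup>2"] cong: if_cong)
        ultimately show ?thesis by (intro image_eqI[of _ _ "(1, \<lambda>i. if i = 0 then 1 else 0)"]) auto
      next
        case False
        then have pos: "0 < radius n x" using radius_nonneg[of n x] by simp
        have "(\<lambda>i. (1 / radius n x) * x i) \<in> ?B"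
          unfolding in_disc_boundary_iff radius_mult using x pos by (simp add: in_disc_iff)
        moreover have "1 - radius n x \<in> {0..1}" using x pos by (simp add: in_disc_iff)
        ultimately show ?thesis
          using pos by (intro image_eqI[of _ _ "(1 - radius n x, \<lambda>i. (1 / radius n x) * x i)"]) auto
      qed
    qed
  qed
  have D: "disc n = top_of_set (topspace (disc n))" by (simp add: disc_top_of_set)
  have q: "quotient_map (top_of_set ({0..1} \<times> ?B)) (disc n) ?m"
  proof (rule T1_Spaces.continuous_imp_quotient_map)
    have "continuous_map (top_of_set ({0..1} \<times> ?B)) (top_of_set (topspace (disc n))) ?m"
      using cont im by auto
    then show "continuous_map (top_of_set ({0..1} \<times> ?B)) (disc n) ?m" by (simp only: D[symmetric])
    have "compact ?B"
      using compactin_disc_boundary[of n] unfolding compactin_subtopology disc_top_of_set by simp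
    then have "compact ({0..1::real} \<times> ?B)" by (intro compact_Times) auto
    then show "compact_space (top_of_set ({0..1::real} \<times> ?B))"
      by (intro compact_space_subtopology) simp
    show "Hausdorff_space (disc n)" by (simp add: disc_top_of_set Hausdorff_space_subtopology)
    show "?m ` topspace (top_of_set ({0..1} \<times> ?B)) = topspace (disc n)" using im by simp
  qed
  have resp: "h u = h v"
    if uv: "u \<in> topspace (top_of_set ({0..1} \<times> ?B))" "v \<in> topspace (top_of_set ({0..1} \<times> ?B))" "?m u = ?m v" for u v
  proof -
    obtain t x s y where e: "u = (t, x)" "v = (s, y)" by (metis surj_pair)
    have in': "t \<in> {0..1}" "x \<in> ?B" "s \<in> {0..1}" "y \<in> ?B" using uv(1,2) e by auto
    have "t = s" using rad[OF in'(1,2)] rad[OF in'(3,4)] uv(3) e by simp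
    moreover have "x = y" if "t \<noteq> 1"
    proof
      fix i show "x i = y i" using fun_cong[OF uv(3), of i] e \<open>t = s\<close> that by simp
    qed
    ultimately show ?thesis using e h(3) by (cases "t = 1") auto
  qed
  show thesis
  proof (rule quotient_map_lift_exists[OF q h(1) resp])
    fix F assume F: "continuous_map (disc n) W F"
      "\<And>u. u \<in> topspace (top_of_set ({0..1} \<times> ?B)) \<Longrightarrow> F (?m u) = h u"
    show thesis
    proof (rule that[OF F(1)])
      fix x assume "x \<in> ?B"
      then show "F x = f x" using F(2)[of "(0, x)"] h(2) by simp
    qed
  qed
qed

lemma fills_spheresI:
  assumes "topspace W \<noteq> {}"
    and "\<And>n f. 0 < n \<Longrightarrow> continuous_map (subtopology (disc n) (disc_boundary n)) W f \<Longrightarrow>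
      \<exists>F. continuous_map (disc n) W F \<and> (\<forall>x\<in>disc_boundary n. F x = f x)"
  shows "fills_spheres W"
  unfolding fills_spheres_def
proof (intro allI impI)
  fix n f assume f: "continuous_map (subtopology (disc n) (disc_boundary n)) W f"
  show "\<exists>F. continuous_map (disc n) W F \<and> (\<forall>x\<in>disc_boundary n. F x = f x)"
  proof (cases "n = 0")
    case True
    obtain w where "w \<in> topspace W" using assms(1) by blast
    then show ?thesis using True by (intro exI[of _ "\<lambda>_. w"]) (simp add: disc_boundary_eq)
  qed (use assms(2) f in simp)
qed

lemma fills_spheres_contractible:
  assumes "contractible_space W" "topspace W \<noteq> {}" shows "fills_spheres W"
proof (rule fills_spheresI[OF assms(2)])
  fix n :: nat and f
  assume n: "0 < n" and f: "continuous_map (subtopology (disc n) (disc_boundary n)) W f"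
  obtain a where "homotopic_with (\<lambda>_. True) (subtopology (disc n) (disc_boundary n)) W f (\<lambda>_. a)"
    using nullhomotopic_into_contractible_space[OF f assms(1)] .
  from null_homotopic_imp_fills[OF n this]
  show "\<exists>F. continuous_map (disc n) W F \<and> (\<forall>x\<in>disc_boundary n. F x = f x)" by metis
qed

lemma nsphere_eq: "nsphere m = subtopology (disc (Suc m)) (disc_boundary (Suc m))"
  unfolding sphere_top_of_set
  by (simp add: disc_boundary_eq nsphere_def Euclidean_space_top_of_set subtopology_subtopology Collect_conj_eq
      lessThan_Suc_atMost)

lemma connected_space_nsphere:
  assumes "0 < m" shows "connected_space (nsphere m)"
proof -
  let ?A = "topspace (nsphere m) \<inter> {x. x 0 \<ge> 0}" and ?B = "topspace (nsphere m) \<inter> {x. x 0 \<le> 0}"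
  have "connectedin (nsphere m) ?A" "connectedin (nsphere m) ?B"
    using contractible_imp_connected_space[OF contractible_space_upper_hemisphere[of 0 m]]
      contractible_imp_connected_space[OF contractible_space_lower_hemisphere[of 0 m]]
    by (simp_all add: connectedin_def subtopology_restrict)
  moreover have "(\<lambda>i. if i = 1 then 1 else 0) \<in> ?A \<inter> ?B"
    using assms by (auto simp: nsphere_eq topspace_disc disc_boundary_eq if_distrib[of "\<lambda>x. x\<^sup>2"] cong: if_cong)
  ultimately have "connectedin (nsphere m) (?A \<union> ?B)" by (intro connectedin_Un) blast+
  moreover have "?A \<union> ?B = topspace (nsphere m)" by auto
  ultimately show ?thesis by (simp add: connectedin_topspace)
qed

text \<open>Above dimension one, a null-homotopy in the base lifts to one that ends over a point, hence at a
  point.\<close>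

lemma covering_fills_high_spheres:
  assumes p: "covering_map P Y \<pi>" and triv: "\<And>n z. n \<ge> 2 \<Longrightarrow> z \<in> topspace Y \<Longrightarrow> trivial_homotopy_group n Y z"
    and n: "n \<ge> 3" and f: "continuous_map (subtopology (disc n) (disc_boundary n)) P f"
  shows "\<exists>F. continuous_map (disc n) P F \<and> (\<forall>x\<in>disc_boundary n. F x = f x)"
proof -
  obtain m where m: "n = Suc m" "m \<ge> 2" using n by (cases n) auto
  have f: "continuous_map (nsphere m) P f" using f m(1) by (simp add: nsphere_eq)
  have base: "sphere_base \<in> topspace (nsphere m)"
    using in_topspace_nsphere[of m] by (simp add: sphere_base_def)
  have \<pi>f: "continuous_map (nsphere m) Y (\<pi> \<circ> f)"
    by (rule continuous_map_compose[OF f covering_map_imp_continuous[OF p]])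
  let ?y = "\<pi> (f sphere_base)"
  have "trivial_homotopy_group m Y ?y"
    using triv[OF m(2)] continuous_map_in_topspace[OF \<pi>f base] by simp
  then have "homotopic_with (\<lambda>h. h sphere_base = ?y) (nsphere m) Y (\<pi> \<circ> f) (\<lambda>_. ?y)"
    using \<pi>f by (simp add: trivial_homotopy_group_def)
  then obtain h where h: "continuous_map (prod_topology (top_of_set {0..1::real}) (nsphere m)) Y h"
    "\<And>x. h (0, x) = \<pi> (f x)" "\<And>x. h (1, x) = ?y"
    unfolding homotopic_with_def by auto
  show ?thesis
  proof (rule covering_map_lift_homotopy[OF p h(1) f])
    show "\<pi> (f x) = h (0, x)" if "x \<in> topspace (nsphere m)" for x using h(2) by simp
    fix H assume H: "continuous_map (prod_topology (top_of_set {0..1::real}) (nsphere m)) P H"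
      "\<And>t x. t \<in> {0..1} \<Longrightarrow> x \<in> topspace (nsphere m) \<Longrightarrow> \<pi> (H (t, x)) = h (t, x)"
      "\<And>x. x \<in> topspace (nsphere m) \<Longrightarrow> H (0, x) = f x"
    have end_cont: "continuous_map (nsphere m) P (\<lambda>x. H (1, x))"
      using continuous_map_o_Pair[OF H(1), of 1] by (simp add: o_def)
    let ?a = "H (1, sphere_base)"
    have a: "?a \<in> topspace P" using continuous_map_in_topspace[OF end_cont base] .
    have const: "H (1, x) = ?a" if x: "x \<in> topspace (nsphere m)" for x
      using lifts_equal[OF p end_cont, of "\<lambda>_. ?a" sphere_base x] a H(2)[of 1] base x h(3)
        connected_space_nsphere[of m] m(2) by simp
    have "homotopic_with (\<lambda>_. True) (nsphere m) P (\<lambda>x. H (0, x)) (\<lambda>x. H (1, x))"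
      unfolding homotopic_with_def using H(1) by (intro exI[of _ H]) simp
    then have "homotopic_with (\<lambda>_. True) (nsphere m) P f (\<lambda>_. ?a)"
      by (rule homotopic_with_eq) (use H(3) const in auto)
    then have hom: "homotopic_with (\<lambda>_. True) (subtopology (disc n) (disc_boundary n)) P f (\<lambda>_. ?a)"
      by (simp add: nsphere_eq m(1))
    show ?thesis
      by (rule null_homotopic_imp_fills[OF _ hom]) (use n in auto)
  qed
qed

lemma path_connected_fills_0_sphere:
  assumes W: "path_connected_space W" and f: "continuous_map (subtopology (disc 1) (disc_boundary 1)) W f"
  shows "\<exists>F. continuous_map (disc 1) W F \<and> (\<forall>x\<in>disc_boundary 1. F x = f x)"
proof -
  let ?e = "\<lambda>s::real. (\<lambda>i::nat. if i = 0 then s else 0)"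
  have B: "x \<in> disc_boundary 1 \<longleftrightarrow> x = ?e 1 \<or> x = ?e (-1)" for x
  proof
    assume x: "x \<in> disc_boundary 1"
    then have "(x 0)\<^sup>2 = 1" "\<And>i. i \<noteq> 0 \<Longrightarrow> x i = 0" by (auto simp: disc_boundary_eq)
    then show "x = ?e 1 \<or> x = ?e (-1)" by (auto simp: power2_eq_1_iff fun_eq_iff)
  qed (auto simp: disc_boundary_eq)
  have fe: "f (?e s) \<in> topspace W" if "s = 1 \<or> s = -1" for s
    using continuous_map_in_topspace[OF f, of "?e s"] B[of "?e s"] that
    by (auto simp: topspace_disc disc_boundary_eq)
  obtain c where c: "pathin W c" "c 0 = f (?e (-1))" "c 1 = f (?e 1)"
    using W[unfolded path_connected_space_def, rule_format, of "f (?e (-1))" "f (?e 1)"]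
      fe[of 1] fe[of "-1"] by blast
  have "continuous_on (topspace (disc 1)) (\<lambda>x::nat \<Rightarrow> real. (x 0 + 1) / 2)"
    by (intro continuous_on_divide continuous_on_add continuous_on_const
        continuous_on_product_then_coordinatewise[OF continuous_on_id]) auto
  moreover have "(x 0 + 1) / 2 \<in> {0..1}" if "x \<in> topspace (disc 1)" for x
  proof -
    have "(x 0)\<^sup>2 \<le> 1" using that by (simp add: topspace_disc)
    then have "\<bar>x 0\<bar> \<le> 1" using abs_square_le_1 by blast
    then show ?thesis by (auto simp: abs_le_iff)
  qed
  ultimately have "continuous_map (top_of_set (topspace (disc 1))) W (\<lambda>x. c ((x 0 + 1) / 2))"
    by (intro continuous_map_top_of_set_compose[OF c(1)[unfolded pathin_def]]) auto
  then have "continuous_map (disc 1) W (\<lambda>x. c ((x 0 + 1) / 2))" by (simp add: disc_top_of_set)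
  then show ?thesis using c(2,3) B by (intro exI[of _ "\<lambda>x. c ((x 0 + 1) / 2)"]) auto
qed

text \<open>The disc of dimension two as a quotient of the square in polar coordinates, with radius
  \<open>1 - t\<close> and angle \<open>2 \<pi> s\<close>.\<close>

lemma null_homotopic_loop_fills_circle:
  fixes W :: "'w topology"
  assumes hom: "path_homotopic W
      (\<lambda>s. f (\<lambda>i::nat. if i = 0 then cos (2 * pi * s) else if i = 1 then sin (2 * pi * s) else (0::real))) (\<lambda>_. a)"
  shows "\<exists>F. continuous_map (disc 2) W F \<and> (\<forall>x\<in>disc_boundary 2. F x = f x)"
proof -
  define e where "e s = (\<lambda>i::nat. if i = 0 then cos (2 * pi * s) else if i = 1 then sin (2 * pi * s) else (0::real))" for s :: real
  have hom': "path_homotopic W (\<lambda>s. f (e s)) (\<lambda>_. a)" using hom by (simp only: e_def)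
  have circ: "f (e 0) = a" "f (e 1) = a"
    using path_homotopic_ends[OF hom'] by metis+
  obtain h :: "real \<times> real \<Rightarrow> 'w" where h: "continuous_map (top_of_set ({0..1} \<times> {0..1})) W h"
    "\<forall>s\<in>{0..1}. h (0, s) = f (e s)" "\<forall>s\<in>{0..1}. h (1, s) = a" "\<forall>t\<in>{0..1}. h (t, 0) = a \<and> h (t, 1) = a"
    using hom' circ unfolding path_homotopic_iff by auto
  let ?Q = "{0..1::real} \<times> {0..1::real}"
  let ?m = "\<lambda>(t::real, s::real). (\<lambda>i. (1 - t) * e s i)"
  have sum2: "(\<Sum>i<2. (x i)\<^sup>2) = (x 0)\<^sup>2 + (x 1)\<^sup>2" for x :: "nat \<Rightarrow> real"
    by (simp add: numeral_2_eq_2)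
  have rad_e: "radius 2 (e s) = 1" for s unfolding radius_def sum2 by (simp add: e_def)
  have e_high: "e s i = 0" if "i \<ge> 2" for s i using that by (simp add: e_def)
  have rad: "radius 2 (?m (t, s)) = 1 - t" if "t \<in> {0..1}" for t s
    using that by (simp add: radius_mult rad_e)
  have polar: "\<exists>s\<in>{0..1}. x = e s" if x: "x \<in> disc_boundary 2" for x
  proof -
    have "(x 0)\<^sup>2 + (x 1)\<^sup>2 = 1" using x by (simp add: disc_boundary_eq sum2)
    then obtain t where t: "0 \<le> t" "t \<le> 2 * pi" "x 0 = cos t" "x 1 = sin t"
      using sincos_total_2pi_le by blast
    have "x i = e (t / (2 * pi)) i" for i
    proof (cases "i \<ge> 2")
      case True then show ?thesis using x e_high by (simp add: disc_boundary_eq)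
    next
      case False
      then have "i = 0 \<or> i = 1" by auto
      then show ?thesis using t by (auto simp: e_def)
    qed
    then show ?thesis using t by (intro bexI[of _ "t / (2 * pi)"]) (auto simp: fun_eq_iff)
  qed
  have e_bd: "e s \<in> disc_boundary 2" for s using rad_e e_high by (simp add: in_disc_boundary_iff)
  have im: "?m ` ?Q = topspace (disc 2)"
  proof
    show "?m ` ?Q \<subseteq> topspace (disc 2)"
      using rad e_high by (auto simp: in_disc_iff)
    show "topspace (disc 2) \<subseteq> ?m ` ?Q"
    proof
      fix x assume x: "x \<in> topspace (disc 2)"
      show "x \<in> ?m ` ?Q"
      proof (cases "radius 2 x = 0")
        case True
        then have "(x 0)\<^sup>2 + (x 1)\<^sup>2 = 0" by (simp add: radius_def sum2)
        then have "x 0 = 0" "x 1 = 0" by (simp_all add: sum_power2_eq_zero_iff)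
        then have "x i = 0" for i
          using x by (cases "i \<ge> 2") (auto simp: in_disc_iff numeral_2_eq_2 not_le less_Suc_eq)
        then show ?thesis by (intro image_eqI[of _ _ "(1, 0)"]) auto
      next
        case False
        then have pos: "0 < radius 2 x" using radius_nonneg[of 2 x] by simp
        have "(\<lambda>i. (1 / radius 2 x) * x i) \<in> disc_boundary 2"
          unfolding in_disc_boundary_iff radius_mult using x pos by (simp add: in_disc_iff)
        then obtain s where s: "s \<in> {0..1}" "(\<lambda>i. (1 / radius 2 x) * x i) = e s" using polar by blast
        have "1 - radius 2 x \<in> {0..1}" using x pos by (simp add: in_disc_iff)
        then show ?thesis
          using s pos by (intro image_eqI[of _ _ "(1 - radius 2 x, s)"]) (auto simp flip: s(2))
      qed
    qed
  qed
  have D: "disc 2 = top_of_set (topspace (disc 2))" by (simp add: disc_top_of_set)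
  have q: "quotient_map (top_of_set ?Q) (disc 2) ?m"
  proof (rule T1_Spaces.continuous_imp_quotient_map)
    have ci: "continuous_on ?Q (\<lambda>w. e (snd w) i)" for i
      unfolding e_def by (cases "i = 0"; cases "i = 1") (auto intro!: continuous_intros)
    have "continuous_on ?Q ?m"
      unfolding split_def
      by (intro continuous_on_coordinatewise_then_product continuous_on_mult continuous_on_diff ci
        continuous_on_const continuous_on_fst continuous_on_id)
    then have "continuous_map (top_of_set ?Q) (top_of_set (topspace (disc 2))) ?m" using im by auto
    then show "continuous_map (top_of_set ?Q) (disc 2) ?m" by (simp only: D[symmetric])
    show "compact_space (top_of_set ?Q)" by (simp add: compact_space_subtopology compact_Times)
    show "Hausdorff_space (disc 2)" by (simp add: disc_top_of_set Hausdorff_space_subtopology)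
    show "?m ` topspace (top_of_set ?Q) = topspace (disc 2)" using im by simp
  qed
  have e_inj: "s = s' \<or> (s \<in> {0, 1} \<and> s' \<in> {0, 1})" if s: "s \<in> {0..1}" "s' \<in> {0..1}" "e s = e s'" for s s'
  proof -
    have "sin (2 * pi * s) = sin (2 * pi * s') \<and> cos (2 * pi * s) = cos (2 * pi * s')"
      using fun_cong[OF s(3), of 0] fun_cong[OF s(3), of 1] by (simp add: e_def)
    then obtain k :: int where k: "2 * pi * s = 2 * pi * s' + 2 * pi * k" using sin_cos_eq_iff by blast
    then have "2 * pi * s = 2 * pi * (s' + k)" by (simp add: distrib_left)
    then have sk: "s = s' + k" by simp
    then have "\<bar>real_of_int k\<bar> \<le> 1" using s(1,2) by auto
    then have "k = 0 \<or> k = 1 \<or> k = -1" by linarith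
    then show ?thesis using sk s(1,2) by auto
  qed
  have resp: "h u = h v"
    if uv: "u \<in> topspace (top_of_set ?Q)" "v \<in> topspace (top_of_set ?Q)" "?m u = ?m v" for u v
  proof -
    obtain t s t' s' where w: "u = (t, s)" "v = (t', s')" by (metis surj_pair)
    have in': "t \<in> {0..1}" "s \<in> {0..1}" "t' \<in> {0..1}" "s' \<in> {0..1}" using uv(1,2) w by auto
    have t: "t = t'" using rad[OF in'(1), of s] rad[OF in'(3), of s'] uv(3) w by simp
    show ?thesis
    proof (cases "t = 1")
      case True then show ?thesis using w t h(3) in' by simp
    next
      case False
      have "e s = e s'"
      proof
        fix i show "e s i = e s' i" using fun_cong[OF uv(3), of i] w t False by simp
      qed
      then show ?thesis using e_inj[OF in'(2,4)] w t h(4) in' by auto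
    qed
  qed
  show ?thesis
  proof (rule quotient_map_lift_exists[OF q h(1) resp])
    fix F assume F: "continuous_map (disc 2) W F" "\<And>u. u \<in> topspace (top_of_set ?Q) \<Longrightarrow> F (?m u) = h u"
    have "F x = f x" if "x \<in> disc_boundary 2" for x
    proof -
      obtain s where "s \<in> {0..1}" "x = e s" using polar \<open>x \<in> _\<close> by blast
      then show ?thesis using F(2)[of "(0, s)"] h(2) by simp
    qed
    then show ?thesis using F(1) by blast
  qed
qed

lemma continuous_map_circle:
  "continuous_map (top_of_set {0..1}) (subtopology (disc 2) (disc_boundary 2))
     (\<lambda>s::real. (\<lambda>i::nat. if i = 0 then cos (2 * pi * s) else if i = 1 then sin (2 * pi * s) else (0::real)))"
proof -
  have "continuous_on {0..1} (\<lambda>s::real. if i = 0 then cos (2 * pi * s) else if i = 1 then sin (2 * pi * s) else (0::real))"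
    for i :: nat by (cases "i = 0"; cases "i = 1") (auto intro!: continuous_intros)
  then have "continuous_on {0..1} (\<lambda>s::real. (\<lambda>i::nat. if i = 0 then cos (2 * pi * s) else if i = 1 then sin (2 * pi * s) else (0::real)))"
    by (rule continuous_on_coordinatewise_then_product)
  then show ?thesis
    unfolding sphere_top_of_set by (auto simp: disc_boundary_eq numeral_2_eq_2)
qed

text \<open>A null-homotopy of a loop below lifts to a null-homotopy of a loop above, by uniqueness of
  lifts along the three sides of the square that lie over constant paths.\<close>

lemma lift_null_homotopy:
  assumes p: "covering_map P Y \<pi>" and c: "pathin P c"
    and hom: "path_homotopic Y (\<pi> \<circ> c) (\<lambda>_. b)"
  shows "path_homotopic P c (\<lambda>_. c 0)"
proof -
  obtain h :: "real \<times> real \<Rightarrow> 'b" where h: "continuous_map (top_of_set ({0..1} \<times> {0..1})) Y h"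
    "\<forall>s\<in>{0..1}. h (0, s) = \<pi> (c s)" "\<forall>s\<in>{0..1}. h (1, s) = b"
    "\<forall>t\<in>{0..1}. h (t, 0) = \<pi> (c 0) \<and> h (t, 1) = \<pi> (c 1)"
    using hom unfolding path_homotopic_iff by auto
  have b: "\<pi> (c 0) = b" "\<pi> (c 1) = b" using path_homotopic_ends[OF hom] by (metis comp_apply)+
  have h': "continuous_map (prod_topology (top_of_set {0..1}) (top_of_set {0..1})) Y h"
    using h(1) by (simp add: prod_topology_top_of_set)
  show ?thesis
  proof (rule covering_map_lift_homotopy[OF p h'])
    show "continuous_map (top_of_set {0..1}) P c" using c by (simp add: pathin_def)
    show "\<pi> (c s) = h (0, s)" if "s \<in> topspace (top_of_set {0..1})" for s using h(2) that by auto
    fix H assume "continuous_map (prod_topology (top_of_set {0..1}) (top_of_set {0..1})) P H"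
      and H: "\<And>t s. t \<in> {0..1} \<Longrightarrow> s \<in> topspace (top_of_set {0..1}) \<Longrightarrow> \<pi> (H (t, s)) = h (t, s)"
      "\<And>s. s \<in> topspace (top_of_set {0..1}) \<Longrightarrow> H (0, s) = c s"
    then have Hc: "continuous_map (top_of_set ({0..1} \<times> {0..1})) P H"
      by (simp add: prod_topology_top_of_set)
    have side: "pathin P (\<lambda>t. H (t, s))" if "s \<in> {0..1}" for s
      unfolding pathin_def
      by (rule continuous_map_top_of_set_compose[OF Hc]) (use that in \<open>auto intro!: continuous_intros\<close>)
    have top: "pathin P (\<lambda>s. H (1, s))"
      unfolding pathin_def
      by (rule continuous_map_top_of_set_compose[OF Hc]) (auto intro!: continuous_intros)
    have cP: "c 0 \<in> topspace P" "c 1 \<in> topspace P"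
      using path_start_in_topspace[OF c] path_finish_in_topspace[OF c] by auto
    have s0: "H (t, 0) = (\<lambda>_. c 0) t" if "t \<in> {0..1}" for t
      by (rule path_lifts_equal[OF p side, of 0]) (use that cP H h(4) in auto)
    have s1: "H (t, 1) = (\<lambda>_. c 1) t" if "t \<in> {0..1}" for t
      by (rule path_lifts_equal[OF p side, of 1]) (use that cP H h(4) in auto)
    have st: "H (1, s) = (\<lambda>_. c 0) s" if "s \<in> {0..1}" for s
      by (rule path_lifts_equal[OF p top]) (use that cP s0[of 1] H(1) h(3) b in auto)
    have "c 1 = c 0" using s1[of 1] st[of 1] by simp
    then show ?thesis
      unfolding path_homotopic_iff using Hc H(2) s0 s1 st by (intro exI[of _ H]) auto
  qed
qed

text \<open>A circle in the universal cover projects to a contractible loop, by \<open>universal_cover_path_end\<close>, and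
  the contraction lifts.\<close>

theorem fills_spheres_universal_cover:
  assumes cov: "covering_map (universal_cover Y y) Y endpoint" and y: "y \<in> topspace Y"
    and triv: "\<And>n z. n \<ge> 2 \<Longrightarrow> z \<in> topspace Y \<Longrightarrow> trivial_homotopy_group n Y z"
  shows "fills_spheres (universal_cover Y y)"
proof (rule fills_spheresI)
  let ?UC = "universal_cover Y y"
  show "topspace ?UC \<noteq> {}"
    using path_class_in_universal_cover[of Y "\<lambda>_. y" y] y by auto
  fix n :: nat and f
  assume n: "0 < n" and f: "continuous_map (subtopology (disc n) (disc_boundary n)) ?UC f"
  consider "n = 1" | "n = 2" | "n \<ge> 3" using n by linarith
  then show "\<exists>F. continuous_map (disc n) ?UC F \<and> (\<forall>x\<in>disc_boundary n. F x = f x)"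
  proof cases
    case 1
    then show ?thesis
      using path_connected_fills_0_sphere[OF path_connected_space_universal_cover[OF y]] f by simp
  next
    case 3
    then show ?thesis using covering_fills_high_spheres[OF cov triv _ f] by blast
  next
    case 2
    let ?c = "\<lambda>s. f (\<lambda>i::nat. if i = 0 then cos (2 * pi * s) else if i = 1 then sin (2 * pi * s) else (0::real))"
    have c: "pathin ?UC ?c"
      using continuous_map_compose[OF continuous_map_circle f[unfolded 2]] by (simp add: pathin_def o_def)
    have closed: "?c 1 = ?c 0" by (intro arg_cong[where f = f] ext) simp
    obtain \<gamma> where \<gamma>: "pathin Y \<gamma>" "\<gamma> 0 = y" "?c 0 = path_class Y \<gamma>"
      using in_universal_coverE[OF path_start_in_topspace[OF c]] .
    let ?l = "endpoint \<circ> ?c" and ?r = "\<lambda>t. \<gamma> (1 - t)"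
    have l: "pathin Y ?l" by (rule pathin_compose[OF c continuous_map_endpoint])
    have l01: "?l 0 = \<gamma> 1" "?l 1 = \<gamma> 1"
      using endpoint_path_class[OF \<gamma>(1)] \<gamma>(3) closed by simp_all
    have "path_class Y (path_concat \<gamma> ?l) = path_class Y \<gamma>"
      using universal_cover_path_end[OF cov c \<gamma>] closed \<gamma>(3) by simp
    then have fix\<gamma>: "path_homotopic Y (path_concat \<gamma> ?l) \<gamma>" by (rule path_class_eqD[OF \<gamma>(1)])
    note r = pathin_reverse[OF \<gamma>(1)]
    have "path_homotopic Y ?l (path_concat (\<lambda>_. \<gamma> 1) ?l)"
      by (rule path_homotopic_sym[OF path_concat_const_left[OF l]]) (use l01 in simp)
    also have "path_homotopic Y \<dots> (path_concat (path_concat ?r \<gamma>) ?l)"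
      by (rule path_homotopic_concat[OF path_homotopic_sym[OF path_concat_reverse_left[OF \<gamma>(1)]]
            path_homotopic_refl[OF l]]) (use l01 in simp)
    also have "path_homotopic Y \<dots> (path_concat ?r (path_concat \<gamma> ?l))"
      by (rule path_concat_assoc[OF r \<gamma>(1) l]) (use l01 in simp_all)
    also have "path_homotopic Y \<dots> (path_concat ?r \<gamma>)"
      by (rule path_homotopic_concat[OF path_homotopic_refl[OF r] fix\<gamma>]) simp
    also have "path_homotopic Y \<dots> (\<lambda>_. \<gamma> 1)" by (rule path_concat_reverse_left[OF \<gamma>(1)])
    finally have "path_homotopic ?UC ?c (\<lambda>_. ?c 0)" by (rule lift_null_homotopy[OF cov c])
    from null_homotopic_loop_fills_circle[OF this] show ?thesis unfolding 2 .
  qed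
qed


section \<open>Sectional category and genus\<close>

text \<open>For a covering map the homotopies in the definition of the sectional category can be lifted, so
  that local sections up to homotopy become local sections.\<close>

lemma covering_strict_section_iff:
  assumes p: "covering_map X Y p"
  shows "(\<exists>s. continuous_map (subtopology Y U) X s \<and> homotopic_with (\<lambda>_. True) (subtopology Y U) Y (p \<circ> s) id)
    \<longleftrightarrow> (\<exists>s. continuous_map (subtopology Y U) X s \<and> (\<forall>u\<in>topspace (subtopology Y U). p (s u) = u))"
    (is "?lhs \<longleftrightarrow> ?rhs")
proof
  assume ?lhs
  then obtain s h where s: "continuous_map (subtopology Y U) X s"
    and h: "continuous_map (prod_topology (top_of_set {0..1::real}) (subtopology Y U)) Y h"
    "\<And>u. h (0, u) = p (s u)" "\<And>u. h (1, u) = u"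
    unfolding homotopic_with_def by auto
  show ?rhs
  proof (rule covering_map_lift_homotopy[OF p h(1) s])
    show "p (s u) = h (0, u)" if "u \<in> topspace (subtopology Y U)" for u by (simp add: h(2))
    fix H assume H: "continuous_map (prod_topology (top_of_set {0..1::real}) (subtopology Y U)) X H"
      "\<And>t u. t \<in> {0..1} \<Longrightarrow> u \<in> topspace (subtopology Y U) \<Longrightarrow> p (H (t, u)) = h (t, u)"
    have "continuous_map (subtopology Y U) X (H \<circ> Pair 1)" by (rule continuous_map_o_Pair[OF H(1)]) simp
    moreover have "p ((H \<circ> Pair 1) u) = u" if "u \<in> topspace (subtopology Y U)" for u
      using H(2)[of 1 u] that h(3) by simp
    ultimately show ?rhs by blast
  qed
next
  assume ?rhs
  then obtain s where s: "continuous_map (subtopology Y U) X s" "\<And>u. u \<in> topspace (subtopology Y U) \<Longrightarrow> p (s u) = u"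
    by blast
  have "continuous_map (subtopology Y U) Y (p \<circ> s)"
    by (rule continuous_map_compose[OF s(1) covering_map_imp_continuous[OF p]])
  then have "homotopic_with (\<lambda>_. True) (subtopology Y U) Y (p \<circ> s) id"
    by (intro homotopic_with_equal) (use s(2) in auto)
  then show ?lhs using s(1) by blast
qed

text \<open>Genus and sectional category are compared through the predicates that bound them by \<open>k\<close>, of which
  they are the infima.\<close>

definition genus_le :: "('g, 'm) monoid_scheme \<Rightarrow> 'c topology \<Rightarrow> ('g \<Rightarrow> 'c \<Rightarrow> 'c) \<Rightarrow> 'a topology \<Rightarrow>
    ('g \<Rightarrow> 'a \<Rightarrow> 'a) \<Rightarrow> nat \<Rightarrow> bool" where
  "genus_le G A \<beta> X \<alpha> k \<longleftrightarrow> (\<exists>U. (\<forall>i\<le>k. openin X (U i)) \<and>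
     (\<forall>i\<le>k. \<forall>g\<in>carrier G. \<forall>u\<in>U i. \<alpha> g u \<in> U i) \<and>
     (\<Union>i\<le>k. U i) = topspace X \<and>
     (\<forall>i\<le>k. \<exists>f. continuous_map (subtopology X (U i)) A f \<and>
        (\<forall>g\<in>carrier G. \<forall>u\<in>U i. f (\<alpha> g u) = \<beta> g (f u))))"

definition sections_le :: "'a topology \<Rightarrow> 'b topology \<Rightarrow> ('a \<Rightarrow> 'b) \<Rightarrow> nat \<Rightarrow> bool" where
  "sections_le X Y p k \<longleftrightarrow> (\<exists>U. (\<forall>i\<le>k. openin Y (U i)) \<and> (\<Union>i\<le>k. U i) = topspace Y \<and>
     (\<forall>i\<le>k. \<exists>s. continuous_map (subtopology Y (U i)) X s \<and>
        (\<forall>u\<in>topspace (subtopology Y (U i)). p (s u) = u)))"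

lemma genus_singleton: "genus G {(A, \<beta>)} X \<alpha> = Inf (enat ` {k. genus_le G A \<beta> X \<alpha> k})"
  by (simp add: genus_def genus_le_def image_subset_iff all_conj_distrib imp_conjR conj_assoc)

lemma secat_covering: "covering_map X Y p \<Longrightarrow> secat X Y p = Inf (enat ` {k. sections_le X Y p k})"
  by (simp add: secat_def sections_le_def covering_strict_section_iff)

text \<open>Covers and equivariant maps pull back along equivariant maps.\<close>

lemma genus_le_pullback:
  assumes F: "continuous_map Z W F" and eq: "\<And>g z. g \<in> carrier G \<Longrightarrow> z \<in> topspace Z \<Longrightarrow> F (\<alpha> g z) = \<gamma> g (F z)"
    and \<alpha>: "\<And>g z. g \<in> carrier G \<Longrightarrow> z \<in> topspace Z \<Longrightarrow> \<alpha> g z \<in> topspace Z"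
    and W: "genus_le G A \<beta> W \<gamma> k"
  shows "genus_le G A \<beta> Z \<alpha> k"
proof -
  obtain U where U': "\<forall>i\<le>k. openin W (U i)"
    "\<forall>i\<le>k. \<forall>g\<in>carrier G. \<forall>u\<in>U i. \<gamma> g u \<in> U i"
    "(\<Union>i\<le>k. U i) = topspace W"
    "\<forall>i\<le>k. \<exists>f. continuous_map (subtopology W (U i)) A f \<and>
        (\<forall>g\<in>carrier G. \<forall>u\<in>U i. f (\<gamma> g u) = \<beta> g (f u))"
    using W unfolding genus_le_def by (elim exE conjE)
  note U = U'[rule_format]
  define V where "V i = {z \<in> topspace Z. F z \<in> U i}" for i
  have "openin Z (V i)" if i: "i \<le> k" for i
    unfolding V_def by (rule openin_continuous_map_preimage[OF F U(1)[OF i]])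
  moreover have "\<alpha> g z \<in> V i" if "i \<le> k" "g \<in> carrier G" "z \<in> V i" for i g z
    using U(2)[OF that(1,2)] eq[OF that(2)] \<alpha>[OF that(2)] that(3) by (simp add: V_def)
  moreover have "(\<Union>i\<le>k. V i) = topspace Z"
    unfolding V_def using U(3) continuous_map_in_topspace[OF F] by auto
  moreover have "\<exists>f. continuous_map (subtopology Z (V i)) A f \<and>
        (\<forall>g\<in>carrier G. \<forall>u\<in>V i. f (\<alpha> g u) = \<beta> g (f u))" if i: "i \<le> k" for i
  proof -
    obtain f where f: "continuous_map (subtopology W (U i)) A f"
      "\<And>g u. g \<in> carrier G \<Longrightarrow> u \<in> U i \<Longrightarrow> f (\<gamma> g u) = \<beta> g (f u)" using U(4)[OF i] by blast
    have "continuous_map (subtopology Z (V i)) (subtopology W (U i)) F"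
      unfolding continuous_map_in_subtopology using continuous_map_from_subtopology[OF F]
      by (auto simp: V_def)
    from continuous_map_compose[OF this f(1)] show ?thesis
      using f(2) eq by (intro exI[of _ "f \<circ> F"]) (auto simp: V_def)
  qed
  ultimately show ?thesis unfolding genus_le_def by (intro exI[of _ V]) simp
qed

text \<open>Let \<open>P\<close> be a principal \<open>G\<close>-covering of \<open>Y\<close> and let \<open>\<l>\<close> identify \<open>X\<close> with the orbit space \<open>P/H\<close>. A
  section of \<open>X\<close> over \<open>U\<close> amounts to an equivariant map from the preimage of \<open>U\<close> to \<open>G/H\<close>: a point \<open>z\<close>
  goes to the coset of those \<open>g\<close> for which \<open>g\<^sup>-\<^sup>1 z\<close> lies over the value of the section.\<close>

locale orbit_covering = principal_covering G P \<alpha> Y \<pi> for G (structure) and P :: "'z topology" and \<alpha>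
    and Y :: "'y topology" and \<pi> +
  fixes H :: "'a set" and X :: "'x topology" and p :: "'x \<Rightarrow> 'y" and \<l> :: "'z \<Rightarrow> 'x"
  assumes H: "subgroup H G"
    and p: "covering_map X Y p"
    and l_cont: "continuous_map P X \<l>"
    and l_over: "z \<in> topspace P \<Longrightarrow> p (\<l> z) = \<pi> z"
    and l_surj: "x \<in> topspace X \<Longrightarrow> \<exists>z\<in>topspace P. \<l> z = x"
    and l_eq: "z \<in> topspace P \<Longrightarrow> g \<in> carrier G \<Longrightarrow> \<l> (\<alpha> g z) = \<l> z \<longleftrightarrow> g \<in> H"
begin

abbreviation cosets :: "'a set topology" where
  "cosets \<equiv> discrete_topology (lcosets H)"

lemma HG: "H \<subseteq> carrier G" using H subgroup.subset by blast

lemma coset_of_section: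
  assumes s: "\<And>u. u \<in> U \<Longrightarrow> s u \<in> topspace X" "\<And>u. u \<in> U \<Longrightarrow> p (s u) = u"
    and z: "z \<in> topspace P" "\<pi> z \<in> U"
  obtains g where "g \<in> carrier G" "\<l> (\<alpha> (inv g) z) = s (\<pi> z)"
    "{h \<in> carrier G. \<l> (\<alpha> (inv h) z) = s (\<pi> z)} = g <# H"
proof -
  obtain w where w: "w \<in> topspace P" "\<l> w = s (\<pi> z)" using l_surj[OF s(1)[OF z(2)]] by blast
  have "\<pi> w = \<pi> z" using l_over[OF w(1)] w(2) s(2)[OF z(2)] by simp
  then obtain g where g: "g \<in> carrier G" "z = \<alpha> g w" using transitive[OF w(1) z(1)] by blast
  have gw: "\<alpha> (inv g) z = w" using act_inv[OF g(1) w(1)] g(2) by simp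
  have "\<l> (\<alpha> (inv h) z) = s (\<pi> z) \<longleftrightarrow> h \<in> g <# H" if h: "h \<in> carrier G" for h
  proof -
    have "\<alpha> (inv h) z = \<alpha> (inv h \<otimes> g) w" using act_mult[of "inv h" g w] h g w(1) by simp
    then have "\<l> (\<alpha> (inv h) z) = s (\<pi> z) \<longleftrightarrow> inv h \<otimes> g \<in> H"
      using l_eq[OF w(1), of "inv h \<otimes> g"] h g(1) w(2) by simp
    also have "\<dots> \<longleftrightarrow> inv g \<otimes> h \<in> H"
    proof
      assume "inv h \<otimes> g \<in> H"
      then have "inv (inv h \<otimes> g) \<in> H" by (rule subgroup.m_inv_closed[OF H])
      then show "inv g \<otimes> h \<in> H" using h g(1) by (simp add: inv_mult_group)
    next
      assume "inv g \<otimes> h \<in> H"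
      then have "inv (inv g \<otimes> h) \<in> H" by (rule subgroup.m_inv_closed[OF H])
      then show "inv h \<otimes> g \<in> H" using h g(1) by (simp add: inv_mult_group)
    qed
    also have "\<dots> \<longleftrightarrow> h \<in> g <# H"
    proof
      assume "inv g \<otimes> h \<in> H"
      moreover have "h = g \<otimes> (inv g \<otimes> h)" using g(1) h by (simp add: m_assoc[symmetric])
      ultimately show "h \<in> g <# H" unfolding l_coset_def by blast
    next
      assume "h \<in> g <# H"
      then obtain k where "k \<in> H" "h = g \<otimes> k" unfolding l_coset_def by blast
      moreover from this have "k \<in> carrier G" using HG by blast
      ultimately show "inv g \<otimes> h \<in> H" using g(1) by (simp add: m_assoc[symmetric])
    qed
    finally show ?thesis .
  qed
  moreover have "g <# H \<subseteq> carrier G" using l_coset_subset_G[OF HG g(1)] .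
  ultimately have "{h \<in> carrier G. \<l> (\<alpha> (inv h) z) = s (\<pi> z)} = g <# H" by blast
  then show thesis using that g(1) gw w(2) by simp
qed

lemma equivariant_map_of_section:
  assumes U: "openin Y U" and s: "continuous_map (subtopology Y U) X s"
    "\<And>u. u \<in> U \<Longrightarrow> p (s u) = u"
  defines "V \<equiv> {z \<in> topspace P. \<pi> z \<in> U}"
  shows "\<exists>f. continuous_map (subtopology P V) cosets f \<and>
    (\<forall>g\<in>carrier G. \<forall>z\<in>V. f (\<alpha> g z) = left_translation G H g (f z))"
proof -
  have UY: "U \<subseteq> topspace Y" using U openin_subset by blast
  have sX: "s u \<in> topspace X" if "u \<in> U" for u
    using continuous_map_in_topspace[OF s(1), of u] that UY by auto
  define f where "f z = {h \<in> carrier G. \<l> (\<alpha> (inv h) z) = s (\<pi> z)}" for z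
  have f_coset: "\<exists>g\<in>carrier G. f z = g <# H" if z: "z \<in> V" for z
    using coset_of_section[OF sX s(2), of U z] z unfolding V_def f_def by blast
  have f_in: "f z \<in> lcosets H" if "z \<in> V" for z using f_coset[OF that] by (auto simp: LCOSETS_def)
  have opV: "openin P V"
    unfolding V_def using U by (rule openin_continuous_map_preimage[OF covering_map_imp_continuous[OF covering]])
  have \<pi>V: "continuous_map (subtopology P V) (subtopology Y U) \<pi>"
    unfolding continuous_map_in_subtopology
    using continuous_map_from_subtopology[OF covering_map_imp_continuous[OF covering]] by (auto simp: V_def)
  have c1: "continuous_map (subtopology P V) X (\<lambda>z. s (\<pi> z))"
    using continuous_map_compose[OF \<pi>V s(1)] by (simp add: o_def)
  \<comment> \<open>The level sets of \<open>f\<close> are open because each is the set where two lifts of \<open>\<pi>\<close> through \<open>p\<close> agree.\<close>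
  have loc: "openin (subtopology P V) {z \<in> topspace (subtopology P V). f z = C}" if C: "C \<in> lcosets H" for C
  proof -
    obtain g where g: "g \<in> carrier G" "C = g <# H" using C by (auto simp: LCOSETS_def)
    have gC: "g \<in> C"
      unfolding g(2) l_coset_def using g(1) subgroup.one_closed[OF H] by force
    have c2: "continuous_map (subtopology P V) X (\<lambda>z. \<l> (\<alpha> (inv g) z))"
      using continuous_map_from_subtopology[OF continuous_map_compose[OF act_continuous[OF inv_closed[OF g(1)]] l_cont]]
      by (simp add: o_def)
    have "f z = C \<longleftrightarrow> \<l> (\<alpha> (inv g) z) = s (\<pi> z)" if z: "z \<in> V" for z
    proof
      assume "f z = C" then show "\<l> (\<alpha> (inv g) z) = s (\<pi> z)" using gC unfolding f_def by blast
    next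
      assume "\<l> (\<alpha> (inv g) z) = s (\<pi> z)"
      then have "g \<in> f z" using g(1) by (simp add: f_def)
      moreover obtain h where h: "h \<in> carrier G" "f z = h <# H" using f_coset[OF z] by blast
      ultimately show "f z = C" using l_repr_independence[OF _ h(1) H, of g] g(2) by simp
    qed
    then have "{z \<in> topspace (subtopology P V). f z = C} =
        {z \<in> topspace (subtopology P V). \<l> (\<alpha> (inv g) z) = s (\<pi> z)}" by auto
    moreover have "openin (subtopology P V) {z \<in> topspace (subtopology P V). \<l> (\<alpha> (inv g) z) = s (\<pi> z)}"
    proof (rule openin_lifts_agree[OF p c2 c1])
      fix z assume "z \<in> topspace (subtopology P V)"
      then have z: "z \<in> topspace P" "\<pi> z \<in> U" by (auto simp: V_def)
      show "p (\<l> (\<alpha> (inv g) z)) = p (s (\<pi> z))"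
        using l_over[OF act_in[OF inv_closed[OF g(1)] z(1)]] act_fibre[OF inv_closed[OF g(1)] z(1)] s(2)[OF z(2)]
        by simp
    qed
    ultimately show ?thesis by simp
  qed
  have "continuous_map (subtopology P V) cosets f"
    unfolding continuous_map_def
  proof (intro conjI allI impI)
    show "f \<in> topspace (subtopology P V) \<rightarrow> topspace cosets" using f_in by auto
    fix T assume "openin cosets T"
    then have T: "T \<subseteq> lcosets H" by simp
    have "{z \<in> topspace (subtopology P V). f z \<in> T} = (\<Union>C\<in>T. {z \<in> topspace (subtopology P V). f z = C})" by auto
    moreover have "openin (subtopology P V) (\<Union>C\<in>T. {z \<in> topspace (subtopology P V). f z = C})"
      using loc T by (intro openin_Union) auto
    ultimately show "openin (subtopology P V) {z \<in> topspace (subtopology P V). f z \<in> T}" by simp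
  qed
  moreover have "f (\<alpha> g z) = left_translation G H g (f z)" if g: "g \<in> carrier G" and z: "z \<in> V" for g z
  proof -
    have zP: "z \<in> topspace P" using z by (simp add: V_def)
    have "f (\<alpha> g z) = g <# f z"
    proof
      show "f (\<alpha> g z) \<subseteq> g <# f z"
      proof
        fix h assume "h \<in> f (\<alpha> g z)"
        then have h: "h \<in> carrier G" "\<l> (\<alpha> (inv h) (\<alpha> g z)) = s (\<pi> z)"
          using act_fibre[OF g zP] by (auto simp: f_def)
        have "\<alpha> (inv (inv g \<otimes> h)) z = \<alpha> (inv h) (\<alpha> g z)"
          using g h(1) zP act_mult[of "inv h" g z] by (simp add: inv_mult_group)
        then have "inv g \<otimes> h \<in> f z" using h g by (simp add: f_def)
        moreover have "h = g \<otimes> (inv g \<otimes> h)" using g h(1) by (simp add: m_assoc[symmetric])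
        ultimately show "h \<in> g <# f z" unfolding l_coset_def by blast
      qed
      show "g <# f z \<subseteq> f (\<alpha> g z)"
      proof
        fix h assume "h \<in> g <# f z"
        then obtain k where k: "k \<in> carrier G" "\<l> (\<alpha> (inv k) z) = s (\<pi> z)" "h = g \<otimes> k"
          unfolding l_coset_def f_def by blast
        have "\<alpha> (inv h) (\<alpha> g z) = \<alpha> (inv k \<otimes> inv g) (\<alpha> g z)" using k g by (simp add: inv_mult_group)
        also have "\<dots> = \<alpha> (inv k) (\<alpha> (inv g) (\<alpha> g z))"
          by (rule act_mult[OF inv_closed[OF k(1)] inv_closed[OF g] act_in[OF g zP]])
        also have "\<dots> = \<alpha> (inv k) z" using act_inv[OF g zP] by simp
        finally show "h \<in> f (\<alpha> g z)" using k g act_fibre[OF g zP] by (simp add: f_def)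
      qed
    qed
    then show ?thesis using f_in[OF z] by (simp add: left_translation_def)
  qed
  ultimately show ?thesis by blast
qed

text \<open>Over \<open>u\<close> the section takes the value \<open>\<l> z\<close>, where \<open>z\<close> is a point over \<open>u\<close> that \<open>f\<close> sends to the coset \<open>H\<close>.
  Such points form one orbit of \<open>H\<close>, and they can be chosen continuously because \<open>G/H\<close> is discrete.\<close>

lemma section_of_equivariant_map:
  assumes V: "openin P V" "\<And>g z. g \<in> carrier G \<Longrightarrow> z \<in> V \<Longrightarrow> \<alpha> g z \<in> V"
    and f: "continuous_map (subtopology P V) cosets f"
      "\<And>g z. g \<in> carrier G \<Longrightarrow> z \<in> V \<Longrightarrow> f (\<alpha> g z) = left_translation G H g (f z)"
  shows "openin Y (\<pi> ` V)"
    "\<exists>s. continuous_map (subtopology Y (\<pi> ` V)) X s \<and> (\<forall>u\<in>\<pi> ` V. p (s u) = u)"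
proof -
  have VP: "V \<subseteq> topspace P" using V(1) openin_subset by blast
  have f_in: "f z \<in> lcosets H" if "z \<in> V" for z
    using continuous_map_in_topspace[OF f(1), of z] that VP by auto
  have base: "\<exists>z\<in>V. \<pi> z = u \<and> f z = H" if u: "u \<in> \<pi> ` V" for u
  proof -
    obtain z where z: "z \<in> V" "u = \<pi> z" using u by blast
    obtain g where g: "g \<in> carrier G" "f z = g <# H" using f_in[OF z(1)] by (auto simp: LCOSETS_def)
    have "f (\<alpha> (inv g) z) = inv g <# (g <# H)"
      using f(2)[OF inv_closed[OF g(1)] z(1)] f_in[OF z(1)] g by (simp add: left_translation_def)
    also have "\<dots> = H" using g(1) HG by (simp add: lcos_m_assoc lcos_mult_one)
    finally have "f (\<alpha> (inv g) z) = H" .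
    moreover have "\<alpha> (inv g) z \<in> V" by (rule V(2)[OF inv_closed[OF g(1)] z(1)])
    moreover have "\<pi> (\<alpha> (inv g) z) = u" using act_fibre[OF inv_closed[OF g(1)]] z VP by auto
    ultimately show ?thesis by blast
  qed
  have indep: "\<l> z = \<l> w" if z: "z \<in> V" "f z = H" and w: "w \<in> V" "f w = H" and e: "\<pi> z = \<pi> w" for z w
  proof -
    obtain g where g: "g \<in> carrier G" "w = \<alpha> g z" using transitive[of z w] z w e VP by blast
    have "H \<in> lcosets H" using f_in[OF z(1)] z(2) by simp
    then have "g <# H = H" using f(2)[OF g(1) z(1)] g z w by (simp add: left_translation_def)
    moreover have "g \<in> g <# H" unfolding l_coset_def using g(1) subgroup.one_closed[OF H] by force
    ultimately have "g \<in> H" by simp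
    then show ?thesis using l_eq[of z g] g z(1) VP by auto
  qed
  define s where "s u = \<l> (SOME z. z \<in> V \<and> \<pi> z = u \<and> f z = H)" for u
  have s: "s u = \<l> z" if z: "z \<in> V" "\<pi> z = u" "f z = H" for u z
  proof -
    have "(SOME z. z \<in> V \<and> \<pi> z = u \<and> f z = H) \<in> V \<and> \<pi> (SOME z. z \<in> V \<and> \<pi> z = u \<and> f z = H) = u \<and>
        f (SOME z. z \<in> V \<and> \<pi> z = u \<and> f z = H) = H"
      by (rule someI[of "\<lambda>z. z \<in> V \<and> \<pi> z = u \<and> f z = H" z]) (use z in simp)
    then show ?thesis unfolding s_def using indep z by blast
  qed
  have sheet: "\<exists>M \<tau>. openin Y M \<and> \<pi> z \<in> M \<and> M \<subseteq> \<pi> ` V \<and> continuous_map (subtopology Y M) P \<tau> \<and>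
      (\<forall>u\<in>M. s u = \<l> (\<tau> u))" if z: "z \<in> V" "f z = H" for z
  proof -
    have zP: "z \<in> topspace P" using z VP by blast
    obtain U where U: "openin Y U" "\<pi> z \<in> U"
      "\<And>x. x \<in> topspace P \<Longrightarrow> \<pi> x \<in> U \<Longrightarrow>
        \<exists>V \<sigma>. openin P V \<and> x \<in> V \<and> continuous_map (subtopology Y U) P \<sigma> \<and>
          (\<forall>v\<in>V. \<pi> v \<in> U \<and> \<sigma> (\<pi> v) = v) \<and> (\<forall>u\<in>U. \<sigma> u \<in> V \<and> \<pi> (\<sigma> u) = u)"
      using covering_map_evenly_covered[OF covering covering_map_in_topspace[OF covering zP]] by blast
    obtain N \<sigma> where \<sigma>: "z \<in> N" "continuous_map (subtopology Y U) P \<sigma>"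
        "\<forall>v\<in>N. \<pi> v \<in> U \<and> \<sigma> (\<pi> v) = v" "\<forall>u\<in>U. \<sigma> u \<in> N \<and> \<pi> (\<sigma> u) = u"
      using U(3)[OF zP U(2)] by blast
    have UY: "U \<subseteq> topspace Y" using U(1) openin_subset by blast
    have "openin (subtopology P V) {v \<in> topspace (subtopology P V). f v \<in> {H}}"
      by (rule openin_continuous_map_preimage[OF f(1)]) (use f_in[OF z(1)] z(2) in simp)
    then have op: "openin P {v \<in> topspace (subtopology P V). f v \<in> {H}}"
      by (rule openin_trans_full[OF _ V(1)])
    let ?M = "{u \<in> topspace (subtopology Y U). \<sigma> u \<in> {v \<in> topspace (subtopology P V). f v \<in> {H}}}"
    have "openin (subtopology Y U) ?M" by (rule openin_continuous_map_preimage[OF \<sigma>(2) op])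
    then have "openin Y ?M" by (rule openin_trans_full[OF _ U(1)])
    moreover have "\<pi> z \<in> ?M" using z zP U(2) UY \<sigma>(1,3) by auto
    moreover have "?M \<subseteq> \<pi> ` V"
    proof
      fix u assume u: "u \<in> ?M"
      then have "\<pi> (\<sigma> u) = u" "\<sigma> u \<in> V" using \<sigma>(4) by auto
      then show "u \<in> \<pi> ` V" by (metis imageI)
    qed
    moreover have "continuous_map (subtopology Y ?M) P \<sigma>"
      by (rule continuous_map_from_subtopology_mono[OF \<sigma>(2)]) auto
    moreover have "\<forall>u\<in>?M. s u = \<l> (\<sigma> u)" using s \<sigma>(4) by auto
    ultimately show ?thesis by (intro exI[of _ ?M] exI[of _ \<sigma>] conjI)
  qed
  show op\<pi>V: "openin Y (\<pi> ` V)"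
  proof (rule openin_subopen[THEN iffD2], intro ballI)
    fix u assume "u \<in> \<pi> ` V"
    then obtain z where z: "z \<in> V" "\<pi> z = u" "f z = H" using base by blast
    then show "\<exists>T. openin Y T \<and> u \<in> T \<and> T \<subseteq> \<pi> ` V" using sheet[OF z(1,3)] by auto
  qed
  have top\<pi>V: "topspace (subtopology Y (\<pi> ` V)) = \<pi> ` V" using openin_subset[OF op\<pi>V] by auto
  have "continuous_map (subtopology Y (\<pi> ` V)) X s"
    unfolding continuous_map_def top\<pi>V
  proof (intro conjI allI impI)
    show "s \<in> \<pi> ` V \<rightarrow> topspace X"
    proof
      fix u assume "u \<in> \<pi> ` V"
      then obtain z where z: "z \<in> V" "\<pi> z = u" "f z = H" using base by blast
      then show "s u \<in> topspace X" using s[OF z] continuous_map_in_topspace[OF l_cont] VP by auto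
    qed
    fix W assume W: "openin X W"
    show "openin (subtopology Y (\<pi> ` V)) {u \<in> \<pi> ` V. s u \<in> W}"
    proof (rule openin_subopen[THEN iffD2], intro ballI)
      fix u assume u: "u \<in> {u \<in> \<pi> ` V. s u \<in> W}"
      then obtain z where z: "z \<in> V" "\<pi> z = u" "f z = H" using base by blast
      obtain M' \<tau> where M': "openin Y M'" "\<pi> z \<in> M'" "M' \<subseteq> \<pi> ` V" "continuous_map (subtopology Y M') P \<tau>"
        "\<forall>u\<in>M'. s u = \<l> (\<tau> u)" using sheet[OF z(1,3)] by blast
      have M'Y: "M' \<subseteq> topspace Y" using openin_subset[OF M'(1)] .
      let ?T = "{u \<in> topspace (subtopology Y M'). (\<l> \<circ> \<tau>) u \<in> W}"
      have "openin (subtopology Y M') ?T"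
        by (rule openin_continuous_map_preimage[OF continuous_map_compose[OF M'(4) l_cont] W])
      then have "openin Y ?T" by (rule openin_trans_full[OF _ M'(1)])
      then have "openin (subtopology Y (\<pi> ` V)) ?T"
        unfolding openin_open_subtopology[OF op\<pi>V] using M'(3) by auto
      moreover have "u \<in> ?T" using u z(2) M'(2,5) M'Y by auto
      moreover have "?T \<subseteq> {u \<in> \<pi> ` V. s u \<in> W}" using M'(3,5) by auto
      ultimately show "\<exists>T. openin (subtopology Y (\<pi> ` V)) T \<and> u \<in> T \<and> T \<subseteq> {u \<in> \<pi> ` V. s u \<in> W}"
        by (intro exI[of _ ?T] conjI)
    qed
  qed
  moreover have "p (s u) = u" if u: "u \<in> \<pi> ` V" for u
  proof -
    obtain z where z: "z \<in> V" "\<pi> z = u" "f z = H" using base[OF u] by blast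
    then show ?thesis using s[OF z] l_over[of z] VP by auto
  qed
  ultimately show "\<exists>s. continuous_map (subtopology Y (\<pi> ` V)) X s \<and> (\<forall>u\<in>\<pi> ` V. p (s u) = u)" by blast
qed

theorem sections_le_iff_genus_le: "sections_le X Y p k \<longleftrightarrow> genus_le G cosets (left_translation G H) P \<alpha> k"
proof
  assume L: "sections_le X Y p k"
  obtain U where U': "\<forall>i\<le>k. openin Y (U i)" "(\<Union>i\<le>k. U i) = topspace Y"
    "\<forall>i\<le>k. \<exists>s. continuous_map (subtopology Y (U i)) X s \<and>
        (\<forall>u\<in>topspace (subtopology Y (U i)). p (s u) = u)"
    using L unfolding sections_le_def by (elim exE conjE)
  note U = U'[rule_format]
  define V where "V i = {z \<in> topspace P. \<pi> z \<in> U i}" for i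
  have "openin P (V i)" if i: "i \<le> k" for i
    unfolding V_def by (rule openin_continuous_map_preimage[OF covering_map_imp_continuous[OF covering] U(1)[OF i]])
  moreover have "\<alpha> g z \<in> V i" if "i \<le> k" "g \<in> carrier G" "z \<in> V i" for i g z
    using act_in act_fibre that by (simp add: V_def)
  moreover have "(\<Union>i\<le>k. V i) = topspace P"
    unfolding V_def using U(2) covering_map_in_topspace[OF covering] by auto
  moreover have "\<exists>f. continuous_map (subtopology P (V i)) cosets f \<and>
        (\<forall>g\<in>carrier G. \<forall>z\<in>V i. f (\<alpha> g z) = left_translation G H g (f z))" if i: "i \<le> k" for i
  proof -
    obtain s where s: "continuous_map (subtopology Y (U i)) X s"
      "\<forall>u\<in>topspace (subtopology Y (U i)). p (s u) = u" using U(3)[OF i] by blast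
    have "topspace (subtopology Y (U i)) = U i" using openin_subset[OF U(1)[OF i]] by auto
    then show ?thesis
      using equivariant_map_of_section[OF U(1)[OF i] s(1)] s(2) unfolding V_def by simp
  qed
  ultimately show "genus_le G cosets (left_translation G H) P \<alpha> k"
    unfolding genus_le_def by (intro exI[of _ V]) simp
next
  assume L: "genus_le G cosets (left_translation G H) P \<alpha> k"
  obtain V where V': "\<forall>i\<le>k. openin P (V i)"
    "\<forall>i\<le>k. \<forall>g\<in>carrier G. \<forall>z\<in>V i. \<alpha> g z \<in> V i"
    "(\<Union>i\<le>k. V i) = topspace P"
    "\<forall>i\<le>k. \<exists>f. continuous_map (subtopology P (V i)) cosets f \<and>
        (\<forall>g\<in>carrier G. \<forall>z\<in>V i. f (\<alpha> g z) = left_translation G H g (f z))"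
    using L unfolding genus_le_def by (elim exE conjE)
  note V = V'[rule_format]
  have sec: "openin Y (\<pi> ` V i) \<and>
      (\<exists>s. continuous_map (subtopology Y (\<pi> ` V i)) X s \<and> (\<forall>u\<in>\<pi> ` V i. p (s u) = u))" if i: "i \<le> k" for i
  proof -
    obtain f where f: "continuous_map (subtopology P (V i)) cosets f"
      "\<forall>g\<in>carrier G. \<forall>z\<in>V i. f (\<alpha> g z) = left_translation G H g (f z)" using V(4)[OF i] by blast
    show ?thesis
      using section_of_equivariant_map[OF V(1)[OF i] V(2)[OF i] f(1)] f(2) by blast
  qed
  have "(\<Union>i\<le>k. \<pi> ` V i) = \<pi> ` topspace P" using V(3) by blast
  also have "\<dots> = topspace Y" using covering by (simp add: covering_map_def)
  finally have "(\<Union>i\<le>k. \<pi> ` V i) = topspace Y" .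
  moreover have "\<exists>s. continuous_map (subtopology Y (\<pi> ` V i)) X s \<and>
      (\<forall>u\<in>topspace (subtopology Y (\<pi> ` V i)). p (s u) = u)" if i: "i \<le> k" for i
  proof -
    obtain s where "continuous_map (subtopology Y (\<pi> ` V i)) X s" "\<forall>u\<in>\<pi> ` V i. p (s u) = u"
      using sec[OF i] by blast
    then show ?thesis by (intro exI[of _ s] conjI ballI) auto
  qed
  ultimately show "sections_le X Y p k"
    unfolding sections_le_def using sec by (intro exI[of _ "\<lambda>i. \<pi> ` V i"]) simp
qed

end

lemma induced_map_path_class:
  assumes p: "continuous_map X Y p" "p x = y" and b: "pathin X b" "b 0 = x" "b 1 = x"
  shows "induced_map Y y p (path_class X b) = path_class Y (p \<circ> b)"
proof
  show "induced_map Y y p (path_class X b) \<subseteq> path_class Y (p \<circ> b)"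
  proof
    fix r assume "r \<in> induced_map Y y p (path_class X b)"
    then obtain q where q: "path_homotopic X b q" "path_homotopic Y (p \<circ> q) r"
      unfolding induced_map_def path_class_def loop_homotopic_iff by blast
    show "r \<in> path_class Y (p \<circ> b)"
      using path_homotopic_trans[OF path_homotopic_compose[OF p(1) q(1)] q(2)] by (simp add: path_class_def)
  qed
  show "path_class Y (p \<circ> b) \<subseteq> induced_map Y y p (path_class X b)"
  proof
    fix r assume "r \<in> path_class Y (p \<circ> b)"
    then have "loop_homotopic Y y (p \<circ> b) r"
      using p(2) b by (simp add: path_class_def loop_homotopic_iff)
    moreover have "b \<in> path_class X b" using path_homotopic_refl[OF b(1)] by (simp add: path_class_def)
    ultimately show "r \<in> induced_map Y y p (path_class X b)" unfolding induced_map_def by blast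
  qed
qed

text \<open>A deck transformation preserves the fibres of the map to \<open>X\<close> exactly when the loop that
  represents it lifts to a loop in \<open>X\<close>, that is, when it comes from the fundamental group of \<open>X\<close>.\<close>

lemma orbit_covering_universal_cover:
  assumes G: "group G" and H: "subgroup H G" and p: "covering_map X Y p"
    and Y: "locally_path_connected_space Y" "semilocally_simply_connected Y" "path_connected_space Y"
    and X: "path_connected_space X" and x: "x \<in> topspace X" "p x = y"
    and \<psi>: "\<psi> \<in> iso (fundamental_group Y y) G"
    and \<phi>: "\<phi> \<in> iso (fundamental_group X x) (G\<lparr>carrier := H\<rparr>)"
    and comm: "\<And>A. A \<in> carrier (fundamental_group X x) \<Longrightarrow> \<psi> (induced_map Y y p A) = \<phi> A"
  shows "\<exists>\<l>. orbit_covering G (universal_cover Y y)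
     (\<lambda>g. deck_action Y (inv_into (carrier (fundamental_group Y y)) \<psi> g)) Y endpoint H X p \<l>"
proof -
  let ?UC = "universal_cover Y y" and ?\<pi> = "fundamental_group Y y"
  define act where "act = (\<lambda>g. deck_action Y (inv_into (carrier ?\<pi>) \<psi> g))"
  note pc = covering_map_imp_continuous[OF p]
  have y: "y \<in> topspace Y" using covering_map_in_topspace[OF p x(1)] x(2) by simp
  interpret principal_covering G ?UC act Y endpoint
    unfolding act_def by (rule principal_covering_universal_cover[OF G Y y \<psi>])
  have bij: "bij_betw \<psi> (carrier ?\<pi>) (carrier G)" using \<psi> by (simp add: iso_def)
  have \<phi>bij: "\<phi> ` carrier (fundamental_group X x) = H" using \<phi> by (simp add: iso_def bij_betw_def)
  have "\<exists>\<l>. continuous_map ?UC X \<l> \<and> (\<forall>z\<in>topspace ?UC. p (\<l> z) = endpoint z) \<and>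
      (\<forall>\<beta>. pathin X \<beta> \<longrightarrow> \<beta> 0 = x \<longrightarrow> \<l> (path_class Y (p \<circ> \<beta>)) = \<beta> 1)"
  proof (rule universal_cover_map[OF p x])
    fix \<l> assume "continuous_map ?UC X \<l>" "\<And>z. z \<in> topspace ?UC \<Longrightarrow> p (\<l> z) = endpoint z"
      "\<And>\<beta>. pathin X \<beta> \<Longrightarrow> \<beta> 0 = x \<Longrightarrow> \<l> (path_class Y (p \<circ> \<beta>)) = \<beta> 1"
    then show ?thesis by (intro exI[of _ \<l>]) simp
  qed
  then obtain \<l> where \<l>: "continuous_map ?UC X \<l>" "\<forall>z\<in>topspace ?UC. p (\<l> z) = endpoint z"
      "\<forall>\<beta>. pathin X \<beta> \<longrightarrow> \<beta> 0 = x \<longrightarrow> \<l> (path_class Y (p \<circ> \<beta>)) = \<beta> 1"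
    by (elim exE conjE)
  note l_lift = \<l>(3)[rule_format]
  have loops: "\<exists>b. pathin X b \<and> b 0 = x \<and> b 1 = x \<and> B = path_class X b \<and> \<phi> B = \<psi> (path_class Y (p \<circ> b)) \<and>
      path_class Y (p \<circ> b) \<in> carrier ?\<pi>"
    if B: "B \<in> carrier (fundamental_group X x)" for B
  proof -
    obtain b where b: "pathin X b" "b 0 = x" "b 1 = x" "B = path_class X b"
      using B unfolding fundamental_group_carrier by blast
    have "\<phi> B = \<psi> (path_class Y (p \<circ> b))"
      using comm[OF B] induced_map_path_class[OF pc x(2) b(1-3)] b(4) by simp
    moreover have "path_class Y (p \<circ> b) \<in> carrier ?\<pi>"
      unfolding fundamental_group_carrier
      by (intro imageI CollectI conjI pathin_compose[OF b(1) pc]) (simp_all add: b x(2))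
    ultimately show ?thesis using b by blast
  qed
  have stab: "\<l> (act g z) = \<l> z \<longleftrightarrow> g \<in> H" if z: "z \<in> topspace ?UC" and g: "g \<in> carrier G" for z g
  proof -
    have A: "inv_into (carrier ?\<pi>) \<psi> g \<in> carrier ?\<pi>" "\<psi> (inv_into (carrier ?\<pi>) \<psi> g) = g"
      using bij_betw_imp_surj_on[OF bij] g inv_into_into[of g \<psi>] f_inv_into_f[of g \<psi>] by blast+
    then obtain \<omega> where \<omega>: "pathin Y \<omega>" "\<omega> 0 = y" "\<omega> 1 = y" "inv_into (carrier ?\<pi>) \<psi> g = path_class Y \<omega>"
      unfolding fundamental_group_carrier by blast
    have \<psi>\<omega>: "\<psi> (path_class Y \<omega>) = g" "path_class Y \<omega> \<in> carrier ?\<pi>" using A \<omega>(4) by simp_all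
    obtain \<gamma> where \<gamma>: "pathin Y \<gamma>" "\<gamma> 0 = y" "z = path_class Y \<gamma>" using in_universal_coverE[OF z] .
    have act: "act g z = path_class Y (path_concat \<omega> \<gamma>)"
      unfolding act_def \<omega>(4) \<gamma>(3) by (rule deck_action_path_class[OF \<omega>(1) \<gamma>(1)]) (use \<omega> \<gamma> in simp)
    obtain \<beta> where \<beta>: "pathin X \<beta>" "\<beta> 0 = x" "\<And>t. 0 \<le> t \<Longrightarrow> t \<le> 1 \<Longrightarrow> p (\<beta> t) = \<gamma> t"
      using covering_map_lift_path[OF p \<gamma>(1) x(1)] x(2) \<gamma>(2) by auto
    have p\<beta>: "path_homotopic Y (p \<circ> \<beta>) \<gamma>"
      by (rule path_homotopic_eq[OF pathin_compose[OF \<beta>(1) pc]]) (use \<beta>(3) in simp)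
    have lz: "\<l> z = \<beta> 1" using l_lift[OF \<beta>(1,2)] path_class_eq[OF p\<beta>] \<gamma>(3) by simp
    show ?thesis
    proof
      assume "g \<in> H"
      then obtain B where B: "B \<in> carrier (fundamental_group X x)" "\<phi> B = g" using \<phi>bij by blast
      obtain b where b: "pathin X b" "b 0 = x" "b 1 = x" "\<phi> B = \<psi> (path_class Y (p \<circ> b))"
        "path_class Y (p \<circ> b) \<in> carrier ?\<pi>" using loops[OF B(1)] by blast
      have "path_class Y (p \<circ> b) = path_class Y \<omega>"
        using bij_betw_imp_inj_on[OF bij] b(4,5) B(2) \<psi>\<omega> by (auto simp: inj_on_def)
      then have hom: "path_homotopic Y (p \<circ> b) \<omega>" by (rule path_class_eqD[OF \<omega>(1)])
      have cat: "pathin X (path_concat b \<beta>)" by (rule pathin_concat[OF b(1) \<beta>(1)]) (use b \<beta> in simp)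
      have "p \<circ> path_concat b \<beta> = path_concat (p \<circ> b) (p \<circ> \<beta>)" by (auto simp: path_concat_def)
      moreover have "path_homotopic Y (path_concat (p \<circ> b) (p \<circ> \<beta>)) (path_concat \<omega> \<gamma>)"
        by (rule path_homotopic_concat[OF hom p\<beta>]) (use b \<beta> in simp)
      ultimately have "path_class Y (p \<circ> path_concat b \<beta>) = act g z"
        using act path_class_eq by simp
      then show "\<l> (act g z) = \<l> z" using l_lift[OF cat] b(2) lz by simp
    next
      assume eq: "\<l> (act g z) = \<l> z"
      obtain w where w: "pathin X w" "w 0 = x" "\<And>t. 0 \<le> t \<Longrightarrow> t \<le> 1 \<Longrightarrow> p (w t) = \<omega> t"
        using covering_map_lift_path[OF p \<omega>(1) x(1)] x(2) \<omega>(2) by auto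
      have w1: "w 1 \<in> topspace X" "p (w 1) = \<gamma> 0"
        using path_finish_in_topspace[OF w(1)] w(3)[of 1] \<omega>(3) \<gamma>(2) by simp_all
      obtain \<delta> where \<delta>: "pathin X \<delta>" "\<delta> 0 = w 1" "\<And>t. 0 \<le> t \<Longrightarrow> t \<le> 1 \<Longrightarrow> p (\<delta> t) = \<gamma> t"
        using covering_map_lift_path[OF p \<gamma>(1) w1] by auto
      have cat: "pathin X (path_concat w \<delta>)" by (rule pathin_concat[OF w(1) \<delta>(1)]) (use \<delta> in simp)
      have "path_homotopic Y (p \<circ> path_concat w \<delta>) (path_concat \<omega> \<gamma>)"
        by (rule path_homotopic_eq[OF pathin_compose[OF cat pc]]) (use w(3) \<delta>(3) in \<open>auto simp: path_concat_def\<close>)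
      then have "\<l> (act g z) = \<delta> 1" using l_lift[OF cat] w(2) act path_class_eq by fastforce
      then have ends: "\<delta> 1 = \<beta> 1" using eq lz by simp
      have "\<delta> 0 = \<beta> 0"
        by (rule lifts_equal[OF p \<delta>(1)[unfolded pathin_def] \<beta>(1)[unfolded pathin_def], of 1 0])
          (use \<delta>(3) \<beta>(3) ends in \<open>auto simp: connected_space_subtopology\<close>)
      then have wx: "w 1 = x" using \<delta>(2) \<beta>(2) by simp
      let ?B = "path_class X w"
      have B: "?B \<in> carrier (fundamental_group X x)"
        unfolding fundamental_group_carrier using w wx by (intro imageI) simp
      have "path_homotopic Y (p \<circ> w) \<omega>"
        by (rule path_homotopic_eq[OF pathin_compose[OF w(1) pc]]) (use w(3) in simp)
      then have "path_class Y (p \<circ> w) = path_class Y \<omega>" by (rule path_class_eq)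
      then have "\<phi> ?B = g"
        using comm[OF B] induced_map_path_class[OF pc x(2) w(1,2) wx] \<psi>\<omega>(1) by simp
      then show "g \<in> H" using B \<phi>bij by blast
    qed
  qed
  have "orbit_covering G ?UC act Y endpoint H X p \<l>"
  proof (unfold_locales, goal_cases)
    case 1 show ?case by (rule subgroup.subset[OF H])
  next
    case (2 a b) then show ?case by (rule subgroup.m_closed[OF H])
  next
    case 3 show ?case by (rule subgroup.one_closed[OF H])
  next
    case (4 a) then show ?case by (rule subgroup.m_inv_closed[OF H])
  next
    case 5 show ?case by (rule p)
  next
    case 6 show ?case by (rule \<l>(1))
  next
    case (7 z) then show ?case using \<l>(2) by blast
  next
    case (8 x')
    obtain \<beta> where \<beta>: "pathin X \<beta>" "\<beta> 0 = x" "\<beta> 1 = x'"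
      using X x(1) 8 unfolding path_connected_space_def by blast
    have "path_class Y (p \<circ> \<beta>) \<in> topspace ?UC"
      using path_class_in_universal_cover[OF pathin_compose[OF \<beta>(1) pc]] \<beta>(2) x(2) by simp
    then show ?case using l_lift[OF \<beta>(1,2)] \<beta>(3) by blast
  next
    case (9 z g) then show ?case by (rule stab)
  qed
  then show ?thesis unfolding act_def by blast
qed

text \<open>Each of the two spaces maps equivariantly to the other.\<close>

lemma genus_le_iff_of_free_cells:
  assumes Z: "free_cells G Z \<alpha> R n \<xi>" "fills_spheres Z" and W: "free_cells G W \<gamma> R' n' \<xi>'" "fills_spheres W"
  shows "genus_le G A \<beta> Z \<alpha> k \<longleftrightarrow> genus_le G A \<beta> W \<gamma> k"
proof -
  interpret Z: free_cells G Z \<alpha> R n \<xi> by (rule Z(1))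
  interpret W: free_cells G W \<gamma> R' n' \<xi>' by (rule W(1))
  show ?thesis
  proof
    assume g: "genus_le G A \<beta> Z \<alpha> k"
    show "genus_le G A \<beta> W \<gamma> k"
    proof (rule W.equivariant_map_exists[OF Z.continuous_action_axioms Z(2)])
      fix F assume F: "continuous_map W Z F"
        "\<And>g z. g \<in> carrier G \<Longrightarrow> z \<in> topspace W \<Longrightarrow> F (\<gamma> g z) = \<alpha> g (F z)"
      show ?thesis by (rule genus_le_pullback[OF F W.act_in g])
    qed
  next
    assume g: "genus_le G A \<beta> W \<gamma> k"
    show "genus_le G A \<beta> Z \<alpha> k"
    proof (rule Z.equivariant_map_exists[OF W.continuous_action_axioms W(2)])
      fix F assume F: "continuous_map Z W F"
        "\<And>g z. g \<in> carrier G \<Longrightarrow> z \<in> topspace Z \<Longrightarrow> F (\<alpha> g z) = \<gamma> g (F z)"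
      show ?thesis by (rule genus_le_pullback[OF F Z.act_in g])
    qed
  qed
qed

theorem corollary2p3:
  fixes G :: "('g, 'm) monoid_scheme" and H :: "'g set"
    and X :: "'x topology" and Y :: "'y topology" and p :: "'x \<Rightarrow> 'y"
    and E :: "'e topology" and \<alpha> :: "'g \<Rightarrow> 'e \<Rightarrow> 'e"
  assumes "group G" and "torsion_free G" and "subgroup H G"
    and "inclusion_covering G H X Y p"
    and "is_EG G E \<alpha>"
  shows "secat X Y p
    = genus G {(discrete_topology (lcosets\<^bsub>G\<^esub> H), left_translation G H)} E \<alpha>"
proof -
  have p: "covering_map X Y p"
    and "\<exists>x y \<phi> \<psi>. eilenberg_maclane (G\<lparr>carrier := H\<rparr>) X x \<phi> \<and> eilenberg_maclane G Y y \<psi> \<and>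
        p x = y \<and> (\<forall>A\<in>carrier (fundamental_group X x). \<psi> (induced_map Y y p A) = \<phi> A)"
    using assms(4) by (simp_all add: inclusion_covering_def)
  then obtain x y \<phi> \<psi> where KX: "eilenberg_maclane (G\<lparr>carrier := H\<rparr>) X x \<phi>"
    and KY: "eilenberg_maclane G Y y \<psi>" and pxy: "p x = y"
    and comm: "\<forall>A\<in>carrier (fundamental_group X x). \<psi> (induced_map Y y p A) = \<phi> A"
    by (elim exE conjE)
  have X: "path_connected_space X" "x \<in> topspace X" "\<phi> \<in> iso (fundamental_group X x) (G\<lparr>carrier := H\<rparr>)"
    using KX by (simp_all add: eilenberg_maclane_def)
  have Y: "path_connected_space Y" "y \<in> topspace Y" "\<psi> \<in> iso (fundamental_group Y y) G"
    "\<And>n z. n \<ge> 2 \<Longrightarrow> z \<in> topspace Y \<Longrightarrow> trivial_homotopy_group n Y z"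
    and "CW_complex Y"
    using KY by (simp_all add: eilenberg_maclane_def)
  then obtain \<C> d \<Phi> where "CW_structure Y \<C> d \<Phi>" unfolding CW_complex_def by (elim exE)
  then interpret cw Y \<C> d \<Phi> by unfold_locales
  let ?UC = "universal_cover Y y"
    and ?act = "\<lambda>g. deck_action Y (inv_into (carrier (fundamental_group Y y)) \<psi> g)"
    and ?A = "discrete_topology (lcosets\<^bsub>G\<^esub> H)" and ?\<tau> = "left_translation G H"
  have "\<exists>\<l>. orbit_covering G ?UC ?act Y endpoint H X p \<l>"
    using comm
    by (intro orbit_covering_universal_cover[OF assms(1,3) p locally_path_connected
          semilocally_simply_connected Y(1) X(1,2) pxy Y(3) X(3)]) simp
  then obtain \<l> where "orbit_covering G ?UC ?act Y endpoint H X p \<l>" ..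
  then interpret orbit_covering G ?UC ?act Y endpoint H X p \<l> .
  obtain \<xi> where UC_cells: "free_cells G ?UC ?act \<C> d \<xi>"
    using free_cells_principal_covering[OF principal_covering_axioms cw_axioms] by (elim exE)
  obtain R :: "'e set set" and n \<xi>' where E_cells: "free_cells G E \<alpha> R n \<xi>'"
    using free_cells_EG[OF assms(5)] by (elim exE)
  have UC_fills: "fills_spheres ?UC"
    by (rule fills_spheres_universal_cover[OF covering Y(2,4)])
  have E_fills: "fills_spheres E"
    using assms(5) by (intro fills_spheres_contractible) (simp_all add: is_EG_def)
  have "sections_le X Y p k \<longleftrightarrow> genus_le G ?A ?\<tau> E \<alpha> k" for k
    using sections_le_iff_genus_le genus_le_iff_of_free_cells[OF UC_cells UC_fills E_cells E_fills] by simp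
  then show ?thesis
    by (simp add: secat_covering[OF p] genus_singleton)
qed


end
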